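(* Let $\epsilon\in(0,1]$ be sufficiently small, $2<r\le\frac83$, and let $u^{\epsilon}_D$ be the solution to the deterministic Cahn-Hilliard equation described in the context. Then for any $\alpha>0$ (arbitrarily small), $\gamma>\frac{(7-2\alpha)r+6\alpha-8}{r-2}$ and $K$ (the parameter of the approximation $u^{\epsilon}_{\mathsf{A}}$ in the context) large enough such that $\frac32(K-1)\ge\gamma$, there exists a constant $C=C(r)>0$ independent of $\epsilon$ such that $$\sup_{t\in[0,T]}\Vert u^{\epsilon}_D-u^{\epsilon}_{\mathsf{A}}\Vert^2_{\mathbb{H}^{-1}}+\epsilon^4\Vert u^{\epsilon}_D-u^{\epsilon}_{\mathsf{A}}\Vert^2_{L^2(0,T;\mathbb{H}^1)}+\frac{13}{8\epsilon}\Vert u^{\epsilon}_D-u^{\epsilon}_{\mathsf{A}}\Vert^4_{L^4(0,T;\mathbb{L}^4)}\le C\epsilon^{\gamma-1}.$$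
   Context: Setting: $d\in\{2,3\}$, $\mathcal{D}=(0,1)^d$ with outer unit normal $\vec n$, $T>0$ fixed, $\mathcal{D}_T=(0,T)\times\mathcal{D}$, $f(u)=F'(u)=u^3-u$, $F(u)=\frac14(u^2-1)^2$. $\mathbb{L}^p=L^p(\mathcal{D})$, $\mathbb{H}^s=H^s(\mathcal{D})$, $\Delta$ is the Neumann Laplacian, $m(g)$ is the mean value of $g$ over $\mathcal{D}$, and $\Vert v\Vert_{\mathbb{H}^{-1}}=(\Vert(-\Delta)^{-1/2}v\Vert_{\mathbb{L}^2}^2+m(v)^2)^{1/2}$, where $(-\Delta)^{-1/2}$ acts on the mean-zero part. Deterministic Cahn-Hilliard equation: $u^{\epsilon}_D$ solves $$\partial_tu^{\epsilon}_D=\Delta w^{\epsilon}_D,\qquad w^{\epsilon}_D=-\epsilon\Delta u^{\epsilon}_D+\tfrac1\epsilon f(u^{\epsilon}_D)\quad\text{in }\mathcal{D}_T,$$ with $\partial_{\vec n}u^{\epsilon}_D=\partial_{\vec n}\Delta u^{\epsilon}_D=0$ on $(0,T)\times\partial\mathcal{D}$ and initial value $u^{\epsilon}_D(0)=u^{\epsilon}_{\mathsf{A}}(0)$. Approximate solution: it is assumed throughout that for a given smooth closed hypersurface $\Gamma_{00}\subset\mathcal{D}$ the Hele-Shaw problem $$\Delta v=0\text{ in }\mathcal{D}\setminus\Gamma_t,\quad \partial_{\vec n}v=0\text{ on }\partial\mathcal{D},\quad v=\lambda H\text{ on }\Gamma_t,\quad \mathcal{V}=\tfrac12(\partial_{\vec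 n_\Gamma}v^+-\partial_{\vec n_\Gamma}v^-)\text{ on }\Gamma_t,\quad \Gamma_0=\Gamma_{00},$$ has a smooth solution $(v,\{\Gamma_t\}_{t\in[0,T]})$ ($H$ mean curvature, $\mathcal{V}$ normal velocity, $\vec n_\Gamma$ unit normal of $\Gamma_t$, $v^{\pm}$ restrictions of $v$ to the exterior/interior of $\Gamma_t$, $\lambda$ a constant determined by $F$). Then for any $K>0$ there is the approximation $(u^{\epsilon}_{\mathsf{A}},w^{\epsilon}_{\mathsf{A}},r^{\epsilon}_{\mathsf{A}})$ constructed by Alikakos, Bates and Chen (Arch. Rational Mech. Anal. 128, 1994), which satisfies $$\partial_tu^{\epsilon}_{\mathsf{A}}=\Delta w^{\epsilon}_{\mathsf{A}},\qquad w^{\epsilon}_{\mathsf{A}}=-\epsilon\Delta u^{\epsilon}_{\mathsf{A}}+\tfrac1\epsilon f(u^{\epsilon}_{\mathsf{A}})+r^{\epsilon}_{\mathsf{A}}\quad\text{in }\mathcal{D}_T,$$ with the same (Neumann) boundary conditions as $u^\epsilon_D$ (so the spatial mean of $u^{\epsilon}_{\mathsf{A}}$ is conserved), and, with $C$ independent of $\epsilon$: $\Vert r^{\epsilon}_{\mathsf{A}}\Vert_{C(\mathcal{D}_T)}\le C\epsilon^{K-2}$, $\Vert w^{\epsilon}_{\mathsf{A}}-v\Vert_{C(\mathcal{D}_T)}\le C\epsilon$, $u^{\epsilon}_{\mathsf{A}}$ is bounded on $\mathcal{D}_T$ uniformly in $\epsilon$, and the spectral estimate holds: for all $t\in[0,T]$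 and all $w\in\mathbb{H}^1$ with $\int_{\mathcal{D}}w\,dx=0$, $$\int_{\mathcal{D}}\left(\epsilon|\nabla w|^2+\tfrac1\epsilon f'(u^{\epsilon}_{\mathsf{A}})w^2\right)dx\ge -C_0\Vert w\Vert^2_{\mathbb{H}^{-1}},$$ with $C_0\ge0$ independent of $w$ and $\epsilon$. *)

theory Defs
  imports "HOL-Analysis.Analysis"
begin

section \<open>Derivatives up to the boundary\<close>

text \<open>Derivatives are taken within a set \<open>S\<close>, so that they also make sense on the boundary. For
  \<open>S\<close> a nondegenerate closed box or the whole space, the derivative within \<open>S\<close> is unique.\<close>

definition dpart :: "'a::euclidean_space set \<Rightarrow> 'a \<Rightarrow> ('a \<Rightarrow> real) \<Rightarrow> 'a \<Rightarrow> real" where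
  "dpart S b g x = frechet_derivative g (at x within S) b"

primrec dparts :: "'a::euclidean_space set \<Rightarrow> 'a list \<Rightarrow> ('a \<Rightarrow> real) \<Rightarrow> 'a \<Rightarrow> real" where
  "dparts S [] g = g"
| "dparts S (b # bs) g = dpart S b (dparts S bs g)"

definition smooth_up_to :: "'a::euclidean_space set \<Rightarrow> ('a \<Rightarrow> real) \<Rightarrow> bool" where
  "smooth_up_to S g \<longleftrightarrow> (\<forall>bs. set bs \<subseteq> Basis \<longrightarrow> dparts S bs g differentiable_on S)"

section \<open>The unit cube and classical differential operators\<close>

abbreviation cube :: "(real^'n) set" where
  "cube \<equiv> box 0 1"

abbreviation ccube :: "(real^'n) set" where
  "ccube \<equiv> cbox 0 1"

abbreviation pd :: "'n \<Rightarrow> (real^'n \<Rightarrow> real) \<Rightarrow> real^'n \<Rightarrow> real" where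
  "pd i \<equiv> dpart ccube (axis i 1)"

definition grad :: "(real^'n \<Rightarrow> real) \<Rightarrow> real^'n \<Rightarrow> real^'n" where
  "grad g x = (\<chi> i. pd i g x)"

definition divergence :: "(real^'n \<Rightarrow> real^'n) \<Rightarrow> real^'n \<Rightarrow> real" where
  "divergence V x = (\<Sum>i\<in>UNIV. pd i (\<lambda>y. V y $ i) x)"

definition laplacian :: "(real^'n \<Rightarrow> real) \<Rightarrow> real^'n \<Rightarrow> real" where
  "laplacian g x = (\<Sum>i\<in>UNIV. pd i (pd i g) x)"

text \<open>On the faces \<open>x $ i = 0\<close> and \<open>x $ i = 1\<close> the outer normal derivative is minus, respectively
  plus, the \<open>i\<close>-th partial derivative. For functions that are \<open>C\<^sup>1\<close> up to the boundary, including
  the edges and corners is no restriction.\<close>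

definition zero_normal_deriv :: "(real^'n \<Rightarrow> real) \<Rightarrow> bool" where
  "zero_normal_deriv g \<longleftrightarrow> (\<forall>x\<in>ccube. \<forall>i. x $ i = 0 \<or> x $ i = 1 \<longrightarrow> pd i g x = 0)"

text \<open>All spatial derivatives of order at most \<open>k\<close> exist and are continuous on \<open>[0,T]\<close> times the
  closed cube.\<close>

definition spatially_Ck :: "nat \<Rightarrow> real \<Rightarrow> (real \<Rightarrow> real^'n \<Rightarrow> real) \<Rightarrow> bool" where
  "spatially_Ck k T u \<longleftrightarrow>
    (\<forall>bs. set bs \<subseteq> Basis \<and> length bs \<le> k \<longrightarrow>
       continuous_on ({0..T} \<times> ccube) (\<lambda>(t, x). dparts ccube bs (u t) x) \<and>
       (length bs < k \<longrightarrow> (\<forall>t\<in>{0..T}. dparts ccube bs (u t) differentiable_on ccube)))"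

section \<open>Function spaces on the cube\<close>

definition L2 :: "(real^'n \<Rightarrow> real) \<Rightarrow> bool" where
  "L2 g \<longleftrightarrow> g \<in> borel_measurable (lebesgue_on cube) \<and> integrable (lebesgue_on cube) (\<lambda>x. (g x)\<^sup>2)"

definition Lp_norm :: "nat \<Rightarrow> (real^'n \<Rightarrow> real) \<Rightarrow> real" where
  "Lp_norm p g = root p (LINT x|lebesgue_on cube. \<bar>g x\<bar> ^ p)"

definition mean :: "(real^'n \<Rightarrow> real) \<Rightarrow> real" where
  "mean g = (LINT x|lebesgue_on cube. g x) / measure lebesgue (cube :: (real^'n) set)"

definition test_function :: "(real^'n \<Rightarrow> real) \<Rightarrow> bool" where
  "test_function \<phi> \<longleftrightarrow> smooth_up_to UNIV \<phi> \<and>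
     compact (closure {x. \<phi> x \<noteq> 0}) \<and> closure {x. \<phi> x \<noteq> 0} \<subseteq> cube"

definition has_weak_gradient :: "(real^'n \<Rightarrow> real) \<Rightarrow> (real^'n \<Rightarrow> real^'n) \<Rightarrow> bool" where
  "has_weak_gradient g G \<longleftrightarrow> L2 g \<and> (\<forall>i. L2 (\<lambda>x. G x $ i)) \<and>
     (\<forall>\<phi> i. test_function \<phi> \<longrightarrow>
        (LINT x|lebesgue_on cube. g x * dpart UNIV (axis i 1) \<phi> x)
          = - (LINT x|lebesgue_on cube. G x $ i * \<phi> x))"

definition H1 :: "(real^'n \<Rightarrow> real) \<Rightarrow> bool" where
  "H1 g \<longleftrightarrow> (\<exists>G. has_weak_gradient g G)"

text \<open>Determined up to a null set for \<open>g\<close> in \<open>H1\<close>.\<close>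

definition weak_grad :: "(real^'n \<Rightarrow> real) \<Rightarrow> real^'n \<Rightarrow> real^'n" where
  "weak_grad g = (SOME G. has_weak_gradient g G)"

definition H1_norm :: "(real^'n \<Rightarrow> real) \<Rightarrow> real" where
  "H1_norm g = sqrt ((Lp_norm 2 g)\<^sup>2 + (Lp_norm 2 (\<lambda>x. norm (weak_grad g x)))\<^sup>2)"

text \<open>Orthonormal basis of eigenfunctions, and eigenvalues, of minus the Neumann Laplacian on the
  cube.\<close>

definition neumann_eigenfun :: "nat^'n \<Rightarrow> real^'n \<Rightarrow> real" where
  "neumann_eigenfun k x =
     (\<Prod>i\<in>UNIV. if k $ i = 0 then 1 else sqrt 2 * cos (pi * real (k $ i) * x $ i))"

definition neumann_eigenval :: "nat^'n \<Rightarrow> real" where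
  "neumann_eigenval k = pi\<^sup>2 * (\<Sum>i\<in>UNIV. (real (k $ i))\<^sup>2)"

text \<open>\<open>has_inv_sqrt_neumann g h\<close>: \<open>h\<close> is the image of the mean-zero part of \<open>g\<close> under the power
  \<open>-1/2\<close> of minus the Neumann Laplacian, that is, the \<open>L2\<close>-convergent spectral series over the
  nonconstant modes. It is determined by \<open>g\<close> up to a null set and exists for every \<open>g\<close> in \<open>L2\<close>.\<close>

definition has_inv_sqrt_neumann :: "(real^'n \<Rightarrow> real) \<Rightarrow> (real^'n \<Rightarrow> real) \<Rightarrow> bool" where
  "has_inv_sqrt_neumann g h \<longleftrightarrow> L2 h \<and>
     ((\<lambda>A. Lp_norm 2 (\<lambda>x. h x -
         (\<Sum>k\<in>A. (LINT y|lebesgue_on cube. g y * neumann_eigenfun k y)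
                    / sqrt (neumann_eigenval k) * neumann_eigenfun k x))) \<longlongrightarrow> 0)
       (finite_subsets_at_top {k. k \<noteq> 0})"

definition inv_sqrt_neumann :: "(real^'n \<Rightarrow> real) \<Rightarrow> real^'n \<Rightarrow> real" where
  "inv_sqrt_neumann g = (SOME h. has_inv_sqrt_neumann g h)"

definition Hm1_norm :: "(real^'n \<Rightarrow> real) \<Rightarrow> real" where
  "Hm1_norm g = sqrt ((Lp_norm 2 (inv_sqrt_neumann g))\<^sup>2 + (mean g)\<^sup>2)"

section \<open>The Hele-Shaw problem\<close>

text \<open>The moving hypersurface is the zero level set of a smooth function \<open>\<phi> t\<close> with nonvanishing
  gradient on it, negative inside and positive outside (in particular on the boundary of the cube).
  The normal pointing to the exterior is then \<open>grad \<phi> / |grad \<phi>|\<close> and the normal velocity is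
  \<open>- \<partial>\<^sub>t \<phi> / |grad \<phi>|\<close>. Mean curvature is the sum of the principal curvatures, positive for spheres.\<close>

definition unit_normal :: "(real^'n \<Rightarrow> real) \<Rightarrow> real^'n \<Rightarrow> real^'n" where
  "unit_normal \<phi> x = grad \<phi> x /\<^sub>R norm (grad \<phi> x)"

definition mean_curvature :: "(real^'n \<Rightarrow> real) \<Rightarrow> real^'n \<Rightarrow> real" where
  "mean_curvature \<phi> x = divergence (unit_normal \<phi>) x"

definition normal_velocity :: "real \<Rightarrow> (real \<Rightarrow> real^'n \<Rightarrow> real) \<Rightarrow> real \<Rightarrow> real^'n \<Rightarrow> real" where
  "normal_velocity T \<phi> t x =
     - vector_derivative (\<lambda>s. \<phi> s x) (at t within {0..T}) / norm (grad (\<phi> t) x)"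

text \<open>\<open>vp\<close> and \<open>vm\<close> are smooth extensions of the restrictions of \<open>v\<close> to the exterior and to the
  interior; only their values on the closures of these regions matter.\<close>

definition hele_shaw_solution ::
  "real \<Rightarrow> real \<Rightarrow> (real^'n) set \<Rightarrow> (real \<Rightarrow> real^'n \<Rightarrow> real) \<Rightarrow> (real \<Rightarrow> (real^'n) set) \<Rightarrow> bool"
where
  "hele_shaw_solution T lam \<Gamma>\<^sub>0 v \<Gamma> \<longleftrightarrow>
    (\<exists>\<phi> vp vm.
       smooth_up_to ({0..T} \<times> ccube) (\<lambda>(t, x). \<phi> t x) \<and>
       smooth_up_to ({0..T} \<times> ccube) (\<lambda>(t, x). vp t x) \<and>
       smooth_up_to ({0..T} \<times> ccube) (\<lambda>(t, x). vm t x) \<and>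
       \<Gamma> 0 = \<Gamma>\<^sub>0 \<and> \<Gamma>\<^sub>0 \<noteq> {} \<and>
       (\<forall>t\<in>{0..T}.
          \<Gamma> t = {x\<in>cube. \<phi> t x = 0} \<and>
          (\<forall>x\<in>\<Gamma> t. grad (\<phi> t) x \<noteq> 0) \<and>
          (\<forall>x\<in>ccube - cube. \<phi> t x > 0) \<and>
          (\<forall>x\<in>ccube. \<phi> t x \<ge> 0 \<longrightarrow> v t x = vp t x) \<and>
          (\<forall>x\<in>ccube. \<phi> t x \<le> 0 \<longrightarrow> v t x = vm t x) \<and>
          (\<forall>x\<in>cube. \<phi> t x > 0 \<longrightarrow> laplacian (vp t) x = 0) \<and>
          (\<forall>x\<in>cube. \<phi> t x < 0 \<longrightarrow> laplacian (vm t) x = 0) \<and>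
          zero_normal_deriv (vp t) \<and>
          (\<forall>x\<in>\<Gamma> t. v t x = lam * mean_curvature (\<phi> t) x) \<and>
          (\<forall>x\<in>\<Gamma> t. normal_velocity T \<phi> t x =
             1/2 * (grad (vp t) x \<bullet> unit_normal (\<phi> t) x - grad (vm t) x \<bullet> unit_normal (\<phi> t) x))))"

section \<open>The Cahn--Hilliard equation and its approximate solution\<close>

definition ch_f :: "real \<Rightarrow> real" where
  "ch_f s = s ^ 3 - s"

text \<open>The Cahn--Hilliard system with residual \<open>\<rho>\<close> in the equation for the chemical potential \<open>w\<close>,
  in the classical sense.\<close>

definition ch_system ::
  "real \<Rightarrow> real \<Rightarrow> (real \<Rightarrow> real^'n \<Rightarrow> real) \<Rightarrow> (real \<Rightarrow> real^'n \<Rightarrow> real) \<Rightarrow> (real \<Rightarrow> real^'n \<Rightarrow> real) \<Rightarrow> bool"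
where
  "ch_system T \<epsilon> \<rho> u w \<longleftrightarrow>
     spatially_Ck 4 T u \<and> spatially_Ck 2 T w \<and>
     (\<forall>t\<in>{0<..<T}. \<forall>x\<in>cube.
        ((\<lambda>s. u s x) has_real_derivative laplacian (w t) x) (at t) \<and>
        w t x = - \<epsilon> * laplacian (u t) x + 1/\<epsilon> * ch_f (u t x) + \<rho> t x) \<and>
     (\<forall>t\<in>{0<..<T}. zero_normal_deriv (u t) \<and> zero_normal_deriv (laplacian (u t)))"

definition ch_solution ::
  "real \<Rightarrow> real \<Rightarrow> (real^'n \<Rightarrow> real) \<Rightarrow> (real \<Rightarrow> real^'n \<Rightarrow> real) \<Rightarrow> (real \<Rightarrow> real^'n \<Rightarrow> real) \<Rightarrow> bool"
where
  "ch_solution T \<epsilon> u0 u w \<longleftrightarrow>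
     ch_system T \<epsilon> (\<lambda>t x. 0) u w \<and> (\<forall>x\<in>cube. u 0 x = u0 x)"

text \<open>For the approximate solution the Neumann conditions include \<open>\<partial>\<^sub>n w = 0\<close>, which is what makes
  the spatial mean conserved. For the exact solution this already follows from the other two boundary
  conditions.\<close>

definition ch_approximation ::
  "real \<Rightarrow> real \<Rightarrow> real \<Rightarrow> (real \<Rightarrow> real^'n \<Rightarrow> real)
     \<Rightarrow> (real \<Rightarrow> real \<Rightarrow> real^'n \<Rightarrow> real) \<Rightarrow> (real \<Rightarrow> real \<Rightarrow> real^'n \<Rightarrow> real)
     \<Rightarrow> (real \<Rightarrow> real \<Rightarrow> real^'n \<Rightarrow> real) \<Rightarrow> bool"
where
  "ch_approximation T K \<epsilon>\<^sub>1 v uA wA rA \<longleftrightarrow>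
    (\<exists>C C\<^sub>0. C \<ge> 0 \<and> C\<^sub>0 \<ge> 0 \<and> (\<forall>\<epsilon>\<in>{0<..\<epsilon>\<^sub>1}.
       ch_system T \<epsilon> (rA \<epsilon>) (uA \<epsilon>) (wA \<epsilon>) \<and>
       (\<forall>t\<in>{0<..<T}. zero_normal_deriv (wA \<epsilon> t)) \<and>
       (\<forall>t\<in>{0<..<T}. \<forall>x\<in>cube.
          \<bar>rA \<epsilon> t x\<bar> \<le> C * \<epsilon> powr (K - 2) \<and>
          \<bar>wA \<epsilon> t x - v t x\<bar> \<le> C * \<epsilon> \<and>
          \<bar>uA \<epsilon> t x\<bar> \<le> C) \<and>
       (\<forall>t\<in>{0..T}. \<forall>g. H1 g \<and> (LINT x|lebesgue_on cube. g x) = 0 \<longrightarrow>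
          (LINT x|lebesgue_on cube.
              \<epsilon> * (norm (weak_grad g x))\<^sup>2 + 1/\<epsilon> * deriv ch_f (uA \<epsilon> t x) * (g x)\<^sup>2)
            \<ge> - C\<^sub>0 * (Hm1_norm g)\<^sup>2)))"

end

theory Submission imports Defs begin

text \<open>The error \<open>e = u\<^sub>D - u\<^sub>A\<close> vanishes initially and satisfies \<open>\<partial>\<^sub>t e = \<Delta> z\<close>, where
  \<open>z = - \<epsilon> \<Delta> e + (f(u\<^sub>A + e) - f(u\<^sub>A)) / \<epsilon> - r\<^sub>A\<close>. Write \<open>Y\<close> for its squared norm in \<open>H\<^sup>-\<^sup>1\<close>, \<open>X\<close> for the squared
  norm of its gradient in \<open>L\<^sup>2\<close>, and \<open>Z\<close> for the integral of \<open>e\<^sup>4\<close>. Testing with the inverse Neumann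
  Laplacian of \<open>e\<close> gives \<open>Y' = - 2 (e, z)\<close> (\<open>hm1_evolution\<close>), and since
  \<open>(f(u\<^sub>A + e) - f(u\<^sub>A)) e = f'(u\<^sub>A) e\<^sup>2 + 3 u\<^sub>A e\<^sup>3 + e\<^sup>4\<close>, the quadratic terms are those of the spectral estimate.
  Weighting that estimate with \<open>1 - \<epsilon>\<^sup>3\<close>, and the trivial bound \<open>f' \<ge> -1\<close> with \<open>\<epsilon>\<^sup>3\<close>, leaves the dissipation
  \<open>\<epsilon>\<^sup>4 X + Z / \<epsilon>\<close> up to constants, at the price of a multiple of \<open>Y\<close>. The residual contributes
  \<open>C \<epsilon>\<close> to the power \<open>2 K - 6\<close> (\<open>energy_inequality\<close>).

  The obstacle is the cubic term, of size \<open>1/\<epsilon>\<close> times the integral of \<open>|e|\<^sup>3\<close>: it can be absorbed into the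
  dissipation only while \<open>Y\<close> is small. For this, \<open>e\<close> is split by
  frequency. The part of \<open>e\<close> with frequencies up to \<open>N\<close> is bounded pointwise by the
  square root of \<open>N\<^sup>5 Y\<close>, because the dimension is at most three, and the rest has squared \<open>L\<^sup>2\<close> norm at most
  \<open>X / N\<^sup>2\<close>. Two cut-offs of orders \<open>\<epsilon>\<^sup>-\<^sup>3\<close> and \<open>\<epsilon>\<^sup>-\<^sup>2\<close>, one for large and one for intermediate values of \<open>|e|\<close>,
  absorb the cubic term as long as \<open>Y\<close> is below a small multiple of \<open>\<epsilon>\<^sup>1\<^sup>7\<close> (\<open>cubic_estimate\<close>).

  The conditions on \<open>r\<close>, \<open>\<alpha>\<close> and \<open>\<gamma>\<close> force \<open>\<gamma> > 16\<close> and hence \<open>K > 35/3\<close> (\<open>gamma_bound\<close>). Then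
  \<open>2 K - 6 > 17\<close>, so Gronwall's inequality keeps \<open>Y\<close> of the order \<open>2 K - 6\<close> in \<open>\<epsilon>\<close>, below the threshold, on all of
  \<open>[0,T]\<close> (\<open>bootstrap\<close>). The same order bounds the integrated dissipation, and it is at least
  \<open>\<gamma> - 1\<close>. The constants depend on neither \<open>\<alpha>\<close> nor \<open>\<gamma>\<close>.

  Two things have to be supplied before the definitions can be used in this way. The negative norm is defined
  by a choice among limits of spectral series, so the cosine functions are shown to be an orthonormal
  system with Parseval's identity (\<open>parseval\<close>), and the series to converge with the expected norm
  (\<open>Hm1_norm_sq\<close>). The weak gradient is defined by a choice as well and is shown to agree
  almost everywhere with the classical one (\<open>weak_grad_classical\<close>).\<close>

section \<open>Calculus on the closed cube\<close>

abbreviation cint :: "(real^'n \<Rightarrow> real) \<Rightarrow> real" where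
  "cint g \<equiv> LINT x|lebesgue_on cube. g x"

lemma integrable_cube:
  fixes g :: "real^'n \<Rightarrow> real"
  assumes "continuous_on ccube g"
  shows "integrable (lebesgue_on cube) g"
proof -
  have "g absolutely_integrable_on ccube"
    using assms by (rule absolutely_integrable_continuous)
  then have "g absolutely_integrable_on cube"
    by (rule set_integrable_subset) (auto simp: box_subset_cbox)
  then show ?thesis by (rule absolutely_integrable_imp_integrable) auto
qed

lemma cint_eq_integral:
  fixes g :: "real^'n \<Rightarrow> real"
  assumes "continuous_on ccube g"
  shows "cint g = integral ccube g"
  using lebesgue_integral_eq_integral[OF integrable_cube[OF assms]] integral_open_interval[of 0 1 g]
  by simp

lemma measure_cube: "measure lebesgue (cube :: (real^'n) set) = 1"
proof -
  have "measure lebesgue (cube :: (real^'n) set) = measure lborel (ccube :: (real^'n) set)"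
    by (simp add: measure_def emeasure_lborel_box_eq emeasure_lborel_cbox_eq)
  also have "\<dots> = 1"
    by (subst content_cbox_cart) (auto simp: mem_box_cart simp flip: ex_in_conv intro!: exI[of _ 0])
  finally show ?thesis .
qed

lemma cint_const: "cint (\<lambda>x::real^'n. c) = c"
  by (simp add: measure_restrict_space measure_cube)

lemma cint_cong:
  fixes f g :: "real^'n \<Rightarrow> real"
  shows "(\<And>x. x \<in> cube \<Longrightarrow> f x = g x) \<Longrightarrow> cint f = cint g"
  by (rule Bochner_Integration.integral_cong) auto

lemma cint_mono:
  fixes f g :: "real^'n \<Rightarrow> real"
  assumes "continuous_on ccube f" "continuous_on ccube g" "\<And>x. x \<in> cube \<Longrightarrow> f x \<le> g x"
  shows "cint f \<le> cint g"
  by (rule integral_mono) (use assms integrable_cube in auto)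

lemma cint_add:
  fixes f g :: "real^'n \<Rightarrow> real"
  assumes "continuous_on ccube f" "continuous_on ccube g"
  shows "cint (\<lambda>x. f x + g x) = cint f + cint g"
  by (rule Bochner_Integration.integral_add) (use assms integrable_cube in auto)

lemma cint_diff:
  fixes f g :: "real^'n \<Rightarrow> real"
  assumes "continuous_on ccube f" "continuous_on ccube g"
  shows "cint (\<lambda>x. f x - g x) = cint f - cint g"
  by (rule Bochner_Integration.integral_diff) (use assms integrable_cube in auto)

lemma cint_sum:
  fixes f :: "'a \<Rightarrow> real^'n \<Rightarrow> real"
  assumes "\<And>k. k \<in> A \<Longrightarrow> continuous_on ccube (f k)"
  shows "cint (\<lambda>x. \<Sum>k\<in>A. f k x) = (\<Sum>k\<in>A. cint (f k))"
  by (rule Bochner_Integration.integral_sum) (use assms integrable_cube in auto)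

lemma cint_nonneg:
  fixes f :: "real^'n \<Rightarrow> real"
  shows "(\<And>x. x \<in> cube \<Longrightarrow> 0 \<le> f x) \<Longrightarrow> 0 \<le> cint f"
  by (rule Bochner_Integration.integral_nonneg) auto

lemma mem_ccube: "(x::real^'n) \<in> ccube \<longleftrightarrow> (\<forall>i. 0 \<le> x $ i \<and> x $ i \<le> 1)"
  by (simp add: mem_box_cart)

lemma mem_cube: "(x::real^'n) \<in> cube \<longleftrightarrow> (\<forall>i. 0 < x $ i \<and> x $ i < 1)"
  by (simp add: mem_box_cart)

lemma cube_subset_ccube: "(cube :: (real^'n) set) \<subseteq> ccube"
  by (simp add: box_subset_cbox)

lemma closure_cube: "closure (cube :: (real^'n) set) = ccube"
  by (rule closure_box) (auto simp: mem_box_cart intro!: exI[of _ "\<chi> i. 1/2"] simp flip: ex_in_conv)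

lemma pd_eq:
  fixes g :: "real^'n \<Rightarrow> real"
  assumes "(g has_derivative D) (at x within ccube)" "x \<in> ccube"
  shows "pd i g x = D (axis i 1)"
proof -
  have "frechet_derivative g (at x within ccube) = D"
    by (rule frechet_derivative_within_cbox) (use assms in \<open>auto simp: Basis_vec_def inner_axis\<close>)
  then show ?thesis by (simp add: dpart_def)
qed

lemma pd_has_derivative:
  fixes g :: "real^'n \<Rightarrow> real"
  assumes "g differentiable_on ccube" "x \<in> ccube"
  shows "\<exists>D. (g has_derivative D) (at x within ccube) \<and> (\<forall>i. D (axis i 1) = pd i g x)"
proof -
  obtain D where D: "(g has_derivative D) (at x within ccube)"
    using assms unfolding differentiable_on_def differentiable_def by blast
  then show ?thesis using pd_eq[OF D assms(2)] by (intro exI[of _ D]) simp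
qed

lemma pd_cong:
  fixes f g :: "real^'n \<Rightarrow> real"
  assumes "\<And>y. y \<in> ccube \<Longrightarrow> f y = g y" "x \<in> ccube"
  shows "pd i f x = pd i g x"
proof -
  have "(f has_derivative D) (at x within ccube) \<longleftrightarrow> (g has_derivative D) (at x within ccube)" for D
  proof
    show "(g has_derivative D) (at x within ccube)" if "(f has_derivative D) (at x within ccube)"
      by (rule has_derivative_transform[OF assms(2) _ that]) (simp add: assms(1))
    show "(f has_derivative D) (at x within ccube)" if "(g has_derivative D) (at x within ccube)"
      by (rule has_derivative_transform[OF assms(2) _ that]) (simp add: assms(1))
  qed
  then show ?thesis by (simp add: dpart_def frechet_derivative_def)
qed

lemma pd_add:
  fixes f g :: "real^'n \<Rightarrow> real"
  assumes "f differentiable_on ccube" "g differentiable_on ccube" "x \<in> ccube"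
  shows "pd i (\<lambda>y. f y + g y) x = pd i f x + pd i g x"
proof -
  obtain D E where *: "(f has_derivative D) (at x within ccube)" "(g has_derivative E) (at x within ccube)"
     "D (axis i 1) = pd i f x" "E (axis i 1) = pd i g x"
    using pd_has_derivative[OF assms(1,3)] pd_has_derivative[OF assms(2,3)] by blast
  show ?thesis using pd_eq[OF has_derivative_add[OF *(1,2)] assms(3)] *(3,4) by simp
qed

lemma pd_diff:
  fixes f g :: "real^'n \<Rightarrow> real"
  assumes "f differentiable_on ccube" "g differentiable_on ccube" "x \<in> ccube"
  shows "pd i (\<lambda>y. f y - g y) x = pd i f x - pd i g x"
proof -
  obtain D E where *: "(f has_derivative D) (at x within ccube)" "(g has_derivative E) (at x within ccube)"
     "D (axis i 1) = pd i f x" "E (axis i 1) = pd i g x"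
    using pd_has_derivative[OF assms(1,3)] pd_has_derivative[OF assms(2,3)] by blast
  show ?thesis using pd_eq[OF has_derivative_diff[OF *(1,2)] assms(3)] *(3,4) by simp
qed

lemma pd_mult:
  fixes f g :: "real^'n \<Rightarrow> real"
  assumes "f differentiable_on ccube" "g differentiable_on ccube" "x \<in> ccube"
  shows "pd i (\<lambda>y. f y * g y) x = pd i f x * g x + f x * pd i g x"
proof -
  obtain D E where *: "(f has_derivative D) (at x within ccube)" "(g has_derivative E) (at x within ccube)"
     "D (axis i 1) = pd i f x" "E (axis i 1) = pd i g x"
    using pd_has_derivative[OF assms(1,3)] pd_has_derivative[OF assms(2,3)] by blast
  show ?thesis using pd_eq[OF has_derivative_mult[OF *(1,2)] assms(3)] *(3,4) by simp
qed

text \<open>Derivatives are taken within the closed cube, so that boundary values of the gradient make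
  sense and Green's formula has no boundary layer to approximate away.\<close>

definition C1 :: "(real^'n \<Rightarrow> real) \<Rightarrow> bool" where
  "C1 g \<longleftrightarrow> g differentiable_on ccube \<and> (\<forall>i. continuous_on ccube (pd i g))"

definition C2 :: "(real^'n \<Rightarrow> real) \<Rightarrow> bool" where
  "C2 g \<longleftrightarrow> C1 g \<and> (\<forall>i. C1 (pd i g))"

lemma C1_continuous: "C1 g \<Longrightarrow> continuous_on ccube g"
  by (simp add: C1_def differentiable_imp_continuous_on)

lemma C1_cong:
  assumes "\<And>y. y \<in> ccube \<Longrightarrow> f y = g y" "C1 f" shows "C1 g"
proof -
  have "g differentiable_on ccube"
    using assms differentiable_transform_within[of f _ ccube 1 g] by (auto simp: C1_def differentiable_on_def)
  moreover have "continuous_on ccube (pd i g)" for i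
    by (rule continuous_on_eq[of _ "pd i f"]) (use assms pd_cong[of f g] in \<open>auto simp: C1_def\<close>)
  ultimately show ?thesis by (simp add: C1_def)
qed

lemma C1_add: assumes "C1 f" "C1 g" shows "C1 (\<lambda>y. f y + g y)"
  unfolding C1_def
proof (intro conjI allI)
  show "(\<lambda>y. f y + g y) differentiable_on ccube" using assms by (simp add: C1_def differentiable_on_add)
  have "continuous_on ccube (\<lambda>x. pd i f x + pd i g x)" for i
    using assms by (auto simp: C1_def intro!: continuous_intros)
  then show "continuous_on ccube (pd i (\<lambda>y. f y + g y))" for i
    by (rule continuous_on_eq) (use assms in \<open>simp add: pd_add C1_def\<close>)
qed

lemma C1_mult: assumes "C1 f" "C1 g" shows "C1 (\<lambda>y. f y * g y)"
  unfolding C1_def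
proof (intro conjI allI)
  show "(\<lambda>y. f y * g y) differentiable_on ccube" using assms by (simp add: C1_def differentiable_on_mult)
  have "continuous_on ccube (\<lambda>x. pd i f x * g x + f x * pd i g x)" for i
    using assms C1_continuous[OF assms(1)] C1_continuous[OF assms(2)] by (auto simp: C1_def intro!: continuous_intros)
  then show "continuous_on ccube (pd i (\<lambda>y. f y * g y))" for i
    by (rule continuous_on_eq) (use assms in \<open>simp add: pd_mult C1_def\<close>)
qed

lemma C1_const: "C1 (\<lambda>y::real^'n. c)"
proof -
  have "pd i (\<lambda>y. c) x = 0" if "x \<in> ccube" for i and x :: "real^'n"
    using pd_eq[OF has_derivative_const that] by simp
  then have "continuous_on ccube (pd i (\<lambda>y::real^'n. c))" for i
    by (intro continuous_on_eq[OF continuous_on_const[of ccube 0]]) simp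
  then show ?thesis by (simp add: C1_def)
qed

lemma C1_cmult: "C1 g \<Longrightarrow> C1 (\<lambda>y. c * g y)"
  by (rule C1_mult[OF C1_const])

lemma C1_diff: assumes "C1 f" "C1 g" shows "C1 (\<lambda>y. f y - g y)"
  using C1_add[OF assms(1) C1_cmult[OF assms(2), of "-1"]] by simp

lemma C2_diff: assumes "C2 f" "C2 g" shows "C2 (\<lambda>y. f y - g y)"
proof -
  have d: "f differentiable_on ccube" "g differentiable_on ccube" using assms by (auto simp: C2_def C1_def)
  have "C1 (pd i (\<lambda>y. f y - g y))" for i
  proof (rule C1_cong)
    show "C1 (\<lambda>x. pd i f x - pd i g x)" using assms by (intro C1_diff) (auto simp: C2_def)
  qed (simp add: pd_diff d)
  then show ?thesis using assms C1_diff by (auto simp: C2_def)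
qed

lemma laplacian_diff:
  assumes "C2 f" "C2 g" "x \<in> ccube"
  shows "laplacian (\<lambda>y. f y - g y) x = laplacian f x - laplacian g x"
proof -
  have "pd i (pd i (\<lambda>y. f y - g y)) x = pd i (pd i f) x - pd i (pd i g) x" for i
    using assms pd_cong[of "pd i (\<lambda>y. f y - g y)" "\<lambda>x. pd i f x - pd i g x" x i]
    by (simp add: pd_diff C2_def C1_def)
  then show ?thesis by (simp add: laplacian_def sum_subtractf)
qed

lemma C2_continuous_laplacian: "C2 g \<Longrightarrow> continuous_on ccube (laplacian g)"
  unfolding laplacian_def[abs_def] by (intro continuous_intros) (auto simp: C2_def C1_def)

lemma zero_normal_diff:
  assumes "C1 f" "C1 g" "zero_normal_deriv f" "zero_normal_deriv g"
  shows "zero_normal_deriv (\<lambda>y. f y - g y)"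
  using assms unfolding zero_normal_deriv_def C1_def by (simp add: pd_diff)

lemma lipschitz_along_axis:
  fixes g :: "real^'n \<Rightarrow> real"
  assumes g: "g differentiable_on ccube" and B: "\<And>x. x \<in> ccube \<Longrightarrow> \<bar>pd i g x\<bar> \<le> B"
    and xy: "x \<in> ccube" "x + h *\<^sub>R axis i 1 \<in> ccube"
  shows "\<bar>g (x + h *\<^sub>R axis i 1) - g x\<bar> \<le> B * \<bar>h\<bar>"
proof -
  let ?p = "\<lambda>s. x + s *\<^sub>R (h *\<^sub>R axis i 1)"
  have p: "?p s \<in> ccube" if "s \<in> {0..1}" for s
  proof -
    have "(1 - s) *\<^sub>R x + s *\<^sub>R (x + h *\<^sub>R axis i 1) \<in> ccube"
      using convexD_alt[OF convex_box(1) xy] that by auto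
    then show ?thesis by (simp add: algebra_simps)
  qed
  define D where "D = (\<lambda>y. frechet_derivative g (at y within ccube))"
  have D: "(g has_derivative D y) (at y within ccube)" "D y (axis i 1) = pd i g y" if "y \<in> ccube" for y
    using g that by (auto simp: D_def dpart_def differentiable_on_def frechet_derivative_works)
  have der: "((\<lambda>s. g (?p s)) has_derivative (\<lambda>r. D (?p s) (r *\<^sub>R (h *\<^sub>R axis i 1)))) (at s within {0..1})"
    if "s \<in> {0..1}" for s
  proof (rule has_derivative_in_compose2[where t=ccube and g'=D and f="?p"])
    show "(?p has_derivative (\<lambda>r. r *\<^sub>R h *\<^sub>R axis i 1)) (at s within {0..1})"
      by (auto intro!: derivative_eq_intros)
  qed (use p D that in auto)
  obtain s where s: "s \<in> {0..1}" "g (?p 1) - g (?p 0) = D (?p s) ((1 - 0) *\<^sub>R (h *\<^sub>R axis i 1))"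
    using mvt_very_simple[OF _ der] by auto
  have "D (?p s) (h *\<^sub>R axis i 1) = h * pd i g (?p s)"
    using linear_cmul[OF has_derivative_linear[OF D(1)[OF p[OF s(1)]]]] D(2)[OF p[OF s(1)]] by simp
  then have "\<bar>g (?p 1) - g (?p 0)\<bar> = \<bar>h\<bar> * \<bar>pd i g (?p s)\<bar>" using s(2) by (simp add: abs_mult)
  also have "\<dots> \<le> \<bar>h\<bar> * B" using B[OF p[OF s(1)]] by (intro mult_left_mono) auto
  finally show ?thesis by (simp add: mult.commute)
qed

text \<open>Since \<open>g\<close> vanishes on the two faces orthogonal to the \<open>i\<close>-th axis, its extension by zero is
  Lipschitz along that axis. Translation invariance makes the integral of every difference quotient
  of the extension vanish, and dominated convergence passes this on to the derivative. All integrations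
  by parts below reduce to this.\<close>

lemma cint_pd_eq_0:
  fixes g :: "real^'n \<Rightarrow> real"
  assumes g: "C1 g" and face: "\<And>x. x \<in> ccube \<Longrightarrow> x $ i = 0 \<or> x $ i = 1 \<Longrightarrow> g x = 0"
  shows "cint (pd i g) = 0"
proof -
  let ?e = "axis i 1 :: real^'n"
  have gd: "g differentiable_on ccube" and gc: "continuous_on ccube (pd i g)"
    using g by (auto simp: C1_def)
  obtain B where B: "\<And>x. x \<in> ccube \<Longrightarrow> \<bar>pd i g x\<bar> \<le> B" "B \<ge> 0"
  proof -
    have "bounded (pd i g ` ccube)" using gc compact_imp_bounded compact_continuous_image compact_cbox by blast
    then obtain B where "B > 0" "\<forall>y\<in>pd i g ` ccube. norm y \<le> B" unfolding bounded_pos by blast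
    then show ?thesis using that[of B] by auto
  qed
  define F where "F = (\<lambda>x. indicator ccube x *\<^sub>R g x)"
  have Fb[measurable]: "F \<in> borel_measurable borel"
    unfolding F_def by (rule borel_measurable_continuous_on_indicator) (use C1_continuous[OF g] in auto)
  have lip: "\<bar>F (x + h *\<^sub>R ?e) - F x\<bar> \<le> B * \<bar>h\<bar>" for x h
  proof (cases "\<exists>j. j \<noteq> i \<and> \<not> (0 \<le> x $ j \<and> x $ j \<le> 1)")
    case True
    then obtain j where j: "j \<noteq> i" "\<not> (0 \<le> x $ j \<and> x $ j \<le> 1)" by blast
    then have "x \<notin> ccube" by (auto simp: mem_ccube)
    moreover have "x + h *\<^sub>R ?e \<notin> ccube" using j by (auto simp: mem_ccube axis_def intro!: exI[of _ j])
    ultimately show ?thesis using B(2) by (simp add: F_def)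
  next
    case False
    \<comment> \<open>On such lines \<open>F\<close> is \<open>g\<close> composed with the projection onto \<open>[0,1]\<close> of the \<open>i\<close>-th coordinate.\<close>
    define c where "c = (\<lambda>s. max 0 (min 1 s) :: real)"
    define p where "p = (\<lambda>s. x + (c (x $ i + s) - x $ i) *\<^sub>R ?e)"
    have p: "p s \<in> ccube" for s using False by (auto simp: mem_ccube p_def c_def axis_def)
    have "F (x + s *\<^sub>R ?e) = g (p s)" for s
    proof (cases "x $ i + s \<in> {0..1}")
      case True
      then have "p s = x + s *\<^sub>R ?e" by (auto simp: p_def c_def)
      then show ?thesis using p[of s] by (simp add: F_def)
    next
      case out: False
      then have "x + s *\<^sub>R ?e \<notin> ccube" by (auto simp: mem_ccube axis_def intro!: exI[of _ i])
      moreover have "p s $ i = 0 \<or> p s $ i = 1" using out by (auto simp: p_def c_def axis_def)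
      ultimately show ?thesis using face[OF p] by (simp add: F_def)
    qed
    from this[of h] this[of 0] have "\<bar>F (x + h *\<^sub>R ?e) - F x\<bar> = \<bar>g (p h) - g (p 0)\<bar>" by simp
    also have "p h = p 0 + (c (x $ i + h) - c (x $ i)) *\<^sub>R ?e" by (simp add: p_def algebra_simps)
    also have "\<bar>g (p 0 + (c (x $ i + h) - c (x $ i)) *\<^sub>R ?e) - g (p 0)\<bar> \<le> B * \<bar>c (x $ i + h) - c (x $ i)\<bar>"
      by (rule lipschitz_along_axis[OF gd B(1) p]) (use p[of h] in \<open>simp_all add: p_def algebra_simps\<close>)
    also have "\<dots> \<le> B * \<bar>h\<bar>" using B(2) by (intro mult_left_mono) (auto simp: c_def)
    finally show ?thesis .
  qed
  define D where "D = (\<lambda>n x. real (Suc n) * (F (x + (1 / real (Suc n)) *\<^sub>R ?e) - F x))"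
  have Db[measurable]: "D n \<in> borel_measurable borel" for n
    unfolding D_def by measurable
  have Fi: "integrable lborel F"
    unfolding F_def using borel_integrable_compact[of ccube g] C1_continuous[OF g] by auto
  have Fti: "integrable lborel (\<lambda>x. F (x + v))" "(\<integral>x. F (x + v) \<partial>lborel) = (\<integral>x. F x \<partial>lborel)" for v
  proof -
    have "integrable (distr lborel borel ((+) v)) F" "(\<integral>x. F x \<partial>distr lborel borel ((+) v)) = (\<integral>x. F x \<partial>lborel)"
      using Fi by (simp_all add: lborel_distr_plus)
    then show "integrable lborel (\<lambda>x. F (x + v))" "(\<integral>x. F (x + v) \<partial>lborel) = (\<integral>x. F x \<partial>lborel)"
      by (simp_all add: integrable_distr_eq integral_distr add.commute)
  qed
  have D0: "(\<integral>x. D n x \<partial>lborel) = 0" for n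
    unfolding D_def by (simp add: Fti Fi)
  have "(\<lambda>n. \<integral>x. D n x \<partial>lborel) \<longlonglongrightarrow> (\<integral>x. indicator cube x *\<^sub>R pd i g x \<partial>lborel)"
  proof (rule integral_dominated_convergence[where w="\<lambda>x. indicator (cbox (-1) 1) x *\<^sub>R B"])
    have "continuous_on cube (pd i g)" using gc cube_subset_ccube continuous_on_subset by blast
    then show "(\<lambda>x. indicator cube x *\<^sub>R pd i g x) \<in> borel_measurable lborel"
      using borel_measurable_continuous_on_indicator[of cube "pd i g"] by simp
    show "integrable lborel (\<lambda>x::real^'n. indicator (cbox (-1) 1) x *\<^sub>R B)"
      using borel_integrable_compact[of "cbox (-1) 1::(real^'n) set" "\<lambda>_. B"] by auto
    have "AE x in lborel. x \<notin> ccube - (cube::(real^'n) set)"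
    proof -
      have "negligible (ccube - (cube::(real^'n) set))" by (rule negligible_frontier_interval)
      then have "ccube - (cube::(real^'n) set) \<in> null_sets lebesgue" using negligible_iff_null_sets by blast
      moreover have "ccube - (cube::(real^'n) set) \<in> sets lborel" by simp
      ultimately show ?thesis using null_sets_completion_iff by (intro AE_not_in) blast
    qed
    then show "AE x in lborel. (\<lambda>n. D n x) \<longlonglongrightarrow> indicator cube x *\<^sub>R pd i g x"
    proof eventually_elim
      case (elim x)
      have lim: "(\<lambda>n. x + (1 / real (Suc n)) *\<^sub>R ?e) \<longlonglongrightarrow> x"
        using tendsto_add[OF tendsto_const tendsto_scaleR[OF LIMSEQ_inverse_real_of_nat tendsto_const]]
        by (force simp: inverse_eq_divide)
      show ?case
      proof (cases "x \<in> cube")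
        case False
        then have "x \<in> - ccube" using elim by auto
        then have "eventually (\<lambda>n. x + (1 / real (Suc n)) *\<^sub>R ?e \<in> - ccube) sequentially"
          using lim by (intro topological_tendstoD) auto
        then have "eventually (\<lambda>n. D n x = 0) sequentially"
          by eventually_elim (use \<open>x \<in> - ccube\<close> in \<open>simp add: D_def F_def\<close>)
        then show ?thesis using False by (simp add: tendsto_eventually)
      next
        case True
        then have xc: "x \<in> ccube" using cube_subset_ccube by blast
        obtain E where E: "(g has_derivative E) (at x within ccube)" "E ?e = pd i g x"
          using pd_has_derivative[OF gd xc] by blast
        then have "(g has_derivative E) (at x)"
          using True at_within_interior[of x ccube] by (simp add: interior_cbox)
        then have "((\<lambda>s. g (x + s *\<^sub>R ?e)) has_derivative (\<lambda>r. E (r *\<^sub>R ?e))) (at 0)"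
          by (intro has_derivative_compose[of "\<lambda>s. x + s *\<^sub>R ?e" _ 0 UNIV g E, simplified]) (auto intro!: derivative_eq_intros)
        moreover have "(\<lambda>r. E (r *\<^sub>R ?e)) = (*) (pd i g x)"
          using E linear_cmul[OF has_derivative_linear[OF E(1)]] by auto
        ultimately have "((\<lambda>s. g (x + s *\<^sub>R ?e)) has_real_derivative pd i g x) (at 0)"
          by (simp add: has_field_derivative_def)
        then have "((\<lambda>h. (g (x + h *\<^sub>R ?e) - g x) / h) \<longlongrightarrow> pd i g x) (at 0)"
          by (simp add: DERIV_def)
        moreover have "filterlim (\<lambda>n. 1 / real (Suc n)) (at 0) sequentially"
          using LIMSEQ_inverse_real_of_nat by (auto simp: filterlim_at inverse_eq_divide)
        ultimately have *: "(\<lambda>n. (g (x + (1 / real (Suc n)) *\<^sub>R ?e) - g x) / (1 / real (Suc n))) \<longlonglongrightarrow> pd i g x"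
          by (rule filterlim_compose)
        have "eventually (\<lambda>n. x + (1 / real (Suc n)) *\<^sub>R ?e \<in> cube) sequentially"
          using lim True by (intro topological_tendstoD) auto
        then have "eventually (\<lambda>n. (g (x + (1 / real (Suc n)) *\<^sub>R ?e) - g x) / (1 / real (Suc n)) = D n x) sequentially"
        proof eventually_elim
          case (elim n)
          then have "x + (1 / real (Suc n)) *\<^sub>R ?e \<in> ccube" using cube_subset_ccube by blast
          then show ?case using xc by (simp add: D_def F_def)
        qed
        then show ?thesis using * True by (auto dest: Lim_transform_eventually)
      qed
    qed
    show "AE x in lborel. norm (D n x) \<le> indicator (cbox (-1) 1) x *\<^sub>R B" for n
    proof (rule AE_I2)
      fix x :: "real^'n"
      let ?h = "1 / real (Suc n)"
      show "norm (D n x) \<le> indicator (cbox (-1) 1) x *\<^sub>R B"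
      proof (cases "x \<in> cbox (-1) 1")
        case True
        have "norm (D n x) = real (Suc n) * \<bar>F (x + ?h *\<^sub>R ?e) - F x\<bar>"
          by (simp add: D_def abs_mult)
        also have "\<dots> \<le> real (Suc n) * (B * \<bar>?h\<bar>)" by (intro mult_left_mono lip) auto
        finally show ?thesis using True by simp
      next
        case False
        then obtain j where j: "\<not> (-1 \<le> x $ j \<and> x $ j \<le> 1)" by (auto simp: mem_box_cart)
        define h where "h = ?h"
        have h: "h \<le> 1" "h \<ge> 0" by (auto simp: h_def)
        have "x + h *\<^sub>R ?e \<notin> ccube" "x \<notin> ccube"
          using j h unfolding mem_ccube by (auto simp: axis_def intro!: exI[of _ j])
        then show ?thesis using False by (simp add: D_def F_def h_def)
      qed
    qed
  qed auto
  then have "(\<integral>x. indicator cube x *\<^sub>R pd i g x \<partial>lborel) = 0"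
    using LIMSEQ_unique[OF _ tendsto_const[of 0]] by (simp add: D0)
  moreover have "(\<integral>x. indicator cube x *\<^sub>R pd i g x \<partial>lborel) = cint (pd i g)"
  proof -
    have "(\<lambda>x. indicator cube x *\<^sub>R pd i g x) \<in> borel_measurable lborel"
      using borel_measurable_continuous_on_indicator[of cube "pd i g"] gc cube_subset_ccube continuous_on_subset by auto
    then show ?thesis by (simp add: integral_restrict_space integral_completion)
  qed
  ultimately show ?thesis by simp
qed

lemma integration_by_parts:
  assumes "C1 f" "C1 g" "\<And>x. x \<in> ccube \<Longrightarrow> x $ i = 0 \<or> x $ i = 1 \<Longrightarrow> f x * g x = 0"
  shows "cint (\<lambda>x. pd i f x * g x) = - cint (\<lambda>x. f x * pd i g x)"
proof -
  have "0 = cint (pd i (\<lambda>x. f x * g x))"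
    by (rule cint_pd_eq_0[symmetric]) (use assms in \<open>auto intro: C1_mult\<close>)
  also have "\<dots> = cint (\<lambda>x. pd i f x * g x + f x * pd i g x)"
    by (rule cint_cong, rule pd_mult) (use assms cube_subset_ccube in \<open>auto simp: C1_def\<close>)
  also have "\<dots> = cint (\<lambda>x. pd i f x * g x) + cint (\<lambda>x. f x * pd i g x)"
    by (rule cint_add; intro continuous_intros) (use assms in \<open>auto simp: C1_def intro: C1_continuous\<close>)
  finally show ?thesis by simp
qed

lemma green_first:
  fixes f g :: "real^'n \<Rightarrow> real"
  assumes "C2 f" "C1 g" "zero_normal_deriv f"
  shows "cint (\<lambda>x. laplacian f x * g x) = - cint (\<lambda>x. grad f x \<bullet> grad g x)"
proof -
  have c: "continuous_on ccube g" "\<And>i. continuous_on ccube (pd i f)" "\<And>i. continuous_on ccube (pd i g)"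
     "\<And>i. continuous_on ccube (pd i (pd i f))"
    using assms by (auto simp: C2_def C1_def C1_continuous[OF assms(2)])
  have "cint (\<lambda>x. laplacian f x * g x) = (\<Sum>i\<in>UNIV. cint (\<lambda>x. pd i (pd i f) x * g x))"
    unfolding laplacian_def sum_distrib_right by (rule cint_sum) (intro continuous_intros c)
  also have "\<dots> = (\<Sum>i\<in>UNIV. - cint (\<lambda>x. pd i f x * pd i g x))"
    by (intro sum.cong refl integration_by_parts) (use assms in \<open>auto simp: C2_def zero_normal_deriv_def\<close>)
  also have "\<dots> = - cint (\<lambda>x. grad f x \<bullet> grad g x)"
    unfolding grad_def inner_vec_def sum_negf
    by (subst cint_sum[symmetric]) (auto intro!: continuous_intros c)
  finally show ?thesis .
qed

lemma green_second:
  fixes f g :: "real^'n \<Rightarrow> real"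
  assumes "C2 f" "C2 g" "zero_normal_deriv f" "zero_normal_deriv g"
  shows "cint (\<lambda>x. laplacian f x * g x) = cint (\<lambda>x. f x * laplacian g x)"
  using green_first[of f g] green_first[of g f] assms
  by (simp add: C2_def inner_commute mult.commute)

section \<open>Neumann eigenfunctions\<close>

text \<open>Eigenfunctions and smooth bumps are both products of functions of one coordinate and share the
  computation of their derivatives.\<close>

definition coordprod :: "('n \<Rightarrow> real \<Rightarrow> real) \<Rightarrow> real^'n \<Rightarrow> real" where
  "coordprod h x = (\<Prod>i\<in>UNIV. h i (x $ i))"

lemma coordprod_split:
  fixes x :: "real^'n"
  shows "coordprod (h(i := f)) x = f (x $ i) * (\<Prod>j\<in>UNIV - {i}. h j (x $ j))"
  unfolding coordprod_def by (subst prod.remove[of UNIV i]) (auto intro!: prod.cong)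

lemma coordprod_has_derivative:
  fixes x :: "real^'n"
  assumes "\<And>i. (h i has_real_derivative h' i (x $ i)) (at (x $ i))"
  shows "(coordprod h has_derivative
          (\<lambda>v. \<Sum>i\<in>UNIV. v $ i * coordprod (h(i := h' i)) x)) (at x within S)"
proof -
  have "((\<lambda>y. h i (y $ i)) has_derivative (\<lambda>v. h' i (x $ i) * v $ i)) (at x within S)" for i
    by (rule has_derivative_compose[of "\<lambda>y. y $ i" "\<lambda>v. v $ i" x S "h i"])
       (use assms in \<open>auto simp: has_field_derivative_def intro!: derivative_eq_intros bounded_linear_imp_has_derivative bounded_linear_vec_nth\<close>)
  then have "((\<lambda>y. \<Prod>i\<in>UNIV. h i (y $ i)) has_derivative
     (\<lambda>v. \<Sum>i\<in>UNIV. (h' i (x $ i) * v $ i) * (\<Prod>j\<in>UNIV - {i}. h j (x $ j)))) (at x within S)"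
    by (rule has_derivative_prod)
  then show ?thesis unfolding coordprod_split by (simp add: coordprod_def[abs_def] mult_ac)
qed

lemma coordprod_axis:
  "(\<Sum>j\<in>UNIV. axis i (1::real) $ j * c j) = c i"
  by (simp add: axis_def if_distrib[of "\<lambda>a. a * _"] cong: if_cong)

lemma pd_coordprod:
  fixes x :: "real^'n"
  assumes "\<And>i s. (h i has_real_derivative h' i s) (at s)" "x \<in> ccube"
  shows "pd i (coordprod h) x = coordprod (h(i := h' i)) x"
  using pd_eq[OF coordprod_has_derivative[of h h' x] assms(2)] assms(1) by (simp add: coordprod_axis)

lemma coordprod_differentiable:
  fixes h :: "'n::finite \<Rightarrow> real \<Rightarrow> real"
  assumes "\<And>i s. (h i has_real_derivative h' i s) (at s)"
  shows "coordprod h differentiable_on S"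
  using coordprod_has_derivative[of h h'] assms by (force simp: differentiable_on_def differentiable_def)

lemma coordprod_continuous:
  fixes h :: "'n::finite \<Rightarrow> real \<Rightarrow> real"
  assumes "\<And>i. continuous_on UNIV (h i)"
  shows "continuous_on S (coordprod h)"
proof -
  have "continuous_on S (\<lambda>x::real^'n. h i (x $ i))" for i
    by (rule continuous_on_compose2[OF assms]) (auto intro!: continuous_intros)
  then show ?thesis unfolding coordprod_def[abs_def] by (intro continuous_intros)
qed

lemma DERIV_continuous_UNIV: "(\<And>s. (f has_real_derivative f' s) (at s)) \<Longrightarrow> continuous_on UNIV f"
  by (meson DERIV_isCont continuous_at_imp_continuous_on)

lemma C1_coordprod:
  fixes h :: "'n::finite \<Rightarrow> real \<Rightarrow> real"
  assumes "\<And>i s. (h i has_real_derivative h' i s) (at s)" "\<And>i. continuous_on UNIV (h' i)"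
  shows "C1 (coordprod h)"
  unfolding C1_def
proof (intro conjI allI)
  fix i
  have "continuous_on UNIV (h j)" for j by (rule DERIV_continuous_UNIV) (rule assms(1))
  then have "continuous_on ccube (coordprod (h(i := h' i)))"
    by (intro coordprod_continuous) (use assms in auto)
  then show "continuous_on ccube (pd i (coordprod h))"
    by (rule continuous_on_eq) (use pd_coordprod[of h h'] assms(1) in auto)
qed (use coordprod_differentiable assms in auto)

text \<open>The integrand is an \<open>i\<close>-th partial derivative of a function that vanishes on the faces
  orthogonal to the \<open>i\<close>-th axis.\<close>

lemma cint_coordprod_eq_0:
  fixes h :: "'n::finite \<Rightarrow> real \<Rightarrow> real"
  assumes "\<And>j s. (h j has_real_derivative h' j s) (at s)" "\<And>j. continuous_on UNIV (h' j)"
    and "h i 0 = 0" "h i 1 = 0"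
  shows "cint (coordprod (h(i := h' i))) = 0"
proof -
  have "cint (coordprod (h(i := h' i))) = cint (pd i (coordprod h))"
    using pd_coordprod[of h h'] assms(1) cube_subset_ccube by (intro cint_cong) auto
  also have "\<dots> = 0"
  proof (rule cint_pd_eq_0[OF C1_coordprod[OF assms(1,2)]])
    fix x :: "real^'n" assume "x $ i = 0 \<or> x $ i = 1"
    then have "h i (x $ i) = 0" using assms(3,4) by auto
    then show "coordprod h x = 0" unfolding coordprod_def by (intro prod_zero) auto
  qed
  finally show ?thesis .
qed

definition cosmode :: "nat \<Rightarrow> real \<Rightarrow> real" where
  "cosmode m s = (if m = 0 then 1 else sqrt 2 * cos (pi * real m * s))"

definition cosmode' :: "nat \<Rightarrow> real \<Rightarrow> real" where
  "cosmode' m s = - sqrt 2 * (pi * real m) * sin (pi * real m * s)"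

lemma eigenfun_coordprod: "neumann_eigenfun k = coordprod (\<lambda>i. cosmode (k $ i))"
  by (auto simp: neumann_eigenfun_def coordprod_def cosmode_def intro!: prod.cong)

lemma cosmode_deriv: "(cosmode m has_real_derivative cosmode' m s) (at s)"
  unfolding cosmode_def[abs_def] cosmode'_def by (cases "m = 0") (auto intro!: derivative_eq_intros)

lemma cosmode'_deriv: "(cosmode' m has_real_derivative - (pi * real m)\<^sup>2 * cosmode m s) (at s)"
  unfolding cosmode_def cosmode'_def[abs_def]
  by (cases "m = 0") (auto intro!: derivative_eq_intros simp: power2_eq_square)

lemma cosmode_continuous: "continuous_on UNIV (cosmode m)" "continuous_on UNIV (cosmode' m)"
  by (rule DERIV_continuous_UNIV, rule cosmode_deriv) (rule DERIV_continuous_UNIV, rule cosmode'_deriv)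

lemma eigenfun_pd:
  fixes x :: "real^'n"
  assumes "x \<in> ccube"
  shows "pd i (neumann_eigenfun k) x = coordprod ((\<lambda>j. cosmode (k $ j))(i := cosmode' (k $ i))) x"
  unfolding eigenfun_coordprod
  by (rule pd_coordprod[of _ "\<lambda>j. cosmode' (k $ j)"]) (use cosmode_deriv assms in auto)

lemma eigenfun_pd_pd:
  fixes x :: "real^'n"
  assumes "x \<in> ccube"
  shows "pd i (pd i (neumann_eigenfun k)) x = - (pi * real (k $ i))\<^sup>2 * neumann_eigenfun k x"
proof -
  let ?h = "(\<lambda>j. cosmode (k $ j))(i := cosmode' (k $ i))"
  let ?h' = "\<lambda>j s. if j = i then - (pi * real (k $ i))\<^sup>2 * cosmode (k $ i) s else cosmode' (k $ j) s"
  have "pd i (pd i (neumann_eigenfun k)) x = pd i (coordprod ?h) x"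
    by (rule pd_cong) (use eigenfun_pd assms in auto)
  also have "\<dots> = coordprod (?h(i := ?h' i)) x"
    by (rule pd_coordprod) (use assms cosmode_deriv cosmode'_deriv in auto)
  also have "\<dots> = - (pi * real (k $ i))\<^sup>2 * coordprod ((\<lambda>j. cosmode (k $ j))(i := cosmode (k $ i))) x"
    unfolding coordprod_split fun_upd_upd by simp
  also have "(\<lambda>j. cosmode (k $ j))(i := cosmode (k $ i)) = (\<lambda>j. cosmode (k $ j))" by auto
  finally show ?thesis by (simp add: eigenfun_coordprod)
qed

lemma C2_eigenfun: "C2 (neumann_eigenfun k)"
  unfolding C2_def
proof (intro conjI allI)
  show "C1 (neumann_eigenfun k)" unfolding eigenfun_coordprod
    by (rule C1_coordprod[of _ "\<lambda>j. cosmode' (k $ j)"]) (use cosmode_deriv cosmode_continuous in auto)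
  fix i
  let ?h' = "\<lambda>j s. if j = i then - (pi * real (k $ i))\<^sup>2 * cosmode (k $ i) s else cosmode' (k $ j) s"
  have "continuous_on UNIV (?h' j)" for j
    using cosmode_continuous by (cases "j = i") (auto intro!: continuous_intros)
  then have "C1 (coordprod ((\<lambda>j. cosmode (k $ j))(i := cosmode' (k $ i))))"
    by (intro C1_coordprod[of _ ?h']) (use cosmode_deriv cosmode'_deriv in auto)
  then show "C1 (pd i (neumann_eigenfun k))"
    by (rule C1_cong[rotated]) (simp add: eigenfun_pd)
qed

lemma eigenfun_continuous: "continuous_on S (neumann_eigenfun k)"
  unfolding eigenfun_coordprod by (rule coordprod_continuous) (rule cosmode_continuous)

lemma zero_normal_eigenfun:
  fixes k :: "nat^'n"
  shows "zero_normal_deriv (neumann_eigenfun k)"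
  unfolding zero_normal_deriv_def
proof (intro ballI allI impI)
  fix x :: "real^'n" and i assume x: "x \<in> ccube" "x $ i = 0 \<or> x $ i = 1"
  have "cosmode' (k $ i) (x $ i) = 0"
    using x(2) sin_npi[of "k $ i"] by (auto simp: cosmode'_def mult.commute)
  then show "pd i (neumann_eigenfun k) x = 0"
    using eigenfun_pd[OF x(1)] by (simp add: coordprod_split)
qed

lemma laplacian_eigenfun:
  fixes x :: "real^'n" and k :: "nat^'n"
  assumes "x \<in> ccube"
  shows "laplacian (neumann_eigenfun k) x = - neumann_eigenval k * neumann_eigenfun k x"
  unfolding laplacian_def eigenfun_pd_pd[OF assms] neumann_eigenval_def
  by (simp add: sum_distrib_right sum_distrib_left sum_negf power_mult_distrib mult.assoc)

lemma eigenfun_bound: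
  fixes x :: "real^'n" and k :: "nat^'n"
  shows "\<bar>neumann_eigenfun k x\<bar> \<le> sqrt 2 ^ CARD('n)"
proof -
  have "\<bar>cosmode m s\<bar> \<le> sqrt 2" for m s
    by (auto simp: cosmode_def abs_mult intro: mult_left_le)
  then have "(\<Prod>i\<in>UNIV. \<bar>cosmode (k $ i) (x $ i)\<bar>) \<le> (\<Prod>i\<in>(UNIV::'n set). sqrt 2)"
    by (intro prod_mono) auto
  then show ?thesis by (simp add: eigenfun_coordprod coordprod_def abs_prod)
qed

lemma eigenfun_0 [simp]: "neumann_eigenfun 0 x = 1"
  by (simp add: neumann_eigenfun_def)

lemma eigenval_nonneg: "neumann_eigenval k \<ge> 0"
  by (simp add: neumann_eigenval_def sum_nonneg)

lemma eigenval_0 [simp]: "neumann_eigenval 0 = 0"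
  by (simp add: neumann_eigenval_def)

lemma eigenval_ge: fixes k :: "nat^'n" shows "(pi * real (k $ i))\<^sup>2 \<le> neumann_eigenval k"
  unfolding neumann_eigenval_def power_mult_distrib
  by (intro mult_left_mono member_le_sum) auto

lemma eigenval_pos: fixes k :: "nat^'n" shows "k \<noteq> 0 \<Longrightarrow> neumann_eigenval k > 0"
proof -
  assume "k \<noteq> 0"
  then obtain i where "k $ i \<noteq> 0" by (auto simp: vec_eq_iff)
  then have "0 < (pi * real (k $ i))\<^sup>2" by simp
  then show ?thesis using eigenval_ge[of k i] by linarith
qed

text \<open>The second derivative in a direction in which the two indices differ is symmetric and has both
  functions as eigenfunctions, for distinct eigenvalues. The full Laplacian would not do: its
  eigenvalues agree for indices that are permutations of each other.\<close>

lemma eigenfun_orthogonal: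
  fixes k l :: "nat^'n"
  assumes "k \<noteq> l"
  shows "cint (\<lambda>x. neumann_eigenfun k x * neumann_eigenfun l x) = 0"
proof -
  obtain i where i: "k $ i \<noteq> l $ i" using assms by (auto simp: vec_eq_iff)
  have *: "(pi * real (k $ i))\<^sup>2 * cint (\<lambda>x. neumann_eigenfun k x * neumann_eigenfun l x)
      = cint (\<lambda>x. pd i (neumann_eigenfun k) x * pd i (neumann_eigenfun l) x)" for k l :: "nat^'n"
  proof -
    have "cint (\<lambda>x. pd i (pd i (neumann_eigenfun k)) x * neumann_eigenfun l x)
       = - cint (\<lambda>x. pd i (neumann_eigenfun k) x * pd i (neumann_eigenfun l) x)"
      by (rule integration_by_parts)
         (use C2_eigenfun[of k] C2_eigenfun[of l] zero_normal_eigenfun[of k] in \<open>auto simp: C2_def zero_normal_deriv_def\<close>)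
    moreover have "cint (\<lambda>x. pd i (pd i (neumann_eigenfun k)) x * neumann_eigenfun l x)
       = cint (\<lambda>x. - (pi * real (k $ i))\<^sup>2 * (neumann_eigenfun k x * neumann_eigenfun l x))"
      using eigenfun_pd_pd[of _ i k] cube_subset_ccube by (intro cint_cong) auto
    ultimately show ?thesis by simp
  qed
  have "(pi * real (k $ i))\<^sup>2 * cint (\<lambda>x. neumann_eigenfun k x * neumann_eigenfun l x)
      = (pi * real (l $ i))\<^sup>2 * cint (\<lambda>x. neumann_eigenfun k x * neumann_eigenfun l x)"
    using *[of k l] *[of l k] by (simp add: mult.commute)
  moreover have "(pi * real (k $ i))\<^sup>2 \<noteq> (pi * real (l $ i))\<^sup>2" using i
    by (simp add: power2_eq_iff_nonneg)
  ultimately show ?thesis by simp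
qed

text \<open>Expanding \<open>2 cos\<^sup>2 t = 1 + cos 2t\<close> in every factor gives a sum over sets of coordinates, in which
  only the empty set contributes a term with nonzero mean.\<close>

lemma eigenfun_normalized:
  fixes k :: "nat^'n"
  shows "cint (\<lambda>x. neumann_eigenfun k x * neumann_eigenfun k x) = 1"
proof -
  define a where "a = (\<lambda>i s. if k $ i = 0 then 0 else cos (2 * pi * real (k $ i) * s))"
  define q where "q = (\<lambda>X. coordprod (\<lambda>i. if i \<in> X then a i else (\<lambda>s. 1)))"
  have sq: "cosmode (k $ i) s * cosmode (k $ i) s = a i s + 1" for i s
    using cos_double_cos[of "pi * real (k $ i) * s"]
    by (auto simp: cosmode_def a_def power2_eq_square mult_ac)
  have ca: "continuous_on UNIV (if i \<in> X then a i else (\<lambda>s. 1))" for i X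
    unfolding a_def by (cases "k $ i = 0"; cases "i \<in> X") (auto intro!: continuous_intros)
  have expand: "neumann_eigenfun k x * neumann_eigenfun k x = (\<Sum>X\<in>Pow UNIV. q X x)" for x
  proof -
    have "neumann_eigenfun k x * neumann_eigenfun k x = (\<Prod>i\<in>UNIV. a i (x $ i) + 1)"
      unfolding eigenfun_coordprod coordprod_def prod.distrib[symmetric] sq ..
    also have "\<dots> = (\<Sum>X\<in>Pow UNIV. (\<Prod>i\<in>X. a i (x $ i)) * (\<Prod>i\<in>UNIV - X. 1))"
      by (rule prod_add) simp
    also have "\<dots> = (\<Sum>X\<in>Pow UNIV. q X x)"
      unfolding q_def coordprod_def
      by (intro sum.cong refl) (simp add: if_distrib[of "\<lambda>h. h _"] prod.If_cases)
    finally show ?thesis .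
  qed
  have "cint (\<lambda>x. neumann_eigenfun k x * neumann_eigenfun k x) = (\<Sum>X\<in>Pow UNIV. cint (q X))"
    unfolding expand by (rule cint_sum) (unfold q_def, rule coordprod_continuous, rule ca)
  also have "\<dots> = (\<Sum>X\<in>{{}}. cint (q X))"
  proof (rule sum.mono_neutral_right)
    show "\<forall>X\<in>Pow UNIV - {{}}. cint (q X) = 0"
    proof
      fix X :: "'n set" assume "X \<in> Pow UNIV - {{}}"
      then obtain i where i: "i \<in> X" by auto
      show "cint (q X) = 0"
      proof (cases "k $ i = 0")
        case True
        then have "q X x = 0" for x unfolding q_def coordprod_def using i
          by (intro prod_zero) (auto simp: a_def intro!: bexI[of _ i])
        then show ?thesis by simp
      next
        case False
        define w where "w = 2 * pi * real (k $ i)"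
        define b where "b = (\<lambda>j s. if j \<in> X then (if k $ j = 0 then 0 else - (2 * pi * real (k $ j)) * sin (2 * pi * real (k $ j) * s)) else 0)"
        have w: "w \<noteq> 0" using False by (simp add: w_def)
        define H where "H = (\<lambda>j. if j \<in> X then a j else (\<lambda>s. 1))(i := \<lambda>s. sin (w * s) / w)"
        have "cint (coordprod (H(i := (b(i := a i)) i))) = 0"
        proof (rule cint_coordprod_eq_0[where h = H and h' = "b(i := a i)"])
          show "\<And>j s. (H j has_real_derivative (b(i := a i)) j s) (at s)"
            using w False by (auto simp: H_def a_def b_def w_def intro!: derivative_eq_intros)
          have "continuous_on UNIV ((b(i := a i)) j)" for j
            unfolding a_def b_def
            by (cases "j = i"; cases "j \<in> X"; cases "k $ j = 0") (use False in \<open>auto intro!: continuous_intros\<close>)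
          then show "\<And>j. continuous_on UNIV ((b(i := a i)) j)" .
          show "H i 1 = 0"
            using sin_npi[of "2 * k $ i"] by (simp add: H_def w_def mult_ac)
        qed (simp add: H_def)
        moreover have "H(i := (b(i := a i)) i) = (\<lambda>j. if j \<in> X then a j else (\<lambda>s. 1))"
          using i by (auto simp: H_def)
        ultimately show ?thesis by (simp add: q_def)
      qed
    qed
  qed auto
  also have "\<dots> = cint (\<lambda>x::real^'n. 1)" by (simp add: q_def coordprod_def)
  also have "\<dots> = 1" by (rule cint_const)
  finally show ?thesis .
qed

section \<open>Completeness of the eigenfunctions\<close>

text \<open>Boxes of indices are the truncations of all spectral sums: they are finite and exhaust the
  index set along a sequence.\<close>

definition modes :: "nat \<Rightarrow> (nat^'n) set" where
  "modes N = {k. \<forall>i. k $ i \<le> N}"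

definition coef :: "(real^'n \<Rightarrow> real) \<Rightarrow> nat^'n \<Rightarrow> real" where
  "coef g k = cint (\<lambda>x. g x * neumann_eigenfun k x)"

definition low_part :: "nat \<Rightarrow> (real^'n \<Rightarrow> real) \<Rightarrow> real^'n \<Rightarrow> real" where
  "low_part N g x = (\<Sum>k\<in>modes N. coef g k * neumann_eigenfun k x)"

lemma sum_modes_prod:
  fixes a :: "nat \<Rightarrow> real"
  shows "(\<Sum>k\<in>(modes N :: (nat^'n) set). \<Prod>i\<in>UNIV. a (k $ i)) = (\<Sum>m\<le>N. a m) ^ CARD('n)"
    and finite_modes: "finite (modes N :: (nat^'n) set)"
proof -
  have bij: "bij_betw vec_lambda (PiE (UNIV::'n set) (\<lambda>_. {..N})) (modes N)"
  proof (rule bij_betwI[where g = vec_nth])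
  qed (auto simp: modes_def PiE_def extensional_def)
  then show "finite (modes N :: (nat^'n) set)"
    using bij_betw_finite[OF bij] finite_PiE[of "UNIV::'n set" "\<lambda>_. {..N}"] by simp
  have "(\<Sum>k\<in>(modes N :: (nat^'n) set). \<Prod>i\<in>UNIV. a (k $ i))
      = (\<Sum>g\<in>PiE (UNIV::'n set) (\<lambda>_. {..N}). \<Prod>i\<in>UNIV. a (g i))"
    using sum.reindex_bij_betw[OF bij, of "\<lambda>k. \<Prod>i\<in>UNIV. a (k $ i)"] by simp
  also have "\<dots> = (\<Prod>i\<in>(UNIV::'n set). \<Sum>m\<le>N. a m)"
    by (rule prod_sum_PiE[symmetric]) auto
  finally show "(\<Sum>k\<in>(modes N :: (nat^'n) set). \<Prod>i\<in>UNIV. a (k $ i)) = (\<Sum>m\<le>N. a m) ^ CARD('n)"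
    by simp
qed

lemma modes_mono: "M \<le> N \<Longrightarrow> modes M \<subseteq> modes N"
  by (auto simp: modes_def intro: order_trans)

lemma zero_in_modes [simp]: "0 \<in> modes N"
  by (simp add: modes_def)

lemma low_part_continuous: "continuous_on S (low_part N g)"
  unfolding low_part_def[abs_def] by (intro continuous_intros eigenfun_continuous)

lemma coef_low_part:
  fixes k :: "nat^'n"
  assumes "k \<in> modes N"
  shows "coef (low_part N g) k = coef g k"
proof -
  have "coef (low_part N g) k = cint (\<lambda>x. \<Sum>l\<in>modes N. coef g l * (neumann_eigenfun l x * neumann_eigenfun k x))"
    by (simp add: coef_def[of "low_part N g"] low_part_def sum_distrib_right mult.assoc)
  also have "\<dots> = (\<Sum>l\<in>modes N. coef g l * cint (\<lambda>x. neumann_eigenfun l x * neumann_eigenfun k x))"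
    by (subst cint_sum) (auto intro!: continuous_intros eigenfun_continuous)
  also have "\<dots> = (\<Sum>l\<in>modes N. if l = k then coef g l else 0)"
    by (intro sum.cong refl) (use eigenfun_orthogonal eigenfun_normalized in auto)
  finally show ?thesis using assms by (simp add: sum.delta[OF finite_modes])
qed

lemma coef_diff:
  assumes "continuous_on ccube g" "continuous_on ccube h"
  shows "coef (\<lambda>x. g x - h x) k = coef g k - coef h k"
  unfolding coef_def left_diff_distrib
  by (rule cint_diff; intro continuous_intros eigenfun_continuous assms)

lemma coef_add:
  assumes "continuous_on ccube g" "continuous_on ccube h"
  shows "coef (\<lambda>x. g x + h x) k = coef g k + coef h k"
  unfolding coef_def distrib_right
  by (rule cint_add; intro continuous_intros eigenfun_continuous assms)

lemma coef_high_part: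
  assumes "continuous_on ccube g" "k \<in> modes N"
  shows "coef (\<lambda>x. g x - low_part N g x) k = 0"
  using assms by (simp add: coef_diff low_part_continuous coef_low_part)

lemma cint_low_part:
  assumes "continuous_on ccube h"
  shows "cint (\<lambda>x. h x * low_part N g x) = (\<Sum>k\<in>modes N. coef h k * coef g k)"
proof -
  have "cint (\<lambda>x. h x * low_part N g x) = cint (\<lambda>x. \<Sum>k\<in>modes N. coef g k * (h x * neumann_eigenfun k x))"
    by (simp add: low_part_def sum_distrib_left mult_ac)
  also have "\<dots> = (\<Sum>k\<in>modes N. coef g k * coef h k)"
    unfolding coef_def[of h] by (subst cint_sum) (auto intro!: continuous_intros eigenfun_continuous assms)
  finally show ?thesis by (simp add: mult.commute)
qed

lemma norm_high_part:
  assumes g: "continuous_on ccube g"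
  shows "cint (\<lambda>x. (g x - low_part N g x)\<^sup>2) = cint (\<lambda>x. (g x)\<^sup>2) - (\<Sum>k\<in>modes N. (coef g k)\<^sup>2)"
proof -
  let ?E = "\<lambda>x. g x - low_part N g x"
  have E: "continuous_on ccube ?E" by (intro continuous_intros g low_part_continuous)
  have "cint (\<lambda>x. (?E x)\<^sup>2) = cint (\<lambda>x. (g x)\<^sup>2 - g x * low_part N g x - ?E x * low_part N g x)"
    by (simp add: power2_eq_square algebra_simps)
  also have "\<dots> = cint (\<lambda>x. (g x)\<^sup>2) - cint (\<lambda>x. g x * low_part N g x) - cint (\<lambda>x. ?E x * low_part N g x)"
    by ((subst cint_diff; (intro continuous_intros g low_part_continuous)?)+, rule refl)
  also have "\<dots> = cint (\<lambda>x. (g x)\<^sup>2) - (\<Sum>k\<in>modes N. (coef g k)\<^sup>2)"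
    unfolding cint_low_part[OF g] cint_low_part[OF E] using coef_high_part[OF g]
    by (simp add: power2_eq_square)
  finally show ?thesis .
qed

lemma bessel:
  assumes "continuous_on ccube g"
  shows "(\<Sum>k\<in>modes N. (coef g k)\<^sup>2) \<le> cint (\<lambda>x. (g x)\<^sup>2)"
  using norm_high_part[OF assms, of N] cint_nonneg[of "\<lambda>x. (g x - low_part N g x)\<^sup>2"] by simp

text \<open>Without the normalizing factors, the product formula for cosines needs no distinction between
  zero and nonzero frequencies.\<close>

definition cosprod :: "nat^'n \<Rightarrow> real^'n \<Rightarrow> real" where
  "cosprod k = coordprod (\<lambda>i s. cos (pi * real (k $ i) * s))"

lemma eigenfun_cosprod: "\<exists>c>0. \<forall>x. neumann_eigenfun k x = c * cosprod k x"
proof (intro exI conjI allI)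
  show "0 < (\<Prod>i\<in>UNIV. if k $ i = 0 then 1 else sqrt 2)" by (intro prod_pos) auto
  show "neumann_eigenfun k x = (\<Prod>i\<in>UNIV. if k $ i = 0 then 1 else sqrt 2) * cosprod k x" for x
    unfolding neumann_eigenfun_def cosprod_def coordprod_def prod.distrib[symmetric] by (rule prod.cong) auto
qed

text \<open>The span of the eigenfunctions, as an inductive predicate so that its properties follow by
  induction on sums.\<close>

inductive trig :: "(real^'n \<Rightarrow> real) \<Rightarrow> bool" where
  base: "trig (\<lambda>x. c * cosprod k x)"
| add: "trig f \<Longrightarrow> trig g \<Longrightarrow> trig (\<lambda>x. f x + g x)"

lemma trig_cmult: "trig f \<Longrightarrow> trig (\<lambda>x. c * f x)"
proof (induction rule: trig.induct)
  case (base d k) show ?case using trig.base[of "c * d" k] by (simp add: mult.assoc)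
next
  case (add f g) then show ?case using trig.add[OF add.IH] by (simp only: distrib_left)
qed

lemma cosprod_split:
  fixes x :: "real^'n"
  shows "cosprod (\<chi> j. if j = i then m else k $ j) x
    = cos (pi * real m * x $ i) * (\<Prod>j\<in>UNIV - {i}. cos (pi * real (k $ j) * x $ j))"
  unfolding cosprod_def coordprod_def by (subst prod.remove[of UNIV i]) (auto intro!: prod.cong)

lemma trig_cos_mult:
  fixes f :: "real^'n \<Rightarrow> real"
  shows "trig f \<Longrightarrow> trig (\<lambda>x. cos (pi * x $ i) * f x)"
proof (induction rule: trig.induct)
  case (base d k)
  let ?k = "\<lambda>m. \<chi> j. if j = i then m else k $ j"
  have k: "cosprod k = cosprod (?k (k $ i))" by (rule arg_cong[of _ _ cosprod]) (simp add: vec_eq_iff)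
  show ?case
  proof (cases "k $ i")
    case 0
    have "cos (pi * x $ i) * (d * cosprod k x) = d * cosprod (?k 1) x" for x
      unfolding k cosprod_split by (simp add: 0)
    then have "(\<lambda>x. cos (pi * x $ i) * (d * cosprod k x)) = (\<lambda>x. d * cosprod (?k 1) x)" by (rule ext)
    then show ?thesis by (simp only: trig.base)
  next
    case (Suc m)
    have cc: "cos a * cos b = cos (b - a) / 2 + cos (b + a) / 2" for a b :: real
      by (simp add: cos_add cos_diff field_simps)
    have *: "cos (pi * x $ i) * (d * (cos (pi * real (Suc m) * x $ i) * P)) =
        d/2 * (cos (pi * real m * x $ i) * P) + d/2 * (cos (pi * real (Suc (Suc m)) * x $ i) * P)"
      for x :: "real^'n" and P
    proof -
      have "cos (pi * x $ i) * cos (pi * real (Suc m) * x $ i)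
        = cos (pi * real m * x $ i) / 2 + cos (pi * real (Suc (Suc m)) * x $ i) / 2"
        using cc[of "pi * x $ i" "pi * real (Suc m) * x $ i"] by (simp add: algebra_simps)
      then have "d * P * (cos (pi * x $ i) * cos (pi * real (Suc m) * x $ i))
        = d * P * (cos (pi * real m * x $ i) / 2 + cos (pi * real (Suc (Suc m)) * x $ i) / 2)" by (rule arg_cong)
      then show ?thesis by (simp only: distrib_left distrib_right mult_ac times_divide_eq_left times_divide_eq_right)
    qed
    have "cos (pi * x $ i) * (d * cosprod k x) = d/2 * cosprod (?k m) x + d/2 * cosprod (?k (Suc (Suc m))) x" for x
      unfolding k cosprod_split Suc by (rule *)
    then have "(\<lambda>x. cos (pi * x $ i) * (d * cosprod k x)) = (\<lambda>x. d/2 * cosprod (?k m) x + d/2 * cosprod (?k (Suc (Suc m))) x)"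
      by (rule ext)
    then show ?thesis by (simp only: trig.add[OF trig.base trig.base])
  qed
next
  case (add f g) then show ?case using trig.add[OF add.IH] by (simp only: distrib_left)
qed

lemma trig_continuous: "trig f \<Longrightarrow> continuous_on S f"
proof (induction rule: trig.induct)
  case (base c k)
  show ?case unfolding cosprod_def by (intro continuous_intros coordprod_continuous)
qed (intro continuous_intros)

text \<open>A cosine sum is a combination of the eigenfunctions with indices in some box; this is the dual
  form of that fact, which suffices for best approximation.\<close>

lemma trig_orthogonal:
  fixes f :: "real^'n \<Rightarrow> real"
  shows "trig f \<Longrightarrow> \<exists>N0. \<forall>N\<ge>N0. \<forall>G. continuous_on ccube G \<longrightarrow> (\<forall>k\<in>modes N. coef G k = 0) \<longrightarrow>
     cint (\<lambda>x. G x * f x) = 0"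
proof (induction rule: trig.induct)
  case (base d k)
  obtain c where c: "c > 0" "\<And>x. neumann_eigenfun k x = c * cosprod k x" using eigenfun_cosprod by blast
  have "k \<in> modes N" if "N \<ge> (\<Sum>i\<in>UNIV. k $ i)" for N
    using that member_le_sum[of _ UNIV "\<lambda>i. k $ i"] by (force simp: modes_def intro: order_trans)
  moreover have "cint (\<lambda>x. G x * (d * cosprod k x)) = d / c * coef G k" for G
  proof -
    have "G x * (d * cosprod k x) = d / c * (G x * neumann_eigenfun k x)" for x using c by (simp add: field_simps)
    then show ?thesis by (simp add: coef_def)
  qed
  ultimately show ?case by (intro exI[of _ "\<Sum>i\<in>UNIV. k $ i"]) auto
next
  case (add f g)
  then obtain M N where M: "\<forall>n\<ge>M. \<forall>G. continuous_on ccube G \<longrightarrow> (\<forall>k\<in>modes n. coef G k = 0) \<longrightarrow> cint (\<lambda>x. G x * f x) = 0"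
     and N: "\<forall>n\<ge>N. \<forall>G. continuous_on ccube G \<longrightarrow> (\<forall>k\<in>modes n. coef G k = 0) \<longrightarrow> cint (\<lambda>x. G x * g x) = 0"
    by blast
  have "cint (\<lambda>x. G x * (f x + g x)) = cint (\<lambda>x. G x * f x) + cint (\<lambda>x. G x * g x)"
    if "continuous_on ccube G" for G
    unfolding distrib_left
    by (rule cint_add; intro continuous_intros that trig_continuous add.hyps)
  then show ?case using M N by (intro exI[of _ "max M N"]) auto
qed

text \<open>Stone--Weierstrass, applied to the multipliers of the space of cosine sums. They form an algebra
  by construction, which saves multiplying two general cosine sums, and they separate points because
  \<open>cos (pi * s)\<close> is injective on \<open>[0,1]\<close>.\<close>

lemma trig_dense:
  fixes g :: "real^'n \<Rightarrow> real"
  assumes "continuous_on ccube g" "e > 0"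
  shows "\<exists>f. trig f \<and> (\<forall>x\<in>ccube. \<bar>g x - f x\<bar> < e)"
proof -
  define R where "R = {p. \<forall>f :: real^'n \<Rightarrow> real. trig f \<longrightarrow> trig (\<lambda>x. p x * f x)}"
  have one: "(\<lambda>x::real^'n. 1) = (\<lambda>x. 1 * cosprod 0 x)" by (simp add: cosprod_def coordprod_def)
  have "trig (\<lambda>x::real^'n. 1)" unfolding one by (rule trig.base)
  then have "trig (\<lambda>x. p x * 1)" if "p \<in> R" for p using that unfolding R_def by blast
  then have R: "trig p" if "p \<in> R" for p using that by simp
  interpret function_ring_on R "ccube :: (real^'n) set"
  proof
    show "(\<lambda>x. f x + g x) \<in> R" if "f \<in> R" "g \<in> R" for f g
      unfolding R_def mem_Collect_eq distrib_right
    proof (intro allI impI)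
      fix k :: "real^'n \<Rightarrow> real" assume "trig k"
      then have "trig (\<lambda>x. f x * k x)" "trig (\<lambda>x. g x * k x)" using that by (simp_all add: R_def)
      then show "trig (\<lambda>x. f x * k x + g x * k x)" by (rule trig.add)
    qed
    show "(\<lambda>x. f x * g x) \<in> R" if "f \<in> R" "g \<in> R" for f g
      using that by (simp add: R_def mult.assoc)
    show "\<exists>f\<in>R. f x \<noteq> f y" if xy: "x \<in> ccube" "y \<in> ccube" "x \<noteq> y" for x y
    proof -
      obtain i where i: "x $ i \<noteq> y $ i" using xy(3) by (auto simp: vec_eq_iff)
      have "cos (pi * x $ i) \<noteq> cos (pi * y $ i)"
        using cos_inj_pi[of "pi * x $ i" "pi * y $ i"] i xy by (auto simp: mem_ccube)
      moreover have "(\<lambda>x. cos (pi * x $ i)) \<in> R" unfolding R_def using trig_cos_mult by blast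
      ultimately show ?thesis by (intro bexI[of _ "\<lambda>x. cos (pi * x $ i)"])
    qed
    show "continuous_on ccube f" if "f \<in> R" for f by (rule trig_continuous[OF R[OF that]])
    show "(\<lambda>_. c) \<in> R" for c unfolding R_def using trig_cmult by blast
  qed (rule compact_cbox)
  show ?thesis using Stone_Weierstrass_basic[OF assms] R by blast
qed

text \<open>The error of the truncated series is orthogonal to the truncated series and, for large \<open>N\<close>, to a
  given uniform approximation \<open>f\<close> of \<open>g\<close> by cosine sums. Its square norm is therefore the integral of
  its product with \<open>g - f\<close>, which is small.\<close>

lemma parseval:
  fixes g :: "real^'n \<Rightarrow> real"
  assumes g: "continuous_on ccube g"
  shows "(\<lambda>N. \<Sum>k\<in>modes N. (coef g k)\<^sup>2) \<longlonglongrightarrow> cint (\<lambda>x. (g x)\<^sup>2)"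
proof (rule LIMSEQ_I)
  fix r :: real assume "r > 0"
  define e where "e = sqrt (r / 2)"
  have e: "e > 0" "e\<^sup>2 < r" using \<open>r > 0\<close> by (auto simp: e_def)
  obtain f where f: "trig f" "\<And>x. x \<in> ccube \<Longrightarrow> \<bar>g x - f x\<bar> < e" using trig_dense[OF g e(1)] by blast
  obtain N0 where N0: "\<forall>N\<ge>N0. \<forall>G. continuous_on ccube G \<longrightarrow> (\<forall>k\<in>modes N. coef G k = 0) \<longrightarrow> cint (\<lambda>x. G x * f x) = 0"
    using trig_orthogonal[OF f(1)] by blast
  have "norm ((\<Sum>k\<in>modes N. (coef g k)\<^sup>2) - cint (\<lambda>x. (g x)\<^sup>2)) < r" if N: "N \<ge> N0" for N
  proof -
    let ?E = "\<lambda>x. g x - low_part N g x"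
    have E: "continuous_on ccube ?E" by (intro continuous_intros g low_part_continuous)
    have fc: "continuous_on ccube f" by (rule trig_continuous[OF f(1)])
    have 1: "cint (\<lambda>x. ?E x * f x) = 0" using N0 N E coef_high_part[OF g] by blast
    have 2: "cint (\<lambda>x. ?E x * low_part N g x) = 0"
      unfolding cint_low_part[OF E] using coef_high_part[OF g] by simp
    have "cint (\<lambda>x. (?E x)\<^sup>2) = cint (\<lambda>x. ?E x * (g x - f x) + ?E x * f x - ?E x * low_part N g x)"
      by (simp add: power2_eq_square algebra_simps)
    also have "\<dots> = cint (\<lambda>x. ?E x * (g x - f x)) + cint (\<lambda>x. ?E x * f x) - cint (\<lambda>x. ?E x * low_part N g x)"
      by ((subst cint_diff cint_add; (intro continuous_intros g fc low_part_continuous)?)+, rule refl)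
    also have "\<dots> = cint (\<lambda>x. ?E x * (g x - f x))" using 1 2 by simp
    also have "\<dots> \<le> cint (\<lambda>x. 1/2 * (?E x)\<^sup>2 + 1/2 * e\<^sup>2)"
    proof (rule cint_mono)
      fix x :: "real^'n" assume "x \<in> cube"
      then have "\<bar>g x - f x\<bar> \<le> e" using f(2)[of x] cube_subset_ccube by force
      then have "(g x - f x)\<^sup>2 \<le> e\<^sup>2" using abs_le_square_iff[of "g x - f x" e] e(1) by simp
      moreover have "2 * (?E x * (g x - f x)) \<le> (?E x)\<^sup>2 + (g x - f x)\<^sup>2"
        using sum_squares_bound[of "?E x" "g x - f x"] by (simp only: mult.assoc)
      ultimately show "?E x * (g x - f x) \<le> 1/2 * (?E x)\<^sup>2 + 1/2 * e\<^sup>2" by simp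
    qed (intro continuous_intros g fc low_part_continuous)+
    also have "\<dots> = 1/2 * cint (\<lambda>x. (?E x)\<^sup>2) + 1/2 * e\<^sup>2"
      by (subst cint_add) (auto simp: cint_const simp del: lebesgue_integral_const intro!: continuous_intros g low_part_continuous)
    finally have "cint (\<lambda>x. (?E x)\<^sup>2) < r" using e(2) by simp
    then show ?thesis using norm_high_part[OF g, of N] bessel[OF g, of N] by simp
  qed
  then show "\<exists>no. \<forall>n\<ge>no. norm ((\<Sum>k\<in>modes n. (coef g k)\<^sup>2) - cint (\<lambda>x. (g x)\<^sup>2)) < r" by blast
qed

lemma parseval_inner:
  fixes g h :: "real^'n \<Rightarrow> real"
  assumes g: "continuous_on ccube g" and h: "continuous_on ccube h"
  shows "(\<lambda>N. \<Sum>k\<in>modes N. coef g k * coef h k) \<longlonglongrightarrow> cint (\<lambda>x. g x * h x)"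
proof -
  have polar: "a * b = ((a + b)\<^sup>2 - a\<^sup>2 - b\<^sup>2) / 2" for a b :: real
    by (simp add: power2_eq_square algebra_simps)
  have "(\<lambda>N. ((\<Sum>k\<in>modes N. (coef (\<lambda>x. g x + h x) k)\<^sup>2) - (\<Sum>k\<in>modes N. (coef g k)\<^sup>2)
        - (\<Sum>k\<in>modes N. (coef h k)\<^sup>2)) / 2)
     \<longlonglongrightarrow> (cint (\<lambda>x. (g x + h x)\<^sup>2) - cint (\<lambda>x. (g x)\<^sup>2) - cint (\<lambda>x. (h x)\<^sup>2)) / 2"
    by (intro tendsto_intros parseval g h continuous_on_add) simp
  also have "(\<lambda>N. ((\<Sum>k\<in>modes N. (coef (\<lambda>x. g x + h x) k)\<^sup>2) - (\<Sum>k\<in>modes N. (coef g k)\<^sup>2)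
        - (\<Sum>k\<in>modes N. (coef h k)\<^sup>2)) / 2) = (\<lambda>N. \<Sum>k\<in>modes N. coef g k * coef h k)"
    unfolding polar[of "coef g _"] coef_add[OF g h] sum_divide_distrib[symmetric] sum_subtractf ..
  also have "(cint (\<lambda>x. (g x + h x)\<^sup>2) - cint (\<lambda>x. (g x)\<^sup>2) - cint (\<lambda>x. (h x)\<^sup>2)) / 2 = cint (\<lambda>x. g x * h x)"
  proof -
    have "cint (\<lambda>x. (g x + h x)\<^sup>2 - (g x)\<^sup>2 - (h x)\<^sup>2) = cint (\<lambda>x. (g x + h x)\<^sup>2) - cint (\<lambda>x. (g x)\<^sup>2) - cint (\<lambda>x. (h x)\<^sup>2)"
      by ((subst cint_diff; (intro continuous_intros g h)?)+, rule refl)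
    moreover have "cint (\<lambda>x. (g x + h x)\<^sup>2 - (g x)\<^sup>2 - (h x)\<^sup>2) = cint (\<lambda>x. 2 * (g x * h x))"
      by (simp add: power2_eq_square algebra_simps)
    ultimately show ?thesis by simp
  qed
  finally show ?thesis .
qed

section \<open>The negative norm\<close>

lemma coef_laplacian:
  assumes "C2 g" "zero_normal_deriv g"
  shows "coef (laplacian g) k = - neumann_eigenval k * coef g k"
proof -
  have "coef (laplacian g) k = cint (\<lambda>x. g x * laplacian (neumann_eigenfun k) x)"
    unfolding coef_def using assms C2_eigenfun zero_normal_eigenfun by (intro green_second)
  also have "\<dots> = cint (\<lambda>x. - neumann_eigenval k * (g x * neumann_eigenfun k x))"
    by (intro cint_cong) (use cube_subset_ccube in \<open>auto simp: laplacian_eigenfun subset_iff\<close>)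
  finally show ?thesis by (simp add: coef_def)
qed

lemma eigenval_ge_1:
  fixes k :: "nat^'n"
  assumes "k \<noteq> 0"
  shows "1 \<le> neumann_eigenval k"
proof -
  obtain i where "k $ i \<noteq> 0" using assms by (auto simp: vec_eq_iff)
  then have "1 \<le> pi * real (k $ i)" using mult_mono[of 1 pi 1 "real (k $ i)"] pi_gt3 by auto
  then have "1 \<le> (pi * real (k $ i))\<^sup>2" by (simp add: one_le_power)
  then show ?thesis using eigenval_ge[of k i] by linarith
qed

text \<open>For functions with mean zero this is the square of the norm in \<open>H\<^sup>-\<^sup>1\<close> (lemma \<open>Hm1_norm_sq\<close>). The
  evolution equation makes its partial sums differentiable in time, while the norm itself is defined
  through a choice of representatives.\<close>

definition hm1_sq :: "(real^'n \<Rightarrow> real) \<Rightarrow> real" where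
  "hm1_sq g = lim (\<lambda>N. \<Sum>k\<in>modes N - {0}. (coef g k)\<^sup>2 / neumann_eigenval k)"

lemma sum_modes_nonzero_mono:
  fixes f :: "nat^'n \<Rightarrow> real"
  assumes "\<And>k. k \<noteq> 0 \<Longrightarrow> 0 \<le> f k" "M \<le> N"
  shows "sum f (modes M - {0}) \<le> sum f (modes N - {0})"
  using assms modes_mono[of M N] finite_modes by (intro sum_mono2) auto

lemma hm1_sq_tendsto:
  fixes g :: "real^'n \<Rightarrow> real"
  assumes "continuous_on ccube g"
  shows "(\<lambda>N. \<Sum>k\<in>modes N - {0}. (coef g k)\<^sup>2 / neumann_eigenval k) \<longlonglongrightarrow> hm1_sq g"
proof -
  let ?s = "\<lambda>N. \<Sum>k\<in>modes N - {0}. (coef g k)\<^sup>2 / neumann_eigenval k"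
  have inc: "incseq ?s"
    by (intro incseq_SucI sum_modes_nonzero_mono) (auto simp: eigenval_nonneg)
  have "?s N \<le> cint (\<lambda>x. (g x)\<^sup>2)" for N
  proof -
    have "?s N \<le> (\<Sum>k\<in>modes N - {0}. (coef g k)\<^sup>2)"
    proof (rule sum_mono)
      fix k :: "nat^'n" assume "k \<in> modes N - {0}"
      then have "1 \<le> neumann_eigenval k" using eigenval_ge_1 by blast
      then show "(coef g k)\<^sup>2 / neumann_eigenval k \<le> (coef g k)\<^sup>2"
        using divide_left_mono[of 1 "neumann_eigenval k" "(coef g k)\<^sup>2"] by simp
    qed
    also have "\<dots> \<le> (\<Sum>k\<in>modes N. (coef g k)\<^sup>2)" by (intro sum_mono2 finite_modes) auto
    finally show ?thesis using bessel[OF assms, of N] by simp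
  qed
  then obtain L where "?s \<longlonglongrightarrow> L" using incseq_convergent[OF inc] by blast
  then have "convergent ?s" by (rule convergentI)
  then show ?thesis by (simp add: hm1_sq_def convergent_LIMSEQ_iff)
qed

lemma hm1_sq_ge:
  fixes g :: "real^'n \<Rightarrow> real"
  assumes "continuous_on ccube g"
  shows "(\<Sum>k\<in>modes N - {0}. (coef g k)\<^sup>2 / neumann_eigenval k) \<le> hm1_sq g"
  by (rule incseq_le[OF _ hm1_sq_tendsto[OF assms]])
     (intro incseq_SucI sum_modes_nonzero_mono, auto simp: eigenval_nonneg)

lemma hm1_sq_nonneg:
  fixes g :: "real^'n \<Rightarrow> real"
  assumes "continuous_on ccube g" shows "0 \<le> hm1_sq g"
  using hm1_sq_ge[OF assms, of 0] sum_nonneg[of "modes 0 - {0}" "\<lambda>k. (coef g k)\<^sup>2 / neumann_eigenval k"]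
  by (simp add: eigenval_nonneg)

lemma mult_le_sum_squares: "a * b \<le> a\<^sup>2 + b\<^sup>2" for a b :: real
  using sum_squares_bound[of a b] sum_power2_ge_zero[of a b] by linarith

lemma L2_mult:
  fixes f g :: "real^'n \<Rightarrow> real"
  assumes "L2 f" "L2 g"
  shows "integrable (lebesgue_on cube) (\<lambda>x. f x * g x)"
proof (rule Bochner_Integration.integrable_bound)
  show "integrable (lebesgue_on cube) (\<lambda>x. (f x)\<^sup>2 + (g x)\<^sup>2)" using assms by (auto simp: L2_def)
  show "(\<lambda>x. f x * g x) \<in> borel_measurable (lebesgue_on cube)" using assms by (auto simp: L2_def)
  have "\<bar>a * b\<bar> \<le> a\<^sup>2 + b\<^sup>2" for a b :: real
    using mult_le_sum_squares[of "\<bar>a\<bar>" "\<bar>b\<bar>"] by (simp add: abs_mult)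
  then show "AE x in lebesgue_on cube. norm (f x * g x) \<le> norm ((f x)\<^sup>2 + (g x)\<^sup>2)" by auto
qed

lemma L2_diff:
  fixes f g :: "real^'n \<Rightarrow> real"
  assumes "L2 f" "L2 g"
  shows "L2 (\<lambda>x. f x - g x)"
proof -
  have "integrable (lebesgue_on cube) (\<lambda>x. (f x)\<^sup>2 - f x * g x - f x * g x + (g x)\<^sup>2)"
    using assms L2_mult[OF assms] by (auto simp: L2_def)
  moreover have "(\<lambda>x. (f x)\<^sup>2 - f x * g x - f x * g x + (g x)\<^sup>2) = (\<lambda>x. (f x - g x)\<^sup>2)"
    by (simp add: power2_eq_square algebra_simps)
  ultimately show ?thesis using assms by (auto simp: L2_def)
qed

lemma L2_continuous:
  fixes g :: "real^'n \<Rightarrow> real"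
  assumes "continuous_on ccube g"
  shows "L2 g"
  using integrable_cube[OF assms] integrable_cube[of "\<lambda>x. (g x)\<^sup>2"] assms
  by (auto simp: L2_def intro!: continuous_intros)

lemma Lp_norm_2: "Lp_norm 2 f = sqrt (cint (\<lambda>x. (f x)\<^sup>2))"
  by (simp add: Lp_norm_def sqrt_def)

lemma Lp_norm_2_sq: "(Lp_norm 2 f)\<^sup>2 = cint (\<lambda>x. (f x)\<^sup>2)"
  using cint_nonneg[of "\<lambda>x. (f x)\<^sup>2"] by (simp add: Lp_norm_2)

lemma sum_inverse_squares_le: "(\<Sum>m\<le>N. (1 / (1 + real m))\<^sup>2) \<le> 2 - 1 / (1 + real N)"
proof (induction N)
  case (Suc N)
  have "(1 / (1 + real (Suc N)))\<^sup>2 \<le> 1 / (1 + real N) - 1 / (1 + real (Suc N))"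
  proof -
    have "1 / (1 + n) - 1 / (1 + (1 + n)) = 1 / ((1 + n) * (1 + (1 + n)))" if "n \<ge> 0" for n :: real
      using that by (simp add: divide_simps)
    moreover have "1 / ((1 + (1 + n)) * (1 + (1 + n))) \<le> 1 / ((1 + n) * (1 + (1 + n)))" if "n \<ge> 0" for n :: real
      using that by (intro divide_left_mono mult_right_mono mult_pos_pos) auto
    ultimately show ?thesis by (simp add: power2_eq_square)
  qed
  then show ?case using Suc by simp
qed simp

text \<open>Comparison with \<open>\<Prod>\<^sub>i (1 + k\<^sub>i)\<^sup>-\<^sup>2\<close>, whose sum over a box factorizes into bounded sums. The dimension
  is at most three because the largest \<open>k\<^sub>i\<close> must absorb all factors.\<close>

lemma inverse_eigenval_cube_le:
  fixes k :: "nat^'n"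
  assumes "CARD('n) \<le> 3" "k \<noteq> 0"
  shows "1 / neumann_eigenval k ^ 3 \<le> 64 * (\<Prod>i\<in>UNIV. (1 / (1 + real (k $ i)))\<^sup>2)"
proof -
  define m where "m = Max (range (\<lambda>i. k $ i))"
  have le: "k $ i \<le> m" for i unfolding m_def by (rule Max_ge) auto
  have "m \<in> range (\<lambda>i. k $ i)" unfolding m_def by (rule Max_in) auto
  then obtain i where i: "k $ i = m" by auto
  obtain j where "k $ j \<noteq> 0" using assms(2) by (auto simp: vec_eq_iff)
  then have m: "m \<ge> 1" using le[of j] by simp
  have "real m \<le> pi * real m" using pi_gt3 by (simp add: mult_le_cancel_right1)
  then have lam: "(real m)\<^sup>2 \<le> neumann_eigenval k"
    using eigenval_ge[of k i] power_mono[of "real m" "pi * real m" 2] unfolding i by linarith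
  have "(\<Prod>i\<in>UNIV. (1 + real (k $ i))\<^sup>2) \<le> (\<Prod>i\<in>(UNIV::'n set). (1 + real m)\<^sup>2)"
    by (intro prod_mono power_mono conjI) (use le in auto)
  also have "\<dots> = ((1 + real m)\<^sup>2) ^ CARD('n)" by simp
  also have "\<dots> \<le> ((1 + real m)\<^sup>2) ^ 3" by (rule power_increasing[OF assms(1)]) simp
  also have "\<dots> \<le> ((2 * real m)\<^sup>2) ^ 3" by (intro power_mono) (use m in auto)
  also have "\<dots> = 64 * ((real m)\<^sup>2) ^ 3" by (simp add: power_mult_distrib)
  also have "\<dots> \<le> 64 * neumann_eigenval k ^ 3" by (intro mult_left_mono power_mono lam) auto
  finally have "(\<Prod>i\<in>UNIV. (1 + real (k $ i))\<^sup>2) \<le> 64 * neumann_eigenval k ^ 3" .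
  moreover have "(\<Prod>i\<in>UNIV. (1 + real (k $ i))\<^sup>2) > 0" by (intro prod_pos) auto
  moreover have "(\<Prod>i\<in>UNIV. (1 / (1 + real (k $ i)))\<^sup>2) = 1 / (\<Prod>i\<in>UNIV. (1 + real (k $ i))\<^sup>2)"
    by (simp add: power_divide prod_dividef)
  ultimately show ?thesis
    using divide_right_mono[of "\<Prod>i\<in>UNIV. (1 + real (k $ i))\<^sup>2" "64 * neumann_eigenval k ^ 3"
      "(\<Prod>i\<in>UNIV. (1 + real (k $ i))\<^sup>2) * neumann_eigenval k ^ 3"] eigenval_pos[OF assms(2)] by simp
qed

lemma finite_subset_modes:
  fixes F :: "(nat^'n) set"
  assumes "finite F"
  shows "\<exists>N. F \<subseteq> modes N"
proof -
  have "k $ i \<le> (\<Sum>k\<in>F. \<Sum>i\<in>UNIV. k $ i)" if "k \<in> F" for k i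
    using member_le_sum[of i UNIV "\<lambda>i. k $ i"] member_le_sum[of k F "\<lambda>k. \<Sum>i\<in>UNIV. k $ i"] that assms
    by (force intro: order_trans)
  then show ?thesis by (intro exI[of _ "\<Sum>k\<in>F. \<Sum>i\<in>UNIV. k $ i"]) (auto simp: modes_def)
qed

text \<open>The coefficients of \<open>g\<close> are those of its Laplacian divided by the eigenvalues, so that each term is
  a product of a square summable coefficient and the power \<open>-3/2\<close> of an eigenvalue.\<close>

lemma coef_decay_summable:
  fixes g :: "real^'n \<Rightarrow> real"
  assumes "CARD('n) \<le> 3" "C2 g" "zero_normal_deriv g"
  shows "(\<lambda>k. \<bar>coef g k\<bar> / sqrt (neumann_eigenval k)) summable_on {k. k \<noteq> 0}"
proof (rule nonneg_bdd_above_summable_on)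
  let ?D = "\<lambda>k. coef (laplacian g) k" and ?l = "neumann_eigenval :: nat^'n \<Rightarrow> real"
  have Dc: "continuous_on ccube (laplacian g)" by (rule C2_continuous_laplacian[OF assms(2)])
  have term_le: "\<bar>coef g k\<bar> / sqrt (?l k) \<le> (?D k)\<^sup>2 + 64 * (\<Prod>i\<in>UNIV. (1 / (1 + real (k $ i)))\<^sup>2)"
    if "k \<noteq> 0" for k
  proof -
    have l: "?l k > 0" using eigenval_pos[OF that] .
    have "\<bar>?D k\<bar> = ?l k * \<bar>coef g k\<bar>" using coef_laplacian[OF assms(2,3)] l by (simp add: abs_mult)
    then have "\<bar>coef g k\<bar> / sqrt (?l k) = \<bar>?D k\<bar> * (1 / (?l k * sqrt (?l k)))" using l by (simp add: field_simps)
    also have "\<dots> \<le> (?D k)\<^sup>2 + (1 / (?l k * sqrt (?l k)))\<^sup>2"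
      using mult_le_sum_squares[of "\<bar>?D k\<bar>" "1 / (?l k * sqrt (?l k))"] by simp
    also have "(1 / (?l k * sqrt (?l k)))\<^sup>2 = 1 / ?l k ^ 3"
      using l by (simp add: power_divide power_mult_distrib power2_eq_square power3_eq_cube)
    also have "\<dots> \<le> 64 * (\<Prod>i\<in>UNIV. (1 / (1 + real (k $ i)))\<^sup>2)"
      by (rule inverse_eigenval_cube_le[OF assms(1) that])
    finally show ?thesis by simp
  qed
  have "sum (\<lambda>k. \<bar>coef g k\<bar> / sqrt (?l k)) F \<le> cint (\<lambda>x. (laplacian g x)\<^sup>2) + 64 * 2 ^ CARD('n)"
    if F: "F \<subseteq> {k. k \<noteq> 0}" "finite F" for F
  proof -
    obtain N where N: "F \<subseteq> modes N" using finite_subset_modes[OF F(2)] by blast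
    have "sum (\<lambda>k. \<bar>coef g k\<bar> / sqrt (?l k)) F
       \<le> (\<Sum>k\<in>F. (?D k)\<^sup>2 + 64 * (\<Prod>i\<in>UNIV. (1 / (1 + real (k $ i)))\<^sup>2))"
      using F by (intro sum_mono term_le) auto
    also have "\<dots> \<le> (\<Sum>k\<in>modes N. (?D k)\<^sup>2 + 64 * (\<Prod>i\<in>UNIV. (1 / (1 + real (k $ i)))\<^sup>2))"
      using N by (intro sum_mono2 finite_modes) (auto intro!: add_nonneg_nonneg mult_nonneg_nonneg prod_nonneg)
    also have "\<dots> = (\<Sum>k\<in>modes N. (?D k)\<^sup>2) + 64 * (\<Sum>m\<le>N. (1 / (1 + real m))\<^sup>2) ^ CARD('n)"
      unfolding sum.distrib sum_distrib_left[symmetric]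
        sum_modes_prod(1)[where a = "\<lambda>m. (1 / (1 + real m))\<^sup>2"] ..
    also have "\<dots> \<le> cint (\<lambda>x. (laplacian g x)\<^sup>2) + 64 * 2 ^ CARD('n)"
    proof (intro add_mono mult_left_mono power_mono bessel[OF Dc])
      show "(\<Sum>m\<le>N. (1 / (1 + real m))\<^sup>2) \<le> 2"
        by (rule order_trans[OF sum_inverse_squares_le]) simp
    qed (auto intro: sum_nonneg)
    finally show ?thesis .
  qed
  then show "bdd_above (sum (\<lambda>k. \<bar>coef g k\<bar> / sqrt (neumann_eigenval k)) ` {F. F \<subseteq> {k. k \<noteq> 0} \<and> finite F})"
    by (intro bdd_aboveI2[where M = "cint (\<lambda>x. (laplacian g x)\<^sup>2) + 64 * 2 ^ CARD('n)"]) auto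
qed (simp add: eigenval_nonneg)

text \<open>Absolute summability makes the spectral series converge uniformly, hence in \<open>L\<^sup>2\<close>.\<close>

lemma ex_inv_sqrt_neumann:
  fixes g :: "real^'n \<Rightarrow> real"
  assumes "CARD('n) \<le> 3" "C2 g" "zero_normal_deriv g"
  shows "\<exists>h. has_inv_sqrt_neumann g h"
proof -
  define s where "s = (\<lambda>A x. \<Sum>k\<in>A. coef g k / sqrt (neumann_eigenval k) * neumann_eigenfun k x)"
  define h where "h = (\<lambda>x. \<Sum>\<^sub>\<infinity>k\<in>{k. k \<noteq> 0}. coef g k / sqrt (neumann_eigenval k) * neumann_eigenfun k x)"
  have unif: "uniform_limit UNIV s h (finite_subsets_at_top {k. k \<noteq> 0})"
    unfolding s_def h_def
  proof (rule Weierstrass_m_test_general)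
    fix k and x :: "real^'n"
    show "norm (coef g k / sqrt (neumann_eigenval k) * neumann_eigenfun k x)
       \<le> \<bar>coef g k\<bar> / sqrt (neumann_eigenval k) * sqrt 2 ^ CARD('n)"
      unfolding real_norm_def abs_mult abs_divide
      using eigenfun_bound[of k x] eigenval_nonneg[of k] by (intro mult_mono divide_right_mono) auto
    show "(\<lambda>k. \<bar>coef g k\<bar> / sqrt (neumann_eigenval k) * sqrt 2 ^ CARD('n)) summable_on {k. k \<noteq> 0}"
      by (intro summable_on_cmult_left coef_decay_summable assms)
  qed
  have sc: "continuous_on S (s A)" for S A
    unfolding s_def by (intro continuous_intros eigenfun_continuous)
  have hc: "continuous_on UNIV h"
    by (rule uniform_limit_theorem[OF _ unif]) (use sc in auto)
  then have hcS: "continuous_on S h" for S by (rule continuous_on_subset) simp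
  have "((\<lambda>A. Lp_norm 2 (\<lambda>x. h x - s A x)) \<longlongrightarrow> 0) (finite_subsets_at_top {k. k \<noteq> 0})"
  proof (rule tendstoI)
    fix e :: real assume "e > 0"
    then have "eventually (\<lambda>A. \<forall>x\<in>UNIV. dist (s A x) (h x) < e / 2) (finite_subsets_at_top {k. k \<noteq> 0})"
      by (intro unif[unfolded uniform_limit_iff, rule_format]) simp
    then show "eventually (\<lambda>A. dist (Lp_norm 2 (\<lambda>x. h x - s A x)) 0 < e) (finite_subsets_at_top {k. k \<noteq> 0})"
    proof eventually_elim
      case (elim A)
      have "cint (\<lambda>x. (h x - s A x)\<^sup>2) \<le> cint (\<lambda>x::real^'n. (e / 2)\<^sup>2)"
      proof (rule cint_mono)
        fix x show "(h x - s A x)\<^sup>2 \<le> (e / 2)\<^sup>2"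
          using elim \<open>e > 0\<close> by (intro power2_le_iff_abs_le[THEN iffD2]) (auto simp: dist_real_def abs_minus_commute less_imp_le)
      qed (intro continuous_intros sc hcS)+
      then have "cint (\<lambda>x. (h x - s A x)\<^sup>2) \<le> (e / 2)\<^sup>2" by (simp only: cint_const)
      then have "Lp_norm 2 (\<lambda>x. h x - s A x) \<le> e / 2"
        unfolding Lp_norm_2 using \<open>e > 0\<close> by (intro real_le_lsqrt) auto
      moreover have "Lp_norm 2 (\<lambda>x. h x - s A x) \<ge> 0"
        unfolding Lp_norm_2 by (intro real_sqrt_ge_zero cint_nonneg) auto
      ultimately show ?case using \<open>e > 0\<close> by (simp add: dist_real_def)
    qed
  qed
  then have "has_inv_sqrt_neumann g h"
    unfolding has_inv_sqrt_neumann_def s_def coef_def using L2_continuous[OF hcS] by (intro conjI)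
  then show ?thesis by (rule exI[where x = h])
qed

lemma filterlim_modes:
  "filterlim (\<lambda>N. modes N - {0::nat^'n}) (finite_subsets_at_top {k. k \<noteq> 0}) sequentially"
  unfolding filterlim_iff eventually_finite_subsets_at_top
proof (intro allI impI)
  fix P assume "\<exists>X. finite X \<and> X \<subseteq> {k::nat^'n. k \<noteq> 0} \<and> (\<forall>Y. finite Y \<and> X \<subseteq> Y \<and> Y \<subseteq> {k. k \<noteq> 0} \<longrightarrow> P Y)"
  then obtain X where "finite X \<and> X \<subseteq> {k::nat^'n. k \<noteq> 0} \<and> (\<forall>Y. finite Y \<and> X \<subseteq> Y \<and> Y \<subseteq> {k. k \<noteq> 0} \<longrightarrow> P Y)"
    by (rule exE)
  then have X: "finite X" "X \<subseteq> {k. k \<noteq> 0}" and P: "\<And>Y. finite Y \<and> X \<subseteq> Y \<and> Y \<subseteq> {k. k \<noteq> 0} \<Longrightarrow> P Y"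
    by simp_all
  obtain N where N: "X \<subseteq> modes N" using finite_subset_modes[OF X(1)] ..
  have "P (modes M - {0})" if "M \<ge> N" for M
  proof (rule P, intro conjI)
    show "finite (modes M - {0::nat^'n})" using finite_modes by (rule finite_Diff)
    show "X \<subseteq> modes M - {0}" using X(2) N modes_mono[OF that] by blast
  qed blast
  then show "eventually (\<lambda>N. P (modes N - {0})) sequentially" by (auto simp: eventually_sequentially)
qed

text \<open>Testing the error of a partial sum against a single mode identifies the coefficients of the limit
  \<open>h\<close>, whichever representative it is. The square norm of the error is then the square norm of \<open>h\<close> minus
  a partial sum of the series.\<close>

lemma inv_sqrt_neumann_norm:
  fixes g :: "real^'n \<Rightarrow> real"
  assumes g: "continuous_on ccube g" and h: "has_inv_sqrt_neumann g h"
  shows "(Lp_norm 2 h)\<^sup>2 = hm1_sq g"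
proof -
  define a where "a = (\<lambda>k. coef g k / sqrt (neumann_eigenval k))"
  define s where "s = (\<lambda>A x. \<Sum>k\<in>A. a k * neumann_eigenfun k x)"
  define b where "b = (\<lambda>k. cint (\<lambda>x. h x * neumann_eigenfun k x))"
  let ?F = "finite_subsets_at_top {k::nat^'n. k \<noteq> 0}"
  have hL: "L2 h" and lim: "((\<lambda>A. Lp_norm 2 (\<lambda>x. h x - s A x)) \<longlongrightarrow> 0) ?F"
    using h unfolding has_inv_sqrt_neumann_def s_def a_def coef_def by auto
  have sc: "continuous_on S (s A)" for S A
    unfolding s_def by (intro continuous_intros eigenfun_continuous)
  have phiL: "L2 (neumann_eigenfun k :: real^'n \<Rightarrow> real)" for k by (rule L2_continuous[OF eigenfun_continuous])
  have dL: "L2 (\<lambda>x. h x - s A x)" for A by (rule L2_diff[OF hL L2_continuous[OF sc]])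
  have lim2: "((\<lambda>A. cint (\<lambda>x. (h x - s A x)\<^sup>2)) \<longlongrightarrow> 0) ?F"
    using tendsto_power[OF lim, of 2] by (simp add: Lp_norm_2_sq)
  have sphi: "cint (\<lambda>x. s A x * neumann_eigenfun k x) = a k" if "k \<in> A" "finite A" for A k
  proof -
    have "cint (\<lambda>x. s A x * neumann_eigenfun k x) = (\<Sum>l\<in>A. a l * cint (\<lambda>x. neumann_eigenfun l x * neumann_eigenfun k x))"
      unfolding s_def sum_distrib_right mult.assoc
      by (subst cint_sum) (auto intro!: continuous_intros eigenfun_continuous)
    also have "\<dots> = (\<Sum>l\<in>A. if l = k then a l else 0)"
      by (intro sum.cong refl) (use eigenfun_orthogonal eigenfun_normalized in auto)
    finally show ?thesis using that by (simp add: sum.delta)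
  qed
  have beta: "cint (\<lambda>x. (h x - s A x) * neumann_eigenfun k x) = b k - a k" if "k \<in> A" "finite A" for A k
  proof -
    have "cint (\<lambda>x. (h x - s A x) * neumann_eigenfun k x) = b k - cint (\<lambda>x. s A x * neumann_eigenfun k x)"
      unfolding left_diff_distrib b_def
      by (rule Bochner_Integration.integral_diff[OF L2_mult[OF hL phiL] L2_mult[OF L2_continuous[OF sc] phiL]])
    then show ?thesis using sphi[OF that] by simp
  qed
  have "b k = a k" if k: "k \<noteq> 0" for k
  proof -
    have bound: "(b k - a k)\<^sup>2 \<le> cint (\<lambda>x. (h x - s A x)\<^sup>2)" if A: "finite A" "k \<in> A" for A
    proof -
      let ?d = "\<lambda>x. h x - s A x" and ?c = "b k - a k" and ?p = "neumann_eigenfun k"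
      have "0 \<le> cint (\<lambda>x. (?d x - ?c * ?p x)\<^sup>2)" by (rule cint_nonneg) simp
      also have "\<dots> = cint (\<lambda>x. (?d x * ?d x - (2 * ?c) * (?d x * ?p x)) + ?c\<^sup>2 * (?p x * ?p x))"
        by (intro cint_cong) (simp add: power2_eq_square algebra_simps)
      also have "\<dots> = cint (\<lambda>x. ?d x * ?d x) - (2 * ?c) * cint (\<lambda>x. ?d x * ?p x) + ?c\<^sup>2 * cint (\<lambda>x. ?p x * ?p x)"
        using L2_mult[OF dL dL, of A A] L2_mult[OF dL phiL, of A k] L2_mult[OF phiL phiL, of k k] by simp
      also have "\<dots> = cint (\<lambda>x. (?d x)\<^sup>2) - ?c\<^sup>2"
        using beta[OF A(2,1)] eigenfun_normalized[of k] by (simp add: power2_eq_square)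
      finally show ?thesis by simp
    qed
    have "eventually (\<lambda>A. finite A \<and> k \<in> A) ?F"
      unfolding eventually_finite_subsets_at_top using k by (intro exI[of _ "{k}"]) auto
    then have "eventually (\<lambda>A. (b k - a k)\<^sup>2 \<le> cint (\<lambda>x. (h x - s A x)\<^sup>2)) ?F"
      by eventually_elim (rule bound; simp)
    then have "(b k - a k)\<^sup>2 \<le> 0"
      by (rule tendsto_lowerbound[OF lim2]) (rule finite_subsets_at_top_neq_bot)
    then show ?thesis by simp
  qed
  note ba = this
  have norm: "cint (\<lambda>x. (h x - s A x)\<^sup>2) = cint (\<lambda>x. (h x)\<^sup>2) - (\<Sum>k\<in>A. (a k)\<^sup>2)"
    if A: "finite A" "A \<subseteq> {k. k \<noteq> 0}" for A
  proof -
    have sx: "cint (\<lambda>x. f x * s A x) = (\<Sum>k\<in>A. a k * cint (\<lambda>x. f x * neumann_eigenfun k x))" if f: "L2 f" for f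
    proof -
      have "cint (\<lambda>x. f x * s A x) = cint (\<lambda>x. \<Sum>k\<in>A. a k * (f x * neumann_eigenfun k x))"
        by (simp add: s_def sum_distrib_left mult_ac)
      also have "\<dots> = (\<Sum>k\<in>A. cint (\<lambda>x. a k * (f x * neumann_eigenfun k x)))"
        by (rule Bochner_Integration.integral_sum) (use L2_mult[OF f phiL] in auto)
      finally show ?thesis by simp
    qed
    have "cint (\<lambda>x. (h x - s A x)\<^sup>2) = cint (\<lambda>x. (h x * h x - h x * s A x) - (h x - s A x) * s A x)"
      by (simp add: power2_eq_square algebra_simps)
    also have "\<dots> = cint (\<lambda>x. h x * h x) - cint (\<lambda>x. h x * s A x) - cint (\<lambda>x. (h x - s A x) * s A x)"
      using L2_mult[OF hL hL] L2_mult[OF hL L2_continuous[OF sc]] L2_mult[OF dL L2_continuous[OF sc]] by simp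
    also have "cint (\<lambda>x. h x * s A x) = (\<Sum>k\<in>A. (a k)\<^sup>2)"
      unfolding sx[OF hL] using A ba
      by (intro sum.cong refl) (auto simp: b_def power2_eq_square)
    also have "cint (\<lambda>x. (h x - s A x) * s A x) = 0"
      unfolding sx[OF dL] using A ba by (intro sum.neutral) (auto simp: beta)
    finally show ?thesis by (simp add: power2_eq_square)
  qed
  have "(\<lambda>N. cint (\<lambda>x. (h x - s (modes N - {0}) x)\<^sup>2)) \<longlonglongrightarrow> 0"
    using lim2 filterlim_modes by (rule filterlim_compose)
  moreover have "cint (\<lambda>x. (h x - s (modes N - {0}) x)\<^sup>2) = cint (\<lambda>x. (h x)\<^sup>2) - (\<Sum>k\<in>modes N - {0}. (a k)\<^sup>2)" for N
    by (rule norm) (auto simp: finite_modes)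
  ultimately have "(\<lambda>N. cint (\<lambda>x. (h x)\<^sup>2) - (\<Sum>k\<in>modes N - {0}. (a k)\<^sup>2)) \<longlonglongrightarrow> 0"
    by simp
  moreover have "(a k)\<^sup>2 = (coef g k)\<^sup>2 / neumann_eigenval k" for k
    using eigenval_nonneg[of k] by (simp add: a_def power_divide)
  ultimately have "(\<lambda>N. cint (\<lambda>x. (h x)\<^sup>2) - (\<Sum>k\<in>modes N - {0}. (coef g k)\<^sup>2 / neumann_eigenval k)) \<longlonglongrightarrow> 0"
    by simp
  moreover have "(\<lambda>N. cint (\<lambda>x. (h x)\<^sup>2) - (\<Sum>k\<in>modes N - {0}. (coef g k)\<^sup>2 / neumann_eigenval k))
      \<longlonglongrightarrow> cint (\<lambda>x. (h x)\<^sup>2) - hm1_sq g"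
    by (intro tendsto_intros hm1_sq_tendsto g)
  ultimately have "cint (\<lambda>x. (h x)\<^sup>2) - hm1_sq g = 0" using LIMSEQ_unique by blast
  then show ?thesis by (simp add: Lp_norm_2_sq)
qed

lemma Hm1_norm_sq:
  fixes g :: "real^'n \<Rightarrow> real"
  assumes "CARD('n) \<le> 3" "C2 g" "zero_normal_deriv g" "cint g = 0"
  shows "(Hm1_norm g)\<^sup>2 = hm1_sq g"
proof -
  have gc: "continuous_on ccube g" using assms(2) C1_continuous by (auto simp: C2_def)
  have "has_inv_sqrt_neumann g (inv_sqrt_neumann g)"
    unfolding inv_sqrt_neumann_def by (rule someI_ex[OF ex_inv_sqrt_neumann[OF assms(1-3)]])
  then have "(Lp_norm 2 (inv_sqrt_neumann g))\<^sup>2 = hm1_sq g" by (rule inv_sqrt_neumann_norm[OF gc])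
  moreover have "mean g = 0" using assms(4) by (simp add: mean_def)
  ultimately show ?thesis using hm1_sq_nonneg[OF gc] by (simp add: Hm1_norm_def)
qed

section \<open>Interpolation and the cubic term\<close>

abbreviation dirichlet :: "(real^'n \<Rightarrow> real) \<Rightarrow> real" where
  "dirichlet g \<equiv> cint (\<lambda>x. (norm (grad g x))\<^sup>2)"

lemma dirichlet_spectral:
  fixes g :: "real^'n \<Rightarrow> real"
  assumes "C2 g" "zero_normal_deriv g"
  shows "(\<lambda>N. \<Sum>k\<in>modes N. neumann_eigenval k * (coef g k)\<^sup>2) \<longlonglongrightarrow> dirichlet g"
proof -
  have g: "C1 g" using assms(1) by (simp add: C2_def)
  have "(\<lambda>N. - (\<Sum>k\<in>modes N. coef (laplacian g) k * coef g k)) \<longlonglongrightarrow> - cint (\<lambda>x. laplacian g x * g x)"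
    by (intro tendsto_minus parseval_inner C2_continuous_laplacian C1_continuous g assms)
  moreover have "- cint (\<lambda>x. laplacian g x * g x) = dirichlet g"
    by (simp add: green_first[OF assms(1) g assms(2)] power2_norm_eq_inner)
  moreover have "- (\<Sum>k\<in>modes N. coef (laplacian g) k * coef g k) = (\<Sum>k\<in>modes N. neumann_eigenval k * (coef g k)\<^sup>2)" for N
    by (simp add: coef_laplacian[OF assms] sum_negf power2_eq_square mult.assoc)
  ultimately show ?thesis by simp
qed

lemma coef_0: "coef g 0 = cint g"
  by (simp add: coef_def)

text \<open>Holds mode by mode, because \<open>1 \<le> \<mu> * \<lambda> + 1 / (4 * \<mu> * \<lambda>)\<close>; the mean is zero, so the constant mode, for
  which this fails, is absent.\<close>

lemma l2_interpolation:
  fixes g :: "real^'n \<Rightarrow> real"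
  assumes g: "C2 g" "zero_normal_deriv g" "cint g = 0" and "\<mu> > 0"
  shows "cint (\<lambda>x. (g x)\<^sup>2) \<le> \<mu> * dirichlet g + hm1_sq g / (4 * \<mu>)"
proof (rule LIMSEQ_le)
  have gc: "continuous_on ccube g" using g(1) C1_continuous by (auto simp: C2_def)
  show "(\<lambda>N. \<Sum>k\<in>modes N. (coef g k)\<^sup>2) \<longlonglongrightarrow> cint (\<lambda>x. (g x)\<^sup>2)" by (rule parseval[OF gc])
  show "(\<lambda>N. \<mu> * (\<Sum>k\<in>modes N. neumann_eigenval k * (coef g k)\<^sup>2)
      + (\<Sum>k\<in>modes N - {0}. (coef g k)\<^sup>2 / neumann_eigenval k) / (4 * \<mu>)) \<longlonglongrightarrow> \<mu> * dirichlet g + hm1_sq g / (4 * \<mu>)"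
    using \<open>\<mu> > 0\<close> by (intro tendsto_intros dirichlet_spectral hm1_sq_tendsto gc g) auto
  have "(\<Sum>k\<in>modes N. (coef g k)\<^sup>2) \<le> \<mu> * (\<Sum>k\<in>modes N. neumann_eigenval k * (coef g k)\<^sup>2)
      + (\<Sum>k\<in>modes N - {0}. (coef g k)\<^sup>2 / neumann_eigenval k) / (4 * \<mu>)" for N
  proof -
    have rem: "(\<Sum>k\<in>modes N. f k) = (\<Sum>k\<in>modes N - {0}. f k)" if "f 0 = 0" for f :: "nat^'n \<Rightarrow> real"
      using that sum.remove[OF finite_modes zero_in_modes, of f N] by simp
    have "(\<Sum>k\<in>modes N. (coef g k)\<^sup>2) = (\<Sum>k\<in>modes N - {0}. (coef g k)\<^sup>2)"
      by (rule rem) (simp add: coef_0 g(3))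
    also have "\<dots> \<le> (\<Sum>k\<in>modes N - {0}. \<mu> * (neumann_eigenval k * (coef g k)\<^sup>2) + (coef g k)\<^sup>2 / neumann_eigenval k / (4 * \<mu>))"
    proof (rule sum_mono)
      fix k :: "nat^'n" assume "k \<in> modes N - {0}"
      then have l: "neumann_eigenval k > 0" using eigenval_pos by blast
      have "1 \<le> \<mu> * neumann_eigenval k + 1 / (4 * \<mu> * neumann_eigenval k)"
      proof -
        have "1 \<le> a + 1 / (4 * a)" if "a > 0" for a :: real
        proof -
          have "0 \<le> (2 * a - 1)\<^sup>2" by simp
          then show ?thesis using that by (simp add: field_simps power2_eq_square)
        qed
        from this[of "\<mu> * neumann_eigenval k"] show ?thesis using l \<open>\<mu> > 0\<close> by (simp add: mult.assoc)
      qed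
      then have "(coef g k)\<^sup>2 * 1 \<le> (coef g k)\<^sup>2 * (\<mu> * neumann_eigenval k + 1 / (4 * \<mu> * neumann_eigenval k))"
        by (rule mult_left_mono) simp
      then show "(coef g k)\<^sup>2 \<le> \<mu> * (neumann_eigenval k * (coef g k)\<^sup>2) + (coef g k)\<^sup>2 / neumann_eigenval k / (4 * \<mu>)"
        by (simp add: algebra_simps)
    qed
    also have "\<dots> = \<mu> * (\<Sum>k\<in>modes N - {0}. neumann_eigenval k * (coef g k)\<^sup>2)
      + (\<Sum>k\<in>modes N - {0}. (coef g k)\<^sup>2 / neumann_eigenval k) / (4 * \<mu>)"
      by (simp only: sum.distrib sum_distrib_left sum_divide_distrib)
    also have "(\<Sum>k\<in>modes N - {0}. neumann_eigenval k * (coef g k)\<^sup>2) = (\<Sum>k\<in>modes N. neumann_eigenval k * (coef g k)\<^sup>2)"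
      by (rule rem[symmetric]) simp
    finally show ?thesis .
  qed
  then show "\<exists>N0. \<forall>N\<ge>N0. (\<Sum>k\<in>modes N. (coef g k)\<^sup>2) \<le> \<mu> * (\<Sum>k\<in>modes N. neumann_eigenval k * (coef g k)\<^sup>2)
      + (\<Sum>k\<in>modes N - {0}. (coef g k)\<^sup>2 / neumann_eigenval k) / (4 * \<mu>)" by blast
qed

text \<open>An index outside the box has a component larger than \<open>N\<close>, hence an eigenvalue above \<open>N\<^sup>2\<close>.\<close>

lemma high_part_le:
  fixes g :: "real^'n \<Rightarrow> real"
  assumes g: "C2 g" "zero_normal_deriv g" and "N \<ge> 1"
  shows "cint (\<lambda>x. (g x - low_part N g x)\<^sup>2) \<le> dirichlet g / (real N)\<^sup>2"
proof -
  have gc: "continuous_on ccube g" using g(1) C1_continuous by (auto simp: C2_def)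
  have le: "(\<Sum>k\<in>modes M. (coef g k)\<^sup>2) - (\<Sum>k\<in>modes N. (coef g k)\<^sup>2)
      \<le> (\<Sum>k\<in>modes M. neumann_eigenval k * (coef g k)\<^sup>2) / (real N)\<^sup>2" if "M \<ge> N" for M
  proof -
    have "(\<Sum>k\<in>modes M. (coef g k)\<^sup>2) - (\<Sum>k\<in>modes N. (coef g k)\<^sup>2) = (\<Sum>k\<in>modes M - modes N. (coef g k)\<^sup>2)"
      by (rule sum_diff[OF finite_modes modes_mono[OF that], symmetric])
    also have "\<dots> \<le> (\<Sum>k\<in>modes M - modes N. neumann_eigenval k * (coef g k)\<^sup>2 / (real N)\<^sup>2)"
    proof (rule sum_mono)
      fix k :: "nat^'n" assume "k \<in> modes M - modes N"
      then obtain i where i: "k $ i > N" by (auto simp: modes_def not_le)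
      have "real N \<le> pi * real (k $ i)"
        using i pi_gt3 mult_mono[of 1 pi "real N" "real (k $ i)"] by simp
      then have "(real N)\<^sup>2 \<le> (pi * real (k $ i))\<^sup>2" by (intro power_mono) auto
      then have "(real N)\<^sup>2 \<le> neumann_eigenval k" using eigenval_ge[of k i] by linarith
      then have "(real N)\<^sup>2 * (coef g k)\<^sup>2 \<le> neumann_eigenval k * (coef g k)\<^sup>2" by (rule mult_right_mono) simp
      then show "(coef g k)\<^sup>2 \<le> neumann_eigenval k * (coef g k)\<^sup>2 / (real N)\<^sup>2"
        using \<open>N \<ge> 1\<close> by (simp add: pos_le_divide_eq mult.commute)
    qed
    also have "\<dots> \<le> (\<Sum>k\<in>modes M. neumann_eigenval k * (coef g k)\<^sup>2 / (real N)\<^sup>2)"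
      by (intro sum_mono2 finite_modes) (auto simp: eigenval_nonneg)
    finally show ?thesis by (simp add: sum_divide_distrib)
  qed
  have "cint (\<lambda>x. (g x)\<^sup>2) - (\<Sum>k\<in>modes N. (coef g k)\<^sup>2) \<le> dirichlet g / (real N)\<^sup>2"
  proof (rule LIMSEQ_le)
    show "(\<lambda>M. (\<Sum>k\<in>modes M. (coef g k)\<^sup>2) - (\<Sum>k\<in>modes N. (coef g k)\<^sup>2))
       \<longlonglongrightarrow> cint (\<lambda>x. (g x)\<^sup>2) - (\<Sum>k\<in>modes N. (coef g k)\<^sup>2)"
      by (intro tendsto_intros parseval gc)
    show "(\<lambda>M. (\<Sum>k\<in>modes M. neumann_eigenval k * (coef g k)\<^sup>2) / (real N)\<^sup>2) \<longlonglongrightarrow> dirichlet g / (real N)\<^sup>2"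
      using \<open>N \<ge> 1\<close> by (intro tendsto_intros dirichlet_spectral g) auto
    show "\<exists>M0. \<forall>M\<ge>M0. (\<Sum>k\<in>modes M. (coef g k)\<^sup>2) - (\<Sum>k\<in>modes N. (coef g k)\<^sup>2)
      \<le> (\<Sum>k\<in>modes M. neumann_eigenval k * (coef g k)\<^sup>2) / (real N)\<^sup>2" using le by (intro exI[of _ N]) blast
  qed
  then show ?thesis by (simp add: norm_high_part[OF gc])
qed

lemma sum_eigenval_le:
  assumes "CARD('n) \<le> 3" "N \<ge> 1"
  shows "(\<Sum>k\<in>(modes N :: (nat^'n) set). neumann_eigenval k) \<le> 384 * real N ^ 5"
proof -
  have card: "real (card (modes N :: (nat^'n) set)) = (real N + 1) ^ CARD('n)"
    using sum_modes_prod(1)[of "\<lambda>_. 1" N, where 'n='n] by (simp add: add.commute)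
  have "neumann_eigenval k \<le> 48 * (real N)\<^sup>2" if "k \<in> modes N" for k :: "nat^'n"
  proof -
    have "(\<Sum>i\<in>UNIV. (real (k $ i))\<^sup>2) \<le> (\<Sum>i\<in>(UNIV::'n set). (real N)\<^sup>2)"
      using that by (intro sum_mono power_mono) (auto simp: modes_def)
    also have "\<dots> \<le> 3 * (real N)\<^sup>2" using assms(1) by (simp add: mult_right_mono)
    finally have "neumann_eigenval k \<le> pi\<^sup>2 * (3 * (real N)\<^sup>2)"
      unfolding neumann_eigenval_def by (rule mult_left_mono) simp
    also have "\<dots> \<le> 16 * (3 * (real N)\<^sup>2)"
      using power_mono[of pi 4 2] pi_less_4 pi_gt_zero by (intro mult_right_mono) auto
    finally show ?thesis by simp
  qed
  then have "(\<Sum>k\<in>(modes N :: (nat^'n) set). neumann_eigenval k) \<le> (\<Sum>k\<in>(modes N :: (nat^'n) set). 48 * (real N)\<^sup>2)"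
    by (rule sum_mono)
  also have "\<dots> = (real N + 1) ^ CARD('n) * (48 * (real N)\<^sup>2)" by (simp add: card)
  also have "\<dots> \<le> (real N + 1) ^ 3 * (48 * (real N)\<^sup>2)"
    by (intro mult_right_mono power_increasing assms) auto
  also have "\<dots> \<le> (2 * real N) ^ 3 * (48 * (real N)\<^sup>2)"
    using assms(2) by (intro mult_right_mono power_mono) auto
  also have "\<dots> = 384 * real N ^ 5" by (simp add: numeral_eq_Suc)
  finally show ?thesis .
qed

text \<open>Low frequencies are bounded pointwise by the negative norm, at the price of a power of \<open>N\<close>: the
  Cauchy--Schwarz inequality with the eigenvalues as weights.\<close>

lemma low_part_le:
  fixes g :: "real^'n \<Rightarrow> real"
  assumes "CARD('n) \<le> 3" "continuous_on ccube g" "cint g = 0" "N \<ge> 1"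
  shows "(low_part N g x)\<^sup>2 \<le> 3072 * real N ^ 5 * hm1_sq g"
proof -
  let ?l = "neumann_eigenval :: nat^'n \<Rightarrow> real" and ?A = "modes N - {0 :: nat^'n}"
  have "low_part N g x = (\<Sum>k\<in>?A. coef g k * neumann_eigenfun k x)"
    unfolding low_part_def by (subst sum.remove[OF finite_modes zero_in_modes]) (simp add: coef_0 assms(3))
  also have "\<dots> = (\<Sum>k\<in>?A. (sqrt (?l k) * neumann_eigenfun k x) * (coef g k / sqrt (?l k)))"
    by (intro sum.cong refl) (use eigenval_pos in fastforce)
  finally have "(low_part N g x)\<^sup>2 \<le> (\<Sum>k\<in>?A. (sqrt (?l k) * neumann_eigenfun k x)\<^sup>2) * (\<Sum>k\<in>?A. (coef g k / sqrt (?l k))\<^sup>2)"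
    using Cauchy_Schwarz_ineq_sum by metis
  also have "(\<Sum>k\<in>?A. (coef g k / sqrt (?l k))\<^sup>2) = (\<Sum>k\<in>?A. (coef g k)\<^sup>2 / ?l k)"
    by (simp add: power_divide eigenval_nonneg)
  also have "(\<Sum>k\<in>?A. (sqrt (?l k) * neumann_eigenfun k x)\<^sup>2) * (\<Sum>k\<in>?A. (coef g k)\<^sup>2 / ?l k)
     \<le> (8 * (384 * real N ^ 5)) * hm1_sq g"
  proof (rule mult_mono)
    have phi: "(neumann_eigenfun k x)\<^sup>2 \<le> 8" for k
    proof -
      have "(neumann_eigenfun k x)\<^sup>2 \<le> (sqrt 2 ^ CARD('n))\<^sup>2"
        using eigenfun_bound[of k x] by (simp add: abs_le_square_iff[symmetric])
      also have "\<dots> = 2 ^ CARD('n)" by (simp add: power_mult[symmetric] mult.commute[of _ 2]) (simp add: power_mult)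
      also have "\<dots> \<le> 2 ^ 3" by (intro power_increasing assms) auto
      finally show ?thesis by simp
    qed
    have "(\<Sum>k\<in>?A. (sqrt (?l k) * neumann_eigenfun k x)\<^sup>2) \<le> (\<Sum>k\<in>?A. 8 * ?l k)"
    proof (rule sum_mono)
      fix k show "(sqrt (?l k) * neumann_eigenfun k x)\<^sup>2 \<le> 8 * ?l k"
        using mult_left_mono[OF phi[of k] eigenval_nonneg[of k]] by (simp add: power_mult_distrib eigenval_nonneg mult.commute)
    qed
    also have "\<dots> \<le> (\<Sum>k\<in>modes N. 8 * ?l k)" by (intro sum_mono2 finite_modes) (auto simp: eigenval_nonneg)
    also have "\<dots> \<le> 8 * (384 * real N ^ 5)"
      using sum_eigenval_le[OF assms(1,4)] by (simp add: sum_distrib_left[symmetric])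
    finally show "(\<Sum>k\<in>?A. (sqrt (?l k) * neumann_eigenfun k x)\<^sup>2) \<le> 8 * (384 * real N ^ 5)" .
    show "(\<Sum>k\<in>?A. (coef g k)\<^sup>2 / ?l k) \<le> hm1_sq g" by (rule hm1_sq_ge[OF assms(2)])
  qed (auto intro!: sum_nonneg simp: eigenval_nonneg)
  finally show ?thesis by simp
qed

text \<open>Here \<open>a\<close> and \<open>b\<close> stand for the parts of \<open>g\<close> below a high and a low cut-off frequency. Where \<open>|g|\<close> is at
  least twice as large as one of them, \<open>g\<close> is controlled by the complementary part. Small values of
  \<open>g\<close> need no splitting, intermediate ones use \<open>b\<close>, and large ones use \<open>a\<close> together with the quartic
  term.\<close>

lemma cubic_pointwise:
  fixes g a b B e l :: real
  assumes B: "B \<ge> 0" and e: "0 < e" and l: "0 < l" "B * l \<le> e ^ 3" and ab: "\<bar>a\<bar> \<le> e / 2" "\<bar>b\<bar> \<le> l / 2"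
  shows "B * \<bar>g\<bar> ^ 3 \<le> g ^ 4 / 4 + e ^ 3 * g\<^sup>2 + 4 * B * e * (g - b)\<^sup>2 + 4 * B\<^sup>2 * (g - a)\<^sup>2"
proof -
  have pos: "0 \<le> g ^ 4 / 4" "0 \<le> e ^ 3 * g\<^sup>2" "0 \<le> 4 * B * e * (g - b)\<^sup>2" "0 \<le> 4 * B\<^sup>2 * (g - a)\<^sup>2"
    using B e by auto
  have cube: "\<bar>g\<bar> ^ 3 = \<bar>g\<bar> * g\<^sup>2" by (simp add: power3_eq_cube power2_eq_square mult.assoc)
  have half: "g\<^sup>2 \<le> 4 * (g - c)\<^sup>2" if "\<bar>c\<bar> \<le> \<bar>g\<bar> / 2" for c
  proof -
    have "\<bar>g\<bar> \<le> 2 * \<bar>g - c\<bar>" proof -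
      have "p \<le> 2 * r" if "q \<le> p / 2" "p - q \<le> r" for p q r :: real using that by linarith
      from this[OF that abs_triangle_ineq2] show ?thesis .
    qed
    then have "\<bar>g\<bar> \<le> \<bar>2 * (g - c)\<bar>" by (simp only: abs_mult abs_numeral)
    then have "g\<^sup>2 \<le> (2 * (g - c))\<^sup>2" by (simp add: abs_le_square_iff)
    also have "(2 * (g - c))\<^sup>2 = 4 * (g - c)\<^sup>2" by (simp only: power_mult_distrib) simp
    finally show ?thesis .
  qed
  consider "\<bar>g\<bar> \<le> l" | "l < \<bar>g\<bar>" "\<bar>g\<bar> \<le> e" | "e < \<bar>g\<bar>" by linarith
  then show ?thesis
  proof cases
    case 1
    have "B * \<bar>g\<bar> ^ 3 = (B * \<bar>g\<bar>) * g\<^sup>2" by (simp add: cube)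
    also have "\<dots> \<le> (B * l) * g\<^sup>2" using 1 B by (intro mult_right_mono mult_left_mono) auto
    also have "\<dots> \<le> e ^ 3 * g\<^sup>2" using l by (intro mult_right_mono) auto
    finally show ?thesis using pos by linarith
  next
    case 2
    have "B * \<bar>g\<bar> ^ 3 = (B * \<bar>g\<bar>) * g\<^sup>2" by (simp add: cube)
    also have "\<dots> \<le> (B * e) * (4 * (g - b)\<^sup>2)"
      using 2 B e ab half[of b] by (intro mult_mono mult_left_mono) auto
    also have "\<dots> = 4 * B * e * (g - b)\<^sup>2" by simp
    finally show ?thesis using pos by linarith
  next
    case 3
    have "0 \<le> (g\<^sup>2 / 2 - B * \<bar>g\<bar>)\<^sup>2" by simp
    also have "(g\<^sup>2 / 2 - B * \<bar>g\<bar>)\<^sup>2 = g ^ 4 / 4 + B\<^sup>2 * g\<^sup>2 - B * \<bar>g\<bar> ^ 3"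
    proof -
      have "(g\<^sup>2 / 2 - B * \<bar>g\<bar>)\<^sup>2 = (g\<^sup>2)\<^sup>2 / 4 + B\<^sup>2 * \<bar>g\<bar>\<^sup>2 - B * (\<bar>g\<bar> * g\<^sup>2)"
        by (simp add: power2_diff power_divide power_mult_distrib)
      then show ?thesis by (simp add: cube flip: power_mult)
    qed
    finally have "B * \<bar>g\<bar> ^ 3 \<le> g ^ 4 / 4 + B\<^sup>2 * g\<^sup>2" by simp
    also have "B\<^sup>2 * g\<^sup>2 \<le> B\<^sup>2 * (4 * (g - a)\<^sup>2)"
      using 3 ab half[of a] by (intro mult_left_mono) auto
    also have "\<dots> = 4 * B\<^sup>2 * (g - a)\<^sup>2" by simp
    finally show ?thesis using pos by linarith
  qed
qed

text \<open>A frequency splitting with a single cut-off would require \<open>hm1_sq g\<close> to be of order \<open>e\<close> to the power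
  \<open>37/2\<close> in dimension three, which is more than the error estimate provides. Two cut-offs, of order
  \<open>e\<^sup>-\<^sup>3\<close> and \<open>e\<^sup>-\<^sup>2\<close>, lower this to \<open>e\<close> to the power \<open>17\<close>.\<close>

lemma cubic_estimate:
  fixes g :: "real^'n \<Rightarrow> real" and B M e :: real
  assumes d: "CARD('n) \<le> 3" and g: "C2 g" "zero_normal_deriv g" "cint g = 0"
    and B: "B \<ge> 0" and M: "M \<ge> 1" "32 * B + 32 * B\<^sup>2 \<le> M\<^sup>2" and e: "0 < e" "e \<le> 1"
    and small: "hm1_sq g \<le> e ^ 17 / (393216 * M ^ 5 * (B + 1)\<^sup>2)"
  shows "B * cint (\<lambda>x. \<bar>g x\<bar> ^ 3) \<le> cint (\<lambda>x. g x ^ 4) / 4 + e ^ 3 * cint (\<lambda>x. (g x)\<^sup>2) + e ^ 5 / 4 * dirichlet g"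
proof -
  have gc: "continuous_on ccube g" using g(1) C1_continuous by (auto simp: C2_def)
  have Y0: "hm1_sq g \<ge> 0" by (rule hm1_sq_nonneg[OF gc])
  have X0: "dirichlet g \<ge> 0" by (rule cint_nonneg) simp
  have ceil: "\<exists>N::nat. N \<ge> 1 \<and> M / e ^ p \<le> real N \<and> real N \<le> 2 * (M / e ^ p)" for p
  proof -
    have "e ^ p \<le> 1" using e by (simp add: power_le_one)
    then have 1: "1 \<le> M / e ^ p" using M e by (simp add: pos_le_divide_eq order_trans)
    have "real (nat \<lceil>M / e ^ p\<rceil>) \<le> M / e ^ p + 1" "M / e ^ p \<le> real (nat \<lceil>M / e ^ p\<rceil>)"
      using 1 by linarith+
    then show ?thesis using 1 by (intro exI[of _ "nat \<lceil>M / e ^ p\<rceil>"]) linarith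
  qed
  \<comment> \<open>The cut-offs: the squared high parts gain \<open>e\<^sup>6\<close> and \<open>e\<^sup>4\<close>, while the squared low parts cost \<open>e\<^sup>-\<^sup>1\<^sup>5\<close> and \<open>e\<^sup>-\<^sup>1\<^sup>0\<close>.\<close>
  obtain N1 where N1: "N1 \<ge> 1" "M / e ^ 3 \<le> real N1" "real N1 \<le> 2 * (M / e ^ 3)" using ceil[of 3] by blast
  obtain N2 where N2: "N2 \<ge> 1" "M / e ^ 2 \<le> real N2" "real N2 \<le> 2 * (M / e ^ 2)" using ceil[of 2] by blast
  define l where "l = e ^ 3 / (B + 1)"
  have l: "0 < l" "B * l \<le> e ^ 3" using e B by (auto simp: l_def field_simps)
  have low: "(low_part N g x)\<^sup>2 \<le> (e ^ q / (B + 1))\<^sup>2 / 4"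
    if N: "N \<ge> 1" "real N \<le> 2 * (M / e ^ p)" and pq: "5 * p + 2 * q \<le> 17" for N p q and x :: "real^'n"
  proof -
    have "(low_part N g x)\<^sup>2 \<le> 3072 * real N ^ 5 * hm1_sq g" by (rule low_part_le[OF d gc g(3) N(1)])
    also have "\<dots> \<le> 3072 * (2 * (M / e ^ p)) ^ 5 * (e ^ 17 / (393216 * M ^ 5 * (B + 1)\<^sup>2))"
      using N Y0 small M e by (intro mult_mono power_mono mult_nonneg_nonneg) auto
    also have "\<dots> = e ^ 17 / e ^ (5 * p) / (B + 1)\<^sup>2 / 4"
      using M by (simp add: power_mult_distrib power_divide mult.commute[of 5 p] flip: power_mult)
    also have "e ^ 17 / e ^ (5 * p) = e ^ (17 - 5 * p)" using e pq by (simp add: power_diff)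
    also have "e ^ (17 - 5 * p) \<le> e ^ (2 * q)" using e pq by (intro power_decreasing) auto
    also have "e ^ (2 * q) / (B + 1)\<^sup>2 / 4 = (e ^ q / (B + 1))\<^sup>2 / 4"
      by (simp add: power_divide mult.commute[of 2 q] flip: power_mult)
    finally show ?thesis using B by (simp add: divide_right_mono)
  qed
  have a: "\<bar>low_part N1 g x\<bar> \<le> e / 2" for x
  proof -
    have "(low_part N1 g x)\<^sup>2 \<le> (e ^ 1 / (B + 1))\<^sup>2 / 4" by (rule low[OF N1(1,3)]) simp
    also have "\<dots> \<le> (e / 2)\<^sup>2"
    proof -
      have "e / (B + 1) \<le> e / 1" using B e by (intro divide_left_mono) auto
      then have "(e / (B + 1))\<^sup>2 \<le> e\<^sup>2" using B e by (intro power_mono) auto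
      then show ?thesis by (simp add: power_divide)
    qed
    finally show ?thesis using e by (simp add: abs_le_square_iff[symmetric])
  qed
  have b: "\<bar>low_part N2 g x\<bar> \<le> l / 2" for x
  proof -
    have "(low_part N2 g x)\<^sup>2 \<le> (e ^ 3 / (B + 1))\<^sup>2 / 4" by (rule low[OF N2(1,3)]) simp
    also have "\<dots> = (l / 2)\<^sup>2" unfolding l_def power_divide by simp
    finally show ?thesis using l by (simp add: abs_le_square_iff[symmetric])
  qed
  have high: "cint (\<lambda>x. (g x - low_part N g x)\<^sup>2) \<le> (e ^ p)\<^sup>2 / M\<^sup>2 * dirichlet g"
    if N: "N \<ge> 1" "M / e ^ p \<le> real N" for N p
  proof -
    have "cint (\<lambda>x. (g x - low_part N g x)\<^sup>2) \<le> dirichlet g / (real N)\<^sup>2" by (rule high_part_le[OF g(1,2) N(1)])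
    also have "\<dots> \<le> dirichlet g / (M / e ^ p)\<^sup>2"
      using N M e X0 by (intro divide_left_mono power_mono mult_pos_pos) auto
    finally show ?thesis by (simp add: power_divide mult.commute)
  qed
  have "B * cint (\<lambda>x. \<bar>g x\<bar> ^ 3) = cint (\<lambda>x. B * \<bar>g x\<bar> ^ 3)" by simp
  also have "\<dots> \<le> cint (\<lambda>x. 1/4 * g x ^ 4 + e ^ 3 * (g x)\<^sup>2 + 4 * B * e * (g x - low_part N2 g x)\<^sup>2
      + 4 * B\<^sup>2 * (g x - low_part N1 g x)\<^sup>2)"
  proof (rule cint_mono)
    fix x
    show "B * \<bar>g x\<bar> ^ 3 \<le> 1/4 * g x ^ 4 + e ^ 3 * (g x)\<^sup>2 + 4 * B * e * (g x - low_part N2 g x)\<^sup>2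
      + 4 * B\<^sup>2 * (g x - low_part N1 g x)\<^sup>2"
      using cubic_pointwise[OF B e(1) l a[of x] b[of x], of "g x"] by simp
  qed (intro continuous_intros gc low_part_continuous)+
  also have "\<dots> = 1/4 * cint (\<lambda>x. g x ^ 4) + e ^ 3 * cint (\<lambda>x. (g x)\<^sup>2) + 4 * B * e * cint (\<lambda>x. (g x - low_part N2 g x)\<^sup>2)
      + 4 * B\<^sup>2 * cint (\<lambda>x. (g x - low_part N1 g x)\<^sup>2)"
    by (subst cint_add, (intro continuous_intros gc low_part_continuous)+)+ simp
  also have "\<dots> \<le> 1/4 * cint (\<lambda>x. g x ^ 4) + e ^ 3 * cint (\<lambda>x. (g x)\<^sup>2) + 4 * B * e * ((e ^ 2)\<^sup>2 / M\<^sup>2 * dirichlet g)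
      + 4 * B\<^sup>2 * ((e ^ 3)\<^sup>2 / M\<^sup>2 * dirichlet g)"
    using B e high[OF N1(1,2)] high[OF N2(1,2)] by (intro add_mono mult_left_mono) auto
  also have "\<dots> \<le> 1/4 * cint (\<lambda>x. g x ^ 4) + e ^ 3 * cint (\<lambda>x. (g x)\<^sup>2) + e ^ 5 / 4 * dirichlet g"
  proof -
    have "4 * B * e * ((e ^ 2)\<^sup>2 / M\<^sup>2) + 4 * B\<^sup>2 * ((e ^ 3)\<^sup>2 / M\<^sup>2) = (4 * B * e ^ 5 + 4 * B\<^sup>2 * e ^ 6) / M\<^sup>2"
      by (simp add: add_divide_distrib numeral_eq_Suc)
    also have "\<dots> \<le> (4 * B * e ^ 5 + 4 * B\<^sup>2 * e ^ 5) / M\<^sup>2"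
      using e B power_decreasing[of 5 6 e] by (intro divide_right_mono add_mono mult_left_mono) auto
    also have "\<dots> = e ^ 5 / 8 * ((32 * B + 32 * B\<^sup>2) / M\<^sup>2)" by (simp add: add_divide_distrib distrib_left)
    also have "\<dots> \<le> e ^ 5 / 8 * 1" using M e by (intro mult_left_mono) auto
    also have "\<dots> \<le> e ^ 5 / 4" using e by simp
    finally have "(4 * B * e * ((e ^ 2)\<^sup>2 / M\<^sup>2) + 4 * B\<^sup>2 * ((e ^ 3)\<^sup>2 / M\<^sup>2)) * dirichlet g \<le> e ^ 5 / 4 * dirichlet g"
      using X0 by (rule mult_right_mono)
    then show ?thesis by (simp add: algebra_simps)
  qed
  finally show ?thesis by simp
qed

section \<open>Uniqueness of the weak gradient\<close>

text \<open>Carrying the whole sequence of derivatives makes closure under differentiation a shift of the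
  sequence.\<close>

definition smooth_real :: "(real \<Rightarrow> real) \<Rightarrow> bool" where
  "smooth_real h \<longleftrightarrow> (\<exists>D. D 0 = h \<and> (\<forall>n s. (D n has_real_derivative D (Suc n) s) (at s)))"

lemma smooth_real_deriv:
  assumes "smooth_real h"
  shows "\<exists>h'. smooth_real h' \<and> (\<forall>s. (h has_real_derivative h' s) (at s))"
proof -
  obtain D where D: "D 0 = h" "\<forall>n s. (D n has_real_derivative D (Suc n) s) (at s)"
    using assms unfolding smooth_real_def by (elim exE conjE)
  then have "smooth_real (D 1)" unfolding smooth_real_def by (intro exI[of _ "\<lambda>n. D (Suc n)"]) simp
  moreover have "\<forall>s. (h has_real_derivative D 1 s) (at s)" using D by (metis One_nat_def)
  ultimately show ?thesis by (intro exI[of _ "D 1"] conjI)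
qed

text \<open>The derivatives of \<open>exp (-c / ((s - a) * (b - s)))\<close> on \<open>(a, b)\<close> all have this form, a polynomial
  divided by a power of \<open>(s - a) * (b - s)\<close> times the exponential; \<open>bump_step\<close> is the effect of one
  differentiation on the polynomial and the power.\<close>

definition bump_term :: "real \<Rightarrow> real \<Rightarrow> real \<Rightarrow> real poly \<Rightarrow> nat \<Rightarrow> real \<Rightarrow> real" where
  "bump_term a b c p m s = (if a < s \<and> s < b
     then poly p s / ((s - a) * (b - s)) ^ m * exp (- (c / ((s - a) * (b - s)))) else 0)"

definition parabola :: "real \<Rightarrow> real \<Rightarrow> real poly" where
  "parabola a b = [:- a, 1:] * [:b, - 1:]"

lemma poly_parabola: "poly (parabola a b) s = (s - a) * (b - s)"
  by (simp add: parabola_def algebra_simps)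

definition bump_step :: "real \<Rightarrow> real \<Rightarrow> real \<Rightarrow> real poly \<times> nat \<Rightarrow> real poly \<times> nat" where
  "bump_step a b c = (\<lambda>(p, m). (pderiv p * (parabola a b)\<^sup>2
     - smult (real m) (p * parabola a b * pderiv (parabola a b)) + smult c (p * pderiv (parabola a b)), m + 2))"

text \<open>The exponential beats every power of \<open>(s - a) * (b - s)\<close>. Quadratic decay at the end points gives
  derivative zero there.\<close>

lemma bump_term_quadratic:
  assumes c: "c > 0" and ab: "a < b"
  shows "\<exists>C. \<forall>s. \<bar>bump_term a b c p m s\<bar> \<le> C * (s - a)\<^sup>2 \<and> \<bar>bump_term a b c p m s\<bar> \<le> C * (s - b)\<^sup>2"
proof -
  have "bounded (poly p ` {a..b})"
    by (intro compact_imp_bounded compact_continuous_image continuous_intros) auto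
  then obtain P where P: "P > 0" "\<forall>y\<in>poly p ` {a..b}. norm y \<le> P" unfolding bounded_pos by blast
  \<comment> \<open>two powers more than the denominator has\<close>
  define k where "k = m + 2"
  define C where "C = P * (real k / c) ^ k * (b - a)\<^sup>2"
  have C0: "C \<ge> 0" using P c by (simp add: C_def)
  have le: "\<bar>bump_term a b c p m s\<bar> \<le> P * (real k / c) ^ k * ((s - a) * (b - s))\<^sup>2" if s: "a < s" "s < b" for s
  proof -
    define w where "w = (s - a) * (b - s)"
    have w: "w > 0" using s by (simp add: w_def)
    have "(c / w / real k) ^ k \<le> (1 + c / w / real k) ^ k" using c w by (intro power_mono) auto
    also have "\<dots> \<le> exp (c / w)"
    proof (rule exp_ge_one_plus_x_over_n_power_n)
      have "c / w \<ge> 0" using c w by simp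
      then show "- real k \<le> c / w" by linarith
    qed (simp add: k_def)
    finally have "(c / w / real k) ^ k \<le> exp (c / w)" .
    then have "1 / exp (c / w) \<le> 1 / (c / w / real k) ^ k"
      using c w by (intro divide_left_mono) (auto simp: k_def)
    then have e: "exp (- (c / w)) \<le> (real k / c) ^ k * w ^ k"
      by (simp add: exp_minus power_divide field_simps)
    have "\<bar>bump_term a b c p m s\<bar> = \<bar>poly p s\<bar> / w ^ m * exp (- (c / w))"
      using s w by (simp add: bump_term_def w_def abs_mult)
    also have "\<dots> \<le> P / w ^ m * ((real k / c) ^ k * w ^ k)"
      using P s w e c by (intro mult_mono divide_right_mono) auto
    also have "\<dots> = P * (real k / c) ^ k * w\<^sup>2" using w by (simp add: k_def power_add power2_eq_square)
    finally show ?thesis by (simp add: w_def)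
  qed
  have "\<bar>bump_term a b c p m s\<bar> \<le> C * (s - a)\<^sup>2 \<and> \<bar>bump_term a b c p m s\<bar> \<le> C * (s - b)\<^sup>2" for s
  proof (cases "a < s \<and> s < b")
    case True
    have "(b - s)\<^sup>2 \<le> (b - a)\<^sup>2" "(s - a)\<^sup>2 \<le> (b - a)\<^sup>2" using True by (intro power_mono; simp)+
    then have "(b - s)\<^sup>2 * (s - a)\<^sup>2 \<le> (b - a)\<^sup>2 * (s - a)\<^sup>2" "(s - a)\<^sup>2 * (b - s)\<^sup>2 \<le> (b - a)\<^sup>2 * (b - s)\<^sup>2"
      by (simp_all add: mult_right_mono)
    then have "((s - a) * (b - s))\<^sup>2 \<le> (b - a)\<^sup>2 * (s - a)\<^sup>2" "((s - a) * (b - s))\<^sup>2 \<le> (b - a)\<^sup>2 * (s - b)\<^sup>2"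
      unfolding power_mult_distrib power2_commute[of s b] by (simp_all only: mult.commute[of "(s - a)\<^sup>2"])
    then have "P * (real k / c) ^ k * ((s - a) * (b - s))\<^sup>2 \<le> P * (real k / c) ^ k * ((b - a)\<^sup>2 * (s - a)\<^sup>2)"
      "P * (real k / c) ^ k * ((s - a) * (b - s))\<^sup>2 \<le> P * (real k / c) ^ k * ((b - a)\<^sup>2 * (s - b)\<^sup>2)"
      using P c by (intro mult_left_mono; simp)+
    then show ?thesis using le True by (force simp: C_def mult.assoc)
  next
    case False
    then show ?thesis using C0 by (auto simp: bump_term_def)
  qed
  then show ?thesis by blast
qed

lemma quadratic_zero_deriv:
  fixes f :: "real \<Rightarrow> real"
  assumes "\<And>s. \<bar>f s\<bar> \<le> C * (s - x)\<^sup>2"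
  shows "(f has_real_derivative 0) (at x)"
proof -
  have f0: "f x = 0" using assms[of x] by simp
  have "((\<lambda>h. (f (x + h) - f x) / h) \<longlongrightarrow> 0) (at 0)"
  proof (rule Lim_null_comparison)
    have "norm ((f (x + h) - f x) / h) \<le> C * \<bar>h\<bar>" if "h \<noteq> 0" for h
    proof -
      have "\<bar>f (x + h)\<bar> \<le> C * h\<^sup>2" using assms[of "x + h"] by simp
      then have "\<bar>f (x + h)\<bar> / \<bar>h\<bar> \<le> C * h\<^sup>2 / \<bar>h\<bar>" by (rule divide_right_mono) simp
      also have "C * h\<^sup>2 / \<bar>h\<bar> = C * \<bar>h\<bar>" using that by (simp add: power2_eq_square abs_if)
      finally show ?thesis by (simp add: f0)
    qed
    then show "eventually (\<lambda>h. norm ((f (x + h) - f x) / h) \<le> C * \<bar>h\<bar>) (at 0)"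
      by (simp add: eventually_at_filter)
    show "((\<lambda>h. C * \<bar>h\<bar>) \<longlongrightarrow> 0) (at 0)" by (auto intro!: tendsto_eq_intros)
  qed
  then show ?thesis by (simp add: DERIV_def)
qed

lemma bump_term_deriv:
  assumes c: "c > 0" and ab: "a < b"
  shows "(bump_term a b c p m has_real_derivative
     bump_term a b c (fst (bump_step a b c (p, m))) (snd (bump_step a b c (p, m))) s) (at s)"
proof -
  consider "a < s" "s < b" | "s = a" | "s = b" | "s < a \<or> b < s" by linarith
  then show ?thesis
  proof cases
    case 1
    define W where "W = parabola a b"
    define w where "w = (s - a) * (b - s)"
    have w: "w > 0" "w = poly W s" using 1 by (auto simp: w_def W_def poly_parabola)
    have D: "((\<lambda>s. poly p s / poly W s ^ m * exp (- (c / poly W s))) has_real_derivative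
      poly (fst (bump_step a b c (p, m))) s / w ^ (m + 2) * exp (- (c / w))) (at s)"
    proof -
      define dw where "dw = poly (pderiv W) s"
      have p: "(poly p has_real_derivative poly (pderiv p) s) (at s)"
        and W: "(poly W has_real_derivative dw) (at s)" unfolding dw_def by (rule poly_DERIV)+
      have i: "((\<lambda>s. inverse (poly W s)) has_real_derivative - (dw / w\<^sup>2)) (at s)"
        using DERIV_inverse'[OF W] w by (simp add: power2_eq_square divide_simps)
      have i': "((\<lambda>s. inverse (poly W s) ^ m) has_real_derivative - (real m * dw / w ^ (m + 1))) (at s)"
      proof -
        have "((\<lambda>s. inverse (poly W s) ^ m) has_real_derivative of_nat m * (- (dw / w\<^sup>2) * inverse (poly W s) ^ (m - Suc 0))) (at s)"
          by (rule DERIV_power[OF i])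
        moreover have "of_nat m * (- (dw / w\<^sup>2) * inverse (poly W s) ^ (m - Suc 0)) = - (real m * dw / w ^ (m + 1))"
          using w by (cases m) (auto simp: field_simps power2_eq_square)
        ultimately show ?thesis by simp
      qed
      have e: "((\<lambda>s. exp (- (c * inverse (poly W s)))) has_real_derivative exp (- (c / w)) * (c * dw / w\<^sup>2)) (at s)"
        using w by (auto intro!: derivative_eq_intros i simp: divide_inverse dw_def power2_eq_square)
      have "((\<lambda>s. poly p s * inverse (poly W s) ^ m * exp (- (c * inverse (poly W s)))) has_real_derivative
         (poly (pderiv p) s * inverse w ^ m + - (real m * dw / w ^ (m + 1)) * poly p s) * exp (- (c / w))
          + exp (- (c / w)) * (c * dw / w\<^sup>2) * (poly p s * inverse w ^ m)) (at s)"
        using DERIV_mult[OF DERIV_mult[OF p i'] e] w(2) by (simp add: divide_inverse)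
      also have "(poly (pderiv p) s * inverse w ^ m + - (real m * dw / w ^ (m + 1)) * poly p s) * exp (- (c / w))
          + exp (- (c / w)) * (c * dw / w\<^sup>2) * (poly p s * inverse w ^ m)
         = (poly (pderiv p) s * w\<^sup>2 - real m * (poly p s * w * dw) + c * (poly p s * dw)) / w ^ (m + 2) * exp (- (c / w))"
      proof -
        define E where "E = exp (- (c / w))"
        have "inverse w ^ m = w\<^sup>2 / w ^ (m + 2)" "1 / w ^ (m + 1) = w / w ^ (m + 2)" "inverse w ^ m / w\<^sup>2 = 1 / w ^ (m + 2)"
          using w(1) by (simp_all add: field_simps power2_eq_square)
        then show ?thesis unfolding E_def[symmetric]
          by (simp add: field_simps)
      qed
      also have "poly (pderiv p) s * w\<^sup>2 - real m * (poly p s * w * dw) + c * (poly p s * dw)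
         = poly (fst (bump_step a b c (p, m))) s"
        by (simp add: bump_step_def w(2) W_def dw_def)
      finally show ?thesis by (simp add: divide_inverse power_inverse)
    qed
    have ev: "eventually (\<lambda>r. poly p r / poly W r ^ m * exp (- (c / poly W r)) = bump_term a b c p m r) (nhds s)"
    proof -
      have "eventually (\<lambda>r. r \<in> {a<..<b}) (nhds s)" using 1 by (intro eventually_nhds_in_open) auto
      then show ?thesis by eventually_elim (simp add: bump_term_def W_def poly_parabola)
    qed
    have "(bump_term a b c p m has_real_derivative
      poly (fst (bump_step a b c (p, m))) s / w ^ (m + 2) * exp (- (c / w))) (at s)"
      by (rule iffD1[OF DERIV_cong_ev[OF refl ev refl] D])
    moreover have "snd (bump_step a b c (p, m)) = m + 2" by (simp add: bump_step_def)
    ultimately show ?thesis using 1 by (simp only: bump_term_def w_def if_True simp_thms)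
  next
    case 2
    then show ?thesis using bump_term_quadratic[OF assms, of p m] quadratic_zero_deriv[of "bump_term a b c p m" _ a]
      by (auto simp: bump_term_def[of a b c "fst _"])
  next
    case 3
    then show ?thesis using bump_term_quadratic[OF assms, of p m] quadratic_zero_deriv[of "bump_term a b c p m" _ b]
      by (auto simp: bump_term_def[of a b c "fst _"])
  next
    case 4
    then have "eventually (\<lambda>r. r \<in> {..<a} \<union> {b<..}) (nhds s)" by (intro eventually_nhds_in_open) auto
    then have "eventually (\<lambda>r. bump_term a b c p m r = 0) (nhds s)" by eventually_elim (auto simp: bump_term_def)
    then have "(bump_term a b c p m has_real_derivative 0) (at s)"
      by (subst DERIV_cong_ev[OF refl _ refl]) auto
    then show ?thesis using 4 by (auto simp: bump_term_def[of a b c "fst _"])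
  qed
qed

definition bump :: "real \<Rightarrow> real \<Rightarrow> real \<Rightarrow> real \<Rightarrow> real" where
  "bump a b c = bump_term a b c 1 0"

lemma smooth_real_bump:
  assumes "c > 0" "a < b"
  shows "smooth_real (bump a b c)"
  unfolding smooth_real_def
proof (rule exI[where x = "\<lambda>n. bump_term a b c (fst ((bump_step a b c ^^ n) (1, 0))) (snd ((bump_step a b c ^^ n) (1, 0)))"],
    intro conjI allI)
  let ?q = "\<lambda>n. (bump_step a b c ^^ n) (1, 0)"
  show "(\<lambda>n. bump_term a b c (fst (?q n)) (snd (?q n))) 0 = bump a b c" by (simp add: bump_def)
  fix n s
  show "(bump_term a b c (fst (?q n)) (snd (?q n)) has_real_derivative
      bump_term a b c (fst (?q (Suc n))) (snd (?q (Suc n))) s) (at s)"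
    using bump_term_deriv[OF assms, of "fst (?q n)" "snd (?q n)" s] by simp
qed

lemma bump_pos_iff: "bump a b c s \<noteq> 0 \<longleftrightarrow> a < s \<and> s < b"
  by (simp add: bump_def bump_term_def)

lemma bump_range: "c \<ge> 0 \<Longrightarrow> 0 \<le> bump a b c s \<and> bump a b c s \<le> 1"
  by (auto simp: bump_def bump_term_def)

lemma dparts_coordprod:
  fixes h :: "'n::finite \<Rightarrow> real \<Rightarrow> real"
  assumes "\<And>i. smooth_real (h i)" "set bs \<subseteq> (Basis :: (real^'n) set)"
  shows "\<exists>k. (\<forall>i. smooth_real (k i)) \<and> dparts UNIV bs (coordprod h) = coordprod k"
  using assms(2)
proof (induction bs)
  case Nil
  show ?case using assms(1) by (intro exI[of _ h]) simp
next
  case (Cons v bs)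
  then obtain k where k: "\<forall>i. smooth_real (k i)" "dparts UNIV bs (coordprod h) = coordprod k" by auto
  obtain i where v: "v = axis i 1" using Cons.prems by (auto simp: Basis_vec_def)
  have "\<forall>i. \<exists>k'. smooth_real k' \<and> (\<forall>s. (k i has_real_derivative k' s) (at s))"
    using k(1) smooth_real_deriv by blast
  then obtain k' where k': "\<forall>i. smooth_real (k' i) \<and> (\<forall>s. (k i has_real_derivative k' i s) (at s))" by metis
  have "dpart UNIV v (coordprod k) x = coordprod (k(i := k' i)) x" for x
  proof -
    have "(coordprod k has_derivative (\<lambda>v. \<Sum>i\<in>UNIV. v $ i * coordprod (k(i := k' i)) x)) (at x)"
      by (rule coordprod_has_derivative) (use k' in blast)
    then have "frechet_derivative (coordprod k) (at x) = (\<lambda>v. \<Sum>i\<in>UNIV. v $ i * coordprod (k(i := k' i)) x)"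
      by (rule frechet_derivative_at[symmetric])
    then show ?thesis by (simp add: dpart_def v coordprod_axis)
  qed
  then have "dparts UNIV (v # bs) (coordprod h) = coordprod (k(i := k' i))" using k(2) by auto
  moreover have "\<forall>j. smooth_real ((k(i := k' i)) j)" using k(1) k' by simp
  ultimately show ?case by blast
qed

lemma test_function_bump:
  fixes a b :: "real^'n"
  assumes "\<And>i. 0 < a $ i" "\<And>i. a $ i < b $ i" "\<And>i. b $ i < 1" "c > 0"
  shows "test_function (coordprod (\<lambda>i. bump (a $ i) (b $ i) c))"
proof -
  let ?h = "\<lambda>i. bump (a $ i) (b $ i) c"
  have sm: "smooth_real (?h i)" for i using assms smooth_real_bump by blast
  have "smooth_up_to UNIV (coordprod ?h)"
    unfolding smooth_up_to_def
  proof (intro allI impI)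
    fix bs :: "(real^'n) list" assume bs: "set bs \<subseteq> Basis"
    obtain k where k: "\<forall>i. smooth_real (k i)" "dparts UNIV bs (coordprod ?h) = coordprod k"
      using dparts_coordprod[of ?h bs] sm bs by blast
    have "\<forall>i. \<exists>k'. \<forall>s. (k i has_real_derivative k' s) (at s)"
      using k(1) smooth_real_deriv by blast
    then obtain k' where "\<forall>i s. (k i has_real_derivative k' i s) (at s)" by metis
    then show "dparts UNIV bs (coordprod ?h) differentiable_on UNIV"
      unfolding k(2) by (intro coordprod_differentiable) blast
  qed
  moreover have supp: "closure {x. coordprod ?h x \<noteq> 0} \<subseteq> cbox a b"
  proof (rule closure_minimal)
    show "{x. coordprod ?h x \<noteq> 0} \<subseteq> cbox a b"
      by (auto simp: coordprod_def bump_pos_iff mem_box_cart less_imp_le)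
  qed (rule closed_cbox)
  moreover have "cbox a b \<subseteq> cube"
  proof
    fix x assume "x \<in> cbox a b"
    then have "a $ i \<le> x $ i \<and> x $ i \<le> b $ i" for i by (simp add: mem_box_cart)
    then have "0 < x $ i \<and> x $ i < 1" for i using assms(1,3)[of i] by (meson less_le_trans le_less_trans)
    then show "x \<in> cube" by (simp add: mem_cube)
  qed
  moreover have "compact (closure {x. coordprod ?h x \<noteq> 0})"
    unfolding compact_eq_bounded_closed by (intro conjI bounded_subset[OF bounded_cbox supp] closed_closure)
  ultimately show ?thesis unfolding test_function_def by blast
qed

text \<open>Boxes are an intersection-stable generator of the Borel sets, so all Borel sets have integral zero.\<close>

lemma integral_zero_on_boxes:
  fixes f :: "'a::euclidean_space \<Rightarrow> real"
  assumes f: "integrable lborel f" "integral\<^sup>L lborel f = 0"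
    and box: "\<And>a b. (LINT x:box a b|lborel. f x) = 0"
  shows "AE x in lborel. f x = 0"
proof (rule sigma_finite_measure.density_zero[OF sigma_finite_lborel f(1)])
  fix A :: "'a set" assume "A \<in> sets lborel"
  then have "A \<in> sets borel" by simp
  then have A: "A \<in> sigma_sets UNIV (range (\<lambda>(a, b). box a b))" unfolding borel_eq_box by simp
  have Int: "Int_stable (range (\<lambda>(a, b). box a b :: 'a set))" by (auto simp: Int_stable_def box_Int_box)
  have Pow: "range (\<lambda>(a, b). box a b :: 'a set) \<subseteq> Pow UNIV" by simp
  have si: "set_integrable lborel B f" if "B \<in> sets borel" for B
    unfolding set_integrable_def using f(1) that by (intro integrable_mult_indicator) auto
  show "(LINT x:A|lborel. f x) = 0"
    using Int Pow A
  proof (induction rule: sigma_sets_induct_disjoint)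
    case (basic A) then show ?case using box by auto
  next
    case empty show ?case by (simp add: set_lebesgue_integral_def)
  next
    case (compl A)
    then have A[measurable]: "A \<in> sets borel" by (simp add: borel_eq_box)
    have "(LINT x:A \<union> (UNIV - A)|lborel. f x) = (LINT x:A|lborel. f x) + (LINT x:UNIV - A|lborel. f x)"
      by (rule set_integral_Un) (auto intro!: si)
    moreover have "(LINT x:A \<union> (UNIV - A)|lborel. f x) = 0" using f(2) by (simp add: set_lebesgue_integral_def)
    ultimately show ?case using compl by simp
  next
    case (union F)
    then have F: "\<And>i. F i \<in> sets borel" by (simp add: borel_eq_box subset_eq)
    have "(LINT x:(\<Union>i. F i)|lborel. f x) = (\<Sum>i. LINT x:F i|lborel. f x)"
      by (rule lebesgue_integral_countable_add)
         (use F union.hyps in \<open>auto simp: disjoint_family_on_def intro!: si\<close>)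
    also have "\<dots> = 0" using union by simp
    finally show ?case .
  qed
qed

text \<open>Shrinking the interval while letting the exponent tend to zero gives the indicator of the open
  interval as a limit of bumps supported inside it, even if the interval touches the boundary of
  \<open>[0,1]\<close>.\<close>

lemma bump_tendsto:
  fixes a b s :: real
  assumes "a < b"
  defines "\<delta> \<equiv> \<lambda>n. (b - a) / real (n + 3)"
  shows "(\<lambda>n. bump (a + \<delta> n) (b - \<delta> n) (1 / real (Suc n)) s) \<longlonglongrightarrow> (if a < s \<and> s < b then 1 else 0)"
proof -
  have d0: "\<delta> \<longlonglongrightarrow> 0"
    using LIMSEQ_ignore_initial_segment[OF lim_const_over_n[of "b - a"], of 3] by (simp add: \<delta>_def)
  have dpos: "\<delta> n > 0" for n using assms(1) by (simp add: \<delta>_def)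
  show ?thesis
  proof (cases "a < s \<and> s < b")
    case False
    then have "bump (a + \<delta> n) (b - \<delta> n) (1 / real (Suc n)) s = 0" for n
      using dpos[of n] bump_pos_iff[of "a + \<delta> n" "b - \<delta> n" "1 / real (Suc n)" s] by auto
    then show ?thesis unfolding if_not_P[OF False] by simp
  next
    case True
    define w where "w = (\<lambda>n. (s - (a + \<delta> n)) * ((b - \<delta> n) - s))"
    have wl: "w \<longlonglongrightarrow> (s - (a + 0)) * ((b - 0) - s)" unfolding w_def by (intro tendsto_intros d0)
    have c0: "(\<lambda>n. 1 / real (Suc n)) \<longlonglongrightarrow> 0" using LIMSEQ_inverse_real_of_nat by (simp add: inverse_eq_divide)
    have "(\<lambda>n. exp (- ((1 / real (Suc n)) / w n))) \<longlonglongrightarrow> exp (- (0 / ((s - (a + 0)) * ((b - 0) - s))))"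
      by (rule tendsto_exp, rule tendsto_minus, rule tendsto_divide[OF c0 wl]) (use True in auto)
    then have "(\<lambda>n. exp (- ((1 / real (Suc n)) / w n))) \<longlonglongrightarrow> 1" by simp
    moreover have "eventually (\<lambda>n. exp (- ((1 / real (Suc n)) / w n)) = bump (a + \<delta> n) (b - \<delta> n) (1 / real (Suc n)) s) sequentially"
    proof -
      have "min (s - a) (b - s) > 0" using True by simp
      from order_tendstoD(2)[OF d0 this] show ?thesis
        by eventually_elim (auto simp: bump_def bump_term_def w_def)
    qed
    ultimately show ?thesis using True by (auto dest: Lim_transform_eventually)
  qed
qed

text \<open>Fundamental lemma of the calculus of variations, first tested with the indicator of a box, which
  is a bounded pointwise limit of test functions.\<close>

lemma weak_zero_box:
  fixes G :: "real^'n \<Rightarrow> real" and a b :: "real^'n"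
  assumes G: "integrable (lebesgue_on cube) G"
    and test: "\<And>\<phi>. test_function \<phi> \<Longrightarrow> cint (\<lambda>x. G x * \<phi> x) = 0"
    and ab: "\<And>i. 0 \<le> a $ i" "\<And>i. a $ i < b $ i" "\<And>i. b $ i \<le> 1"
  shows "cint (\<lambda>x. G x * indicator (box a b) x) = 0"
proof -
  define \<delta> where "\<delta> = (\<lambda>i n. (b $ i - a $ i) / real (n + 3))"
  define a' where "a' = (\<lambda>n. \<chi> i. a $ i + \<delta> i n)"
  define b' where "b' = (\<lambda>n. \<chi> i. b $ i - \<delta> i n)"
  define \<phi> where "\<phi> = (\<lambda>n. coordprod (\<lambda>i. bump (a' n $ i) (b' n $ i) (1 / real (Suc n))))"
  have d: "0 < \<delta> i n" "2 * \<delta> i n < b $ i - a $ i" for i n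
  proof -
    show "0 < \<delta> i n" using ab(2)[of i] by (simp add: \<delta>_def)
    have half: "2 * (D / real (n + 3)) < D" if "D > 0" for D :: real using that by (simp add: field_simps add_pos_nonneg)
    show "2 * \<delta> i n < b $ i - a $ i" unfolding \<delta>_def by (rule half) (simp add: ab(2))
  qed
  have phi: "test_function (\<phi> n)" for n
    unfolding \<phi>_def
  proof (rule test_function_bump)
    fix i
    show "0 < a' n $ i" "a' n $ i < b' n $ i" "b' n $ i < 1"
      using d[of i n] ab(1,3)[of i] by (auto simp: a'_def b'_def)
  qed simp
  have rng: "0 \<le> \<phi> n x \<and> \<phi> n x \<le> 1" for n x
    unfolding \<phi>_def coordprod_def using bump_range by (intro conjI prod_nonneg prod_le_1) auto
  have phic: "continuous_on S (\<phi> n)" for S n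
    unfolding \<phi>_def
  proof (rule coordprod_continuous)
    fix i
    have "smooth_real (bump (a' n $ i) (b' n $ i) (1 / real (Suc n)))"
      using d[of i n] by (intro smooth_real_bump) (auto simp: a'_def b'_def)
    then obtain h' where "\<forall>s. (bump (a' n $ i) (b' n $ i) (1 / real (Suc n)) has_real_derivative h' s) (at s)"
      using smooth_real_deriv by blast
    then show "continuous_on UNIV (bump (a' n $ i) (b' n $ i) (1 / real (Suc n)))"
      by (intro DERIV_continuous_UNIV) blast
  qed
  have lim: "(\<lambda>n. \<phi> n x) \<longlonglongrightarrow> indicator (box a b) x" for x
  proof -
    have "(\<lambda>n. \<phi> n x) \<longlonglongrightarrow> (\<Prod>i\<in>UNIV. if a $ i < x $ i \<and> x $ i < b $ i then 1 else 0)"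
      unfolding \<phi>_def coordprod_def a'_def b'_def \<delta>_def vec_lambda_beta
      by (intro tendsto_prod bump_tendsto ab)
    also have "(\<Prod>i\<in>UNIV. if a $ i < x $ i \<and> x $ i < b $ i then 1 else 0) = (indicator (box a b) x :: real)"
      by (auto simp: indicator_def mem_box_cart)
    finally show ?thesis .
  qed
  have "(\<lambda>n. cint (\<lambda>x. G x * \<phi> n x)) \<longlonglongrightarrow> cint (\<lambda>x. G x * indicator (box a b) x)"
  proof (rule integral_dominated_convergence[where w = "\<lambda>x. norm (G x)"])
    show "integrable (lebesgue_on cube) (\<lambda>x. norm (G x))" using G by (rule integrable_norm)
    have [measurable]: "G \<in> borel_measurable (lebesgue_on cube)" using G by auto
    have "\<phi> n \<in> borel_measurable (lebesgue_on cube)" for n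
      using integrable_cube[OF phic] by auto
    then show "\<And>n. (\<lambda>x. G x * \<phi> n x) \<in> borel_measurable (lebesgue_on cube)" by simp
    have "indicat_real (box a b) \<in> borel_measurable (lebesgue_on (cube :: (real^'n) set))"
      by (intro measurable_restrict_space1 borel_measurable_indicator) simp
    then show "(\<lambda>x. G x * indicator (box a b) x) \<in> borel_measurable (lebesgue_on cube)" by simp
    show "AE x in lebesgue_on cube. (\<lambda>n. G x * \<phi> n x) \<longlonglongrightarrow> G x * indicator (box a b) x"
      by (intro AE_I2 tendsto_intros lim)
    show "AE x in lebesgue_on cube. norm (G x * \<phi> n x) \<le> norm (G x)" for n
      using rng by (intro AE_I2) (auto simp: abs_mult intro!: mult_left_le)
  qed
  moreover have "cint (\<lambda>x. G x * \<phi> n x) = 0" for n by (rule test[OF phi])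
  ultimately show ?thesis by (simp add: LIMSEQ_const_iff)
qed

lemma weak_zero:
  fixes G :: "real^'n \<Rightarrow> real"
  assumes G: "integrable (lebesgue_on cube) G"
    and test: "\<And>\<phi>. test_function \<phi> \<Longrightarrow> cint (\<lambda>x. G x * \<phi> x) = 0"
  shows "AE x in lebesgue_on cube. G x = 0"
proof -
  define F where "F = (\<lambda>x. indicator cube x *\<^sub>R G x)"
  have Fi: "integrable lebesgue F" using G by (simp add: F_def integrable_restrict_space)
  then have "F \<in> borel_measurable (completion lborel)" by auto
  then obtain f where f: "f \<in> borel_measurable lborel" "AE x in lborel. F x = f x"
    using completion_ex_borel_measurable_real by blast
  have fL: "AE x in lebesgue. F x = f x" using f(2) by (rule AE_completion)
  have fm: "f \<in> borel_measurable lebesgue" using f(1) by (rule measurable_completion)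
  have fi: "integrable lborel f"
    using integrable_cong_AE[OF _ fm fL] Fi integrable_completion[OF f(1)] by auto
  have box0: "(LINT x:box a b|lborel. f x) = 0" for a b
  proof -
    let ?a = "\<chi> i. max 0 (a $ i)" and ?b = "\<chi> i. min 1 (b $ i)"
    have [measurable]: "f \<in> borel_measurable borel" using f(1) by simp
    have "(LINT x:box a b|lborel. f x) = (\<integral>x. indicator (box a b) x *\<^sub>R f x \<partial>lebesgue)"
      unfolding set_lebesgue_integral_def by (rule integral_completion[symmetric]) measurable
    also have "\<dots> = (\<integral>x. indicator (box a b) x *\<^sub>R F x \<partial>lebesgue)"
    proof (rule integral_cong_AE)
      show "AE x in lebesgue. indicator (box a b) x *\<^sub>R f x = indicator (box a b) x *\<^sub>R F x"
        using fL by eventually_elim simp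
      show "(\<lambda>x. indicator (box a b) x *\<^sub>R f x) \<in> borel_measurable lebesgue"
        by (rule measurable_completion) measurable
      show "(\<lambda>x. indicator (box a b) x *\<^sub>R F x) \<in> borel_measurable lebesgue"
        using Fi by (intro borel_measurable_scaleR borel_measurable_indicator) auto
    qed
    also have "\<dots> = (\<integral>x. indicator cube x *\<^sub>R (G x * indicator (box ?a ?b) x) \<partial>lebesgue)"
      by (rule Bochner_Integration.integral_cong) (auto simp: F_def indicator_def mem_box_cart)
    also have "\<dots> = cint (\<lambda>x. G x * indicator (box ?a ?b) x)"
      by (rule integral_restrict_space[symmetric]) simp
    also have "\<dots> = 0"
    proof (cases "\<forall>i. ?a $ i < ?b $ i")
      case True
      then show ?thesis by (intro weak_zero_box[OF G test]) auto
    next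
      case False
      then obtain i where "?b $ i \<le> ?a $ i" unfolding not_all not_less by blast
      then have "x \<notin> box ?a ?b" for x unfolding mem_box_cart by (meson less_trans not_le)
      then have "box ?a ?b = {}" by blast
      then show ?thesis by simp
    qed
    finally show ?thesis .
  qed
  have "AE x in lborel. f x = 0"
  proof (rule integral_zero_on_boxes[OF fi _ box0])
    have "integral\<^sup>L lborel f = (LINT x:box 0 1|lborel. f x)"
      unfolding set_lebesgue_integral_def
    proof (rule integral_cong_AE)
      show "AE x in lborel. f x = indicator (box 0 1) x *\<^sub>R f x"
        using f(2) by eventually_elim (auto simp: F_def indicator_def)
    qed (use f(1) in auto)
    then show "integral\<^sup>L lborel f = 0" by (simp add: box0)
  qed
  then have "AE x in lebesgue. f x = 0" by (rule AE_completion)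
  then have "AE x in lebesgue. F x = 0" using fL by eventually_elim simp
  then have "AE x in lebesgue. x \<in> cube \<longrightarrow> G x = 0" by eventually_elim (auto simp: F_def)
  then show ?thesis by (subst AE_restrict_space_iff) auto
qed

lemma test_function_C1:
  fixes \<phi> :: "real^'n \<Rightarrow> real"
  assumes "test_function \<phi>"
  shows "C1 \<phi>" "\<And>x i. x \<in> ccube \<Longrightarrow> x $ i = 0 \<or> x $ i = 1 \<Longrightarrow> \<phi> x = 0"
    "\<And>x i. x \<in> ccube \<Longrightarrow> pd i \<phi> x = dpart UNIV (axis i 1) \<phi> x"
proof -
  have sm: "set bs \<subseteq> Basis \<Longrightarrow> dparts UNIV bs \<phi> differentiable_on UNIV" for bs
    using assms by (simp add: test_function_def smooth_up_to_def)
  have d0: "\<phi> differentiable_on UNIV" using sm[of "[]"] by simp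
  have d1: "dpart UNIV (axis i 1) \<phi> differentiable_on UNIV" for i
    using sm[of "[axis i 1]"] by (simp add: axis_in_Basis_iff)
  show pd: "pd i \<phi> x = dpart UNIV (axis i 1) \<phi> x" if "x \<in> ccube" for x i
  proof -
    have "(\<phi> has_derivative frechet_derivative \<phi> (at x)) (at x)"
      using d0 by (simp add: differentiable_on_def frechet_derivative_works)
    then show ?thesis
      using pd_eq[OF has_derivative_at_withinI that] by (simp add: dpart_def)
  qed
  have "continuous_on ccube (pd i \<phi>)" for i
    by (rule continuous_on_eq[of _ "dpart UNIV (axis i 1) \<phi>"])
       (rule continuous_on_subset[OF differentiable_imp_continuous_on[OF d1]], simp, simp add: pd)
  then show "C1 \<phi>" using differentiable_on_subset[OF d0] by (simp add: C1_def)
  show "\<phi> x = 0" if "x \<in> ccube" "x $ i = 0 \<or> x $ i = 1" for x i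
  proof (rule ccontr)
    assume "\<phi> x \<noteq> 0"
    then have "x \<in> closure {x. \<phi> x \<noteq> 0}" using closure_subset[of "{x. \<phi> x \<noteq> 0}"] by blast
    then have "x \<in> cube" using assms unfolding test_function_def by blast
    then have "0 < x $ i \<and> x $ i < 1" by (simp add: mem_cube)
    then show False using that(2) by linarith
  qed
qed

lemma has_weak_gradient_grad:
  fixes g :: "real^'n \<Rightarrow> real"
  assumes "C1 g"
  shows "has_weak_gradient g (grad g)"
  unfolding has_weak_gradient_def
proof (intro conjI allI impI)
  show "L2 g" by (rule L2_continuous[OF C1_continuous[OF assms]])
  show "L2 (\<lambda>x. grad g x $ i)" for i
    by (rule L2_continuous) (use assms in \<open>simp add: grad_def C1_def\<close>)
  fix \<phi> :: "real^'n \<Rightarrow> real" and i assume phi: "test_function \<phi>"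
  have "cint (\<lambda>x. pd i \<phi> x * g x) = - cint (\<lambda>x. \<phi> x * pd i g x)"
    by (rule integration_by_parts[OF test_function_C1(1)[OF phi] assms]) (use test_function_C1(2)[OF phi] in auto)
  moreover have "cint (\<lambda>x. g x * dpart UNIV (axis i 1) \<phi> x) = cint (\<lambda>x. pd i \<phi> x * g x)"
    by (intro cint_cong) (use test_function_C1(3)[OF phi] cube_subset_ccube in auto)
  ultimately show "cint (\<lambda>x. g x * dpart UNIV (axis i 1) \<phi> x) = - cint (\<lambda>x. grad g x $ i * \<phi> x)"
    by (simp add: grad_def mult.commute)
qed

text \<open>The weak gradient is selected by a choice operator; only uniqueness up to null sets makes the
  spectral estimate and the \<open>H\<^sup>1\<close> norm statements about the classical gradient.\<close>

lemma weak_grad_classical: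
  fixes g :: "real^'n \<Rightarrow> real"
  assumes "C1 g"
  shows "H1 g" "AE x in lebesgue_on cube. weak_grad g x = grad g x"
proof -
  show "H1 g" unfolding H1_def using has_weak_gradient_grad[OF assms] by (rule exI[of "has_weak_gradient g" "grad g"])
  have w: "has_weak_gradient g (weak_grad g)"
    unfolding weak_grad_def using has_weak_gradient_grad[OF assms] by (rule someI[of "has_weak_gradient g" "grad g"])
  have c: "has_weak_gradient g (grad g)" by (rule has_weak_gradient_grad[OF assms])
  have "AE x in lebesgue_on cube. weak_grad g x $ i - grad g x $ i = 0" for i
  proof (rule weak_zero)
    let ?w = "\<lambda>x. weak_grad g x $ i" and ?c = "\<lambda>x. grad g x $ i"
    have L: "L2 ?w" "L2 ?c" using w c by (auto simp: has_weak_gradient_def)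
    have "L2 (\<lambda>x::real^'n. 1)" by (rule L2_continuous) simp
    from L2_mult[OF L2_diff[OF L] this] show "integrable (lebesgue_on cube) (\<lambda>x. ?w x - ?c x)" by simp
    fix \<phi> :: "real^'n \<Rightarrow> real" assume phi: "test_function \<phi>"
    have P: "L2 \<phi>" by (rule L2_continuous[OF C1_continuous[OF test_function_C1(1)[OF phi]]])
    have "cint (\<lambda>x. ?w x * \<phi> x) = cint (\<lambda>x. ?c x * \<phi> x)"
    proof -
      have "cint (\<lambda>x. g x * dpart UNIV (axis i 1) \<phi> x) = - cint (\<lambda>x. ?w x * \<phi> x)"
        using w phi by (simp add: has_weak_gradient_def)
      moreover have "cint (\<lambda>x. g x * dpart UNIV (axis i 1) \<phi> x) = - cint (\<lambda>x. ?c x * \<phi> x)"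
        using c phi by (simp add: has_weak_gradient_def)
      ultimately show ?thesis by simp
    qed
    then show "cint (\<lambda>x. (?w x - ?c x) * \<phi> x) = 0"
      using L2_mult[OF L(1) P] L2_mult[OF L(2) P] by (simp add: left_diff_distrib)
  qed
  then have "AE x in lebesgue_on cube. \<forall>i. weak_grad g x $ i - grad g x $ i = 0"
    by (simp add: AE_all_countable)
  then show "AE x in lebesgue_on cube. weak_grad g x = grad g x"
    by eventually_elim (simp add: vec_eq_iff)
qed

lemma weak_grad_norm_measurable:
  fixes g :: "real^'n \<Rightarrow> real"
  assumes "C1 g"
  shows "(\<lambda>x. (norm (weak_grad g x))\<^sup>2) \<in> borel_measurable (lebesgue_on cube)"
proof -
  have "has_weak_gradient g (weak_grad g)"
    unfolding weak_grad_def using has_weak_gradient_grad[OF assms] by (rule someI[of "has_weak_gradient g" "grad g"])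
  then have "(\<lambda>x. weak_grad g x $ i) \<in> borel_measurable (lebesgue_on cube)" for i
    by (simp add: has_weak_gradient_def L2_def)
  moreover have "(norm v)\<^sup>2 = (\<Sum>i\<in>UNIV. (v $ i)\<^sup>2)" for v :: "real^'n"
    by (simp add: norm_vec_def L2_set_def sum_nonneg)
  ultimately show ?thesis by simp
qed

lemma dirichlet_weak:
  fixes g h :: "real^'n \<Rightarrow> real"
  assumes g: "C1 g" and h: "continuous_on ccube h"
  shows "cint (\<lambda>x. c * (norm (weak_grad g x))\<^sup>2 + h x) = cint (\<lambda>x. c * (norm (grad g x))\<^sup>2 + h x)"
proof (rule integral_cong_AE)
  have [measurable]: "h \<in> borel_measurable (lebesgue_on cube)" using integrable_cube[OF h] by auto
  have [measurable]: "(\<lambda>x. (norm (weak_grad g x))\<^sup>2) \<in> borel_measurable (lebesgue_on cube)"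
    by (rule weak_grad_norm_measurable[OF g])
  have "continuous_on ccube (\<lambda>x. (norm (grad g x))\<^sup>2)"
    using g unfolding grad_def C1_def by (intro continuous_intros continuous_on_vec_lambda) auto
  then have [measurable]: "(\<lambda>x. (norm (grad g x))\<^sup>2) \<in> borel_measurable (lebesgue_on cube)"
    using integrable_cube by blast
  show "(\<lambda>x. c * (norm (weak_grad g x))\<^sup>2 + h x) \<in> borel_measurable (lebesgue_on cube)" by measurable
  show "(\<lambda>x. c * (norm (grad g x))\<^sup>2 + h x) \<in> borel_measurable (lebesgue_on cube)" by measurable
  show "AE x in lebesgue_on cube. c * (norm (weak_grad g x))\<^sup>2 + h x = c * (norm (grad g x))\<^sup>2 + h x"
    using weak_grad_classical(2)[OF g] by eventually_elim simp
qed

lemma H1_norm_sq: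
  fixes g :: "real^'n \<Rightarrow> real"
  assumes "C1 g"
  shows "(H1_norm g)\<^sup>2 = cint (\<lambda>x. (g x)\<^sup>2) + dirichlet g"
proof -
  have "cint (\<lambda>x. (norm (weak_grad g x))\<^sup>2) = dirichlet g"
    using dirichlet_weak[OF assms, of "\<lambda>x. 0" 1] by simp
  then show ?thesis
    unfolding H1_norm_def Lp_norm_2_sq using cint_nonneg[of "\<lambda>x. (g x)\<^sup>2"] cint_nonneg[of "\<lambda>x. (norm (grad g x))\<^sup>2"]
    by (subst real_sqrt_pow2) auto
qed

lemma Lp_norm_4_pow: "(Lp_norm 4 g) ^ 4 = cint (\<lambda>x. (g x) ^ 4)"
proof -
  have "\<bar>a\<bar> ^ 4 = a ^ 4" for a :: real by (rule power_even_abs) simp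
  then show ?thesis using cint_nonneg[of "\<lambda>x. (g x) ^ 4"] by (simp add: Lp_norm_def)
qed

section \<open>Regularity of solutions up to the boundary\<close>

lemma slice_continuous:
  assumes "continuous_on (S \<times> X) (\<lambda>(t, x). F t x)"
  shows "t \<in> S \<Longrightarrow> continuous_on X (F t)" and "x \<in> X \<Longrightarrow> continuous_on S (\<lambda>t. F t x)"
proof -
  show "continuous_on X (F t)" if "t \<in> S"
  proof -
    have "continuous_on X (\<lambda>x. (t, x))" by (intro continuous_intros)
    moreover have "(\<lambda>x. (t, x)) ` X \<subseteq> S \<times> X" using that by auto
    ultimately show ?thesis using continuous_on_compose2[OF assms] by fastforce
  qed
  show "continuous_on S (\<lambda>t. F t x)" if "x \<in> X"
  proof -
    have "continuous_on S (\<lambda>t. (t, x))" by (intro continuous_intros)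
    moreover have "(\<lambda>t. (t, x)) ` S \<subseteq> S \<times> X" using that by auto
    ultimately show ?thesis using continuous_on_compose2[OF assms] by fastforce
  qed
qed

lemma spatially_Ck_dparts:
  assumes "spatially_Ck k T u" "set bs \<subseteq> Basis"
  shows "length bs \<le> k \<Longrightarrow> continuous_on ({0..T} \<times> ccube) (\<lambda>(t, x). dparts ccube bs (u t) x)"
    and "length bs \<le> k \<Longrightarrow> t \<in> {0..T} \<Longrightarrow> continuous_on ccube (dparts ccube bs (u t))"
    and "length bs < k \<Longrightarrow> t \<in> {0..T} \<Longrightarrow> dparts ccube bs (u t) differentiable_on ccube"
proof -
  show c: "continuous_on ({0..T} \<times> ccube) (\<lambda>(t, x). dparts ccube bs (u t) x)" if "length bs \<le> k"
    using assms that by (simp add: spatially_Ck_def)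
  show "dparts ccube bs (u t) differentiable_on ccube" if "length bs < k" "t \<in> {0..T}"
    using assms that by (simp add: spatially_Ck_def)
  show "continuous_on ccube (dparts ccube bs (u t))" if "length bs \<le> k" "t \<in> {0..T}"
    by (rule slice_continuous(1)[OF c[OF that(1)] that(2)])
qed

lemma axis_Basis: "(axis i 1 :: real^'n) \<in> Basis"
  by (simp add: axis_in_Basis_iff)

lemma spatially_Ck_cont:
  assumes "spatially_Ck k T u"
  shows "continuous_on ({0..T} \<times> ccube) (\<lambda>(t, x). u t x)"
    and "1 \<le> k \<Longrightarrow> continuous_on ({0..T} \<times> ccube) (\<lambda>(t, x). pd i (u t) x)"
    and "2 \<le> k \<Longrightarrow> continuous_on ({0..T} \<times> ccube) (\<lambda>(t, x). laplacian (u t) x)"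
    and "3 \<le> k \<Longrightarrow> continuous_on ({0..T} \<times> ccube) (\<lambda>(t, x). pd i (laplacian (u t)) x)"
proof -
  show "continuous_on ({0..T} \<times> ccube) (\<lambda>(t, x). u t x)"
    using spatially_Ck_dparts(1)[OF assms, of "[]"] by simp
  show "continuous_on ({0..T} \<times> ccube) (\<lambda>(t, x). pd i (u t) x)" if "1 \<le> k"
    using spatially_Ck_dparts(1)[OF assms, of "[axis i 1]"] that by (simp add: axis_Basis)
  have 2: "continuous_on ({0..T} \<times> ccube) (\<lambda>(t, x). pd j (pd j (u t)) x)" if "2 \<le> k" for j
    using spatially_Ck_dparts(1)[OF assms, of "[axis j 1, axis j 1]"] that by (simp add: axis_Basis)
  show "continuous_on ({0..T} \<times> ccube) (\<lambda>(t, x). laplacian (u t) x)" if "2 \<le> k"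
    unfolding laplacian_def case_prod_beta
    by (intro continuous_intros) (use 2[OF that] in \<open>simp add: case_prod_beta\<close>)
  show "continuous_on ({0..T} \<times> ccube) (\<lambda>(t, x). pd i (laplacian (u t)) x)" if "3 \<le> k"
  proof -
    have 3: "continuous_on ({0..T} \<times> ccube) (\<lambda>(t, x). pd i (pd j (pd j (u t))) x)" for j
      using spatially_Ck_dparts(1)[OF assms, of "[axis i 1, axis j 1, axis j 1]"] that by (simp add: axis_Basis)
    have "continuous_on ({0..T} \<times> ccube) (\<lambda>(t, x). \<Sum>j\<in>UNIV. pd i (pd j (pd j (u t))) x)"
      unfolding case_prod_beta by (intro continuous_intros) (use 3 in \<open>simp add: case_prod_beta\<close>)
    moreover have "pd i (laplacian (u t)) x = (\<Sum>j\<in>UNIV. pd i (pd j (pd j (u t))) x)" if "t \<in> {0..T}" "x \<in> ccube" for t x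
    proof -
      have D: "(pd j (pd j (u t)) has_derivative frechet_derivative (pd j (pd j (u t))) (at x within ccube)) (at x within ccube)" for j
        using spatially_Ck_dparts(3)[OF assms, of "[axis j 1, axis j 1]" t] that \<open>3 \<le> k\<close>
        by (simp add: axis_Basis differentiable_on_def frechet_derivative_works)
      have "((\<lambda>y. \<Sum>j\<in>UNIV. pd j (pd j (u t)) y) has_derivative
          (\<lambda>v. \<Sum>j\<in>UNIV. frechet_derivative (pd j (pd j (u t))) (at x within ccube) v)) (at x within ccube)"
        by (intro has_derivative_sum D)
      then show ?thesis using pd_eq[OF _ that(2), of "laplacian (u t)" _ i]
        by (simp add: laplacian_def[abs_def] dpart_def)
    qed
    ultimately show ?thesis by (subst continuous_on_cong[OF refl, of _ _ "\<lambda>(t, x). \<Sum>j\<in>UNIV. pd i (pd j (pd j (u t))) x"]) auto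
  qed
qed

lemma spatially_Ck_C2:
  assumes "spatially_Ck k T u" "2 \<le> k" "t \<in> {0..T}"
  shows "C2 (u t)"
proof -
  have "u t differentiable_on ccube"
    using spatially_Ck_dparts(3)[OF assms(1), of "[]" t] assms(2,3) by simp
  moreover have "continuous_on ccube (pd i (u t))" "pd i (u t) differentiable_on ccube" for i
    using spatially_Ck_dparts(2,3)[OF assms(1), of "[axis i 1]" t] assms(2,3) by (simp_all add: axis_Basis)
  moreover have "continuous_on ccube (pd j (pd i (u t)))" for i j
    using spatially_Ck_dparts(2)[OF assms(1), of "[axis j 1, axis i 1]" t] assms(2,3) by (simp add: axis_Basis)
  ultimately show ?thesis by (simp add: C2_def C1_def)
qed

lemma spatially_Ck_laplacian_C1:
  assumes "spatially_Ck k T u" "3 \<le> k" "t \<in> {0..T}"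
  shows "C1 (laplacian (u t))"
  unfolding C1_def
proof (intro conjI allI)
  have "pd j (pd j (u t)) differentiable_on ccube" for j
    using spatially_Ck_dparts(3)[OF assms(1), of "[axis j 1, axis j 1]" t] assms(2,3) by (simp add: axis_Basis)
  then show "laplacian (u t) differentiable_on ccube"
    unfolding laplacian_def[abs_def] differentiable_on_def by (intro ballI differentiable_sum) auto
  show "continuous_on ccube (pd i (laplacian (u t)))" for i
    by (rule slice_continuous(1)[OF spatially_Ck_cont(4)[OF assms(1,2)] assms(3)])
qed

lemma eq_on_closed_cube:
  fixes f g :: "real^'n \<Rightarrow> real"
  assumes "continuous_on ccube f" "continuous_on ccube g" "\<And>x. x \<in> cube \<Longrightarrow> f x = g x" "x \<in> ccube"
  shows "f x = g x"
proof -
  have "f x - g x = 0"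
    by (rule continuous_constant_on_closure[of cube "\<lambda>x. f x - g x"])
       (use assms in \<open>auto simp: closure_cube intro!: continuous_intros\<close>)
  then show ?thesis by simp
qed

text \<open>The boundary conditions are imposed at interior times and extend to the end points by continuity.
  The supremum in the error estimate includes them.\<close>

lemma zero_normal_end_points:
  fixes u :: "real \<Rightarrow> real^'n \<Rightarrow> real"
  assumes "T > 0" "\<And>i. continuous_on ({0..T} \<times> ccube) (\<lambda>(t, x). pd i (u t) x)"
    and "\<And>t. t \<in> {0<..<T} \<Longrightarrow> zero_normal_deriv (u t)" "t \<in> {0..T}"
  shows "zero_normal_deriv (u t)"
  unfolding zero_normal_deriv_def
proof (intro ballI allI impI)
  fix x :: "real^'n" and i assume x: "x \<in> ccube" "x $ i = 0 \<or> x $ i = 1"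
  have cl: "closure {0<..<T} = {0..T}" using assms(1) by simp
  have "continuous_on (closure {0<..<T}) (\<lambda>t. pd i (u t) x)"
    unfolding cl by (rule slice_continuous(2)[OF assms(2) x(1)])
  then show "pd i (u t) x = 0"
    by (rule continuous_constant_on_closure) (use assms(3,4) x cl in \<open>auto simp: zero_normal_deriv_def\<close>)
qed

text \<open>The no-flux condition of the exact solution: the two boundary conditions on \<open>u\<close> make every term of
  the normal derivative of the chemical potential vanish.\<close>

lemma zero_normal_chemical_potential:
  fixes u w :: "real^'n \<Rightarrow> real"
  assumes u: "C1 u" "zero_normal_deriv u" and l: "C1 (laplacian u)" "zero_normal_deriv (laplacian u)"
    and w: "\<And>x. x \<in> ccube \<Longrightarrow> w x = - \<epsilon> * laplacian u x + c * ch_f (u x)"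
  shows "zero_normal_deriv w"
  unfolding zero_normal_deriv_def
proof (intro ballI allI impI)
  fix x :: "real^'n" and i assume x: "x \<in> ccube" "x $ i = 0 \<or> x $ i = 1"
  obtain D where D: "(u has_derivative D) (at x within ccube)" "D (axis i 1) = pd i u x"
    using pd_has_derivative[OF _ x(1), of u] u by (auto simp: C1_def)
  obtain E where E: "(laplacian u has_derivative E) (at x within ccube)" "E (axis i 1) = pd i (laplacian u) x"
    using pd_has_derivative[OF _ x(1), of "laplacian u"] l by (auto simp: C1_def)
  have z: "pd i u x = 0" "pd i (laplacian u) x = 0" using u l x by (auto simp: zero_normal_deriv_def)
  have "((\<lambda>x. - \<epsilon> * laplacian u x + c * (u x ^ 3 - u x)) has_derivative
     (\<lambda>v. - \<epsilon> * E v + c * (3 * D v * u x ^ 2 - D v))) (at x within ccube)"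
    by (auto intro!: derivative_eq_intros D(1) E(1))
  from pd_eq[OF this x(1), of i] have "pd i (\<lambda>x. - \<epsilon> * laplacian u x + c * (u x ^ 3 - u x)) x = 0"
    by (simp add: D(2) E(2) z)
  moreover have "pd i w x = pd i (\<lambda>x. - \<epsilon> * laplacian u x + c * (u x ^ 3 - u x)) x"
    by (rule pd_cong[OF _ x(1)]) (simp add: w ch_f_def)
  ultimately show "pd i w x = 0" by simp
qed

section \<open>Evolution of the negative norm\<close>

lemma cint_continuous:
  fixes F :: "real \<Rightarrow> real^'n \<Rightarrow> real"
  assumes "continuous_on ({0..T} \<times> ccube) (\<lambda>(t, x). F t x)"
  shows "continuous_on {0..T} (\<lambda>t. cint (F t))"
proof -
  have "continuous_on {0..T} (\<lambda>t. integral ccube (F t))"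
    by (rule integral_continuous_on_param) (use assms in auto)
  then show ?thesis
    by (rule continuous_on_eq) (simp add: cint_eq_integral slice_continuous(1)[OF assms])
qed

text \<open>Differentiation under the integral, when the derivative in time is known in the open cube only.
  The mean value theorem and the uniform continuity of \<open>u'\<close> make the difference quotients converge
  uniformly there.\<close>

lemma cint_has_derivative:
  fixes u u' :: "real \<Rightarrow> real^'n \<Rightarrow> real"
  assumes u: "continuous_on ({0..T} \<times> ccube) (\<lambda>(t, x). u t x)"
    and u': "continuous_on ({0..T} \<times> ccube) (\<lambda>(t, x). u' t x)"
    and der: "\<And>t x. t \<in> {0<..<T} \<Longrightarrow> x \<in> cube \<Longrightarrow> ((\<lambda>s. u s x) has_real_derivative u' t x) (at t)"
    and psi: "continuous_on ccube \<psi>" and t: "t \<in> {0<..<T}"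
  shows "((\<lambda>s. cint (\<lambda>x. u s x * \<psi> x)) has_real_derivative cint (\<lambda>x. u' t x * \<psi> x)) (at t)"
  unfolding has_field_derivative_iff
proof (rule tendstoI)
  fix \<eta> :: real assume "\<eta> > 0"
  have "bounded (\<psi> ` ccube)" using psi compact_imp_bounded compact_continuous_image compact_cbox by blast
  then obtain B where B: "B > 0" "\<forall>y\<in>\<psi> ` ccube. norm y \<le> B" unfolding bounded_pos by blast
  have "uniformly_continuous_on ({0..T} \<times> ccube) (\<lambda>(t, x). u' t x)"
    by (rule compact_uniformly_continuous[OF u']) (intro compact_Times compact_Icc compact_cbox)
  moreover have e: "\<eta> / (2 * B) > 0" using \<open>\<eta> > 0\<close> B by simp
  ultimately obtain d where d: "d > 0" "\<And>p q. p \<in> {0..T} \<times> ccube \<Longrightarrow> q \<in> {0..T} \<times> ccube \<Longrightarrow> dist q p < d \<Longrightarrow>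
      dist (case q of (t, x) \<Rightarrow> u' t x) (case p of (t, x) \<Rightarrow> u' t x) < \<eta> / (2 * B)"
    unfolding uniformly_continuous_on_def by metis
  have close: "\<bar>(u s x - u t x) / (s - t) - u' t x\<bar> \<le> \<eta> / (2 * B)"
    if s: "s \<in> {0<..<T}" "\<bar>s - t\<bar> < d" "s \<noteq> t" and x: "x \<in> cube" for s x
  proof -
    have xc: "x \<in> ccube" using x cube_subset_ccube by blast
    have mv: "\<exists>\<xi>. min s t < \<xi> \<and> \<xi> < max s t \<and> (u s x - u t x) / (s - t) = u' \<xi> x"
    proof (cases "s < t")
      case True
      have "\<exists>z>s. z < t \<and> u t x - u s x = (t - s) * u' z x"
        by (rule MVT2[OF True]) (use der[OF _ x] s t in auto)
      then obtain z where z: "s < z" "z < t" "u t x - u s x = (t - s) * u' z x" by blast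
      then have "u s x - u t x = (s - t) * u' z x" by (simp add: algebra_simps)
      then show ?thesis using z True by (intro exI[of _ z]) auto
    next
      case False
      then have lt: "t < s" using s by simp
      have "\<exists>z>t. z < s \<and> u s x - u t x = (s - t) * u' z x"
        by (rule MVT2[OF lt]) (use der[OF _ x] s t in auto)
      then obtain z where z: "t < z" "z < s" "u s x - u t x = (s - t) * u' z x" by blast
      then show ?thesis using lt by (intro exI[of _ z]) auto
    qed
    then obtain \<xi> where xi: "min s t < \<xi>" "\<xi> < max s t" "(u s x - u t x) / (s - t) = u' \<xi> x" by blast
    have "dist (\<xi>, x) (t, x) < d" using xi s(2) by (simp add: dist_Pair_Pair dist_real_def)
    moreover have "(\<xi>, x) \<in> {0..T} \<times> ccube" "(t, x) \<in> {0..T} \<times> ccube" using xi s t xc by auto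
    ultimately have "dist (u' \<xi> x) (u' t x) < \<eta> / (2 * B)" using d(2) by fastforce
    then show ?thesis by (simp add: xi(3) dist_real_def)
  qed
  have quot: "\<bar>(cint (\<lambda>x. u s x * \<psi> x) - cint (\<lambda>x. u t x * \<psi> x)) / (s - t) - cint (\<lambda>x. u' t x * \<psi> x)\<bar> \<le> \<eta> / 2"
    if s: "s \<in> {0<..<T}" "\<bar>s - t\<bar> < d" "s \<noteq> t" for s
  proof -
    have c: "continuous_on ccube (u s)" "continuous_on ccube (u t)" "continuous_on ccube (u' t)"
      using slice_continuous(1)[OF u] slice_continuous(1)[OF u'] s t by auto
    have "(cint (\<lambda>x. u s x * \<psi> x) - cint (\<lambda>x. u t x * \<psi> x)) / (s - t) - cint (\<lambda>x. u' t x * \<psi> x)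
       = cint (\<lambda>x. (u s x * \<psi> x - u t x * \<psi> x) / (s - t) - u' t x * \<psi> x)"
      by (subst cint_diff, (intro continuous_intros c psi; use s in simp)+) (simp add: cint_diff continuous_intros c psi)
    also have "\<dots> = cint (\<lambda>x. ((u s x - u t x) / (s - t) - u' t x) * \<psi> x)"
      by (simp add: left_diff_distrib)
    finally have eq: "(cint (\<lambda>x. u s x * \<psi> x) - cint (\<lambda>x. u t x * \<psi> x)) / (s - t) - cint (\<lambda>x. u' t x * \<psi> x)
       = cint (\<lambda>x. ((u s x - u t x) / (s - t) - u' t x) * \<psi> x)" .
    have "\<bar>cint (\<lambda>x. ((u s x - u t x) / (s - t) - u' t x) * \<psi> x)\<bar> \<le> cint (\<lambda>x. \<bar>((u s x - u t x) / (s - t) - u' t x) * \<psi> x\<bar>)"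
      using integral_norm_bound[of "lebesgue_on cube" "\<lambda>x. ((u s x - u t x) / (s - t) - u' t x) * \<psi> x"] by simp
    also have "\<dots> \<le> cint (\<lambda>x::real^'n. \<eta> / 2)"
    proof (rule cint_mono)
      fix x :: "real^'n" assume x: "x \<in> cube"
      then have "\<bar>\<psi> x\<bar> \<le> B" using B(2) cube_subset_ccube by force
      then have "\<bar>((u s x - u t x) / (s - t) - u' t x) * \<psi> x\<bar> \<le> \<eta> / (2 * B) * B"
        unfolding abs_mult using close[OF s x] e by (intro mult_mono) auto
      then show "\<bar>((u s x - u t x) / (s - t) - u' t x) * \<psi> x\<bar> \<le> \<eta> / 2" using B(1) by simp
    qed (intro continuous_intros c psi; use s in simp)+
    also have "\<dots> = \<eta> / 2" by (rule cint_const)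
    finally show ?thesis unfolding eq .
  qed
  have "eventually (\<lambda>s. s \<in> {0<..<T} \<inter> ball t d) (nhds t)"
    using t d(1) by (intro eventually_nhds_in_open) auto
  then have "eventually (\<lambda>s. s \<in> {0<..<T} \<inter> ball t d \<and> s \<noteq> t) (at t)"
    by (simp add: eventually_at_filter eventually_mono)
  then show "eventually (\<lambda>s. dist ((cint (\<lambda>x. u s x * \<psi> x) - cint (\<lambda>x. u t x * \<psi> x)) / (s - t)) (cint (\<lambda>x. u' t x * \<psi> x)) < \<eta>) (at t)"
  proof eventually_elim
    case (elim s)
    then have "\<bar>(cint (\<lambda>x. u s x * \<psi> x) - cint (\<lambda>x. u t x * \<psi> x)) / (s - t) - cint (\<lambda>x. u' t x * \<psi> x)\<bar> \<le> \<eta> / 2"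
      by (intro quot) (auto simp: dist_real_def abs_minus_commute)
    then show ?case using \<open>\<eta> > 0\<close> by (simp add: dist_real_def)
  qed
qed

text \<open>Testing the equation \<open>\<partial>\<^sub>t e = \<Delta> z\<close> with the inverse Laplacian of \<open>e\<close>. On the mode \<open>k\<close> the equation reads
  \<open>e\<^sub>k' = - \<lambda>\<^sub>k z\<^sub>k\<close>, so that \<open>e\<^sub>k\<^sup>2 / \<lambda>\<^sub>k\<close> has derivative \<open>- 2 e\<^sub>k z\<^sub>k\<close>; Parseval's identity sums this to
  the inner product, with Bessel's inequality as the bound for dominated convergence in time. The
  constant mode is conserved.\<close>

lemma hm1_evolution:
  fixes e z :: "real \<Rightarrow> real^'n \<Rightarrow> real"
  assumes e: "continuous_on ({0..T} \<times> ccube) (\<lambda>(t, x). e t x)"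
    and z: "continuous_on ({0..T} \<times> ccube) (\<lambda>(t, x). z t x)"
    and lz: "continuous_on ({0..T} \<times> ccube) (\<lambda>(t, x). laplacian (z t) x)"
    and z2: "\<And>t. t \<in> {0<..<T} \<Longrightarrow> C2 (z t) \<and> zero_normal_deriv (z t)"
    and der: "\<And>t x. t \<in> {0<..<T} \<Longrightarrow> x \<in> cube \<Longrightarrow> ((\<lambda>s. e s x) has_real_derivative laplacian (z t) x) (at t)"
    and e0: "\<And>x. x \<in> cube \<Longrightarrow> e 0 x = 0" and t: "t \<in> {0..T}"
  shows "cint (e t) = 0"
    and "hm1_sq (e t) = integral {0..t} (\<lambda>s. - 2 * cint (\<lambda>x. e s x * z s x))"
proof -
  have ec: "continuous_on ccube (e s)" and zc: "continuous_on ccube (z s)" if "s \<in> {0..T}" for s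
    using slice_continuous(1)[OF e that] slice_continuous(1)[OF z that] by auto
  have phi: "continuous_on ({0..T} \<times> ccube) (\<lambda>p. neumann_eigenfun k (snd p))" for k :: "nat^'n"
    by (rule continuous_on_compose2[OF eigenfun_continuous[of UNIV k]]) (auto intro!: continuous_intros)
  have ck: "continuous_on {0..T} (\<lambda>s. coef (e s) k)" "continuous_on {0..T} (\<lambda>s. coef (z s) k)" for k
    unfolding coef_def
    by (rule cint_continuous; use e z phi[of k] in \<open>auto simp: case_prod_beta intro!: continuous_intros\<close>)+
  have dk: "((\<lambda>s. coef (e s) k) has_real_derivative - neumann_eigenval k * coef (z s) k) (at s)" if s: "s \<in> {0<..<T}" for s k
    using cint_has_derivative[OF e lz der eigenfun_continuous s, of k] coef_laplacian[of "z s" k] z2[OF s]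
    by (simp add: coef_def)
  have c0: "coef (e 0) k = 0" for k
  proof -
    have "coef (e 0) k = cint (\<lambda>x::real^'n. 0)" unfolding coef_def by (rule cint_cong) (simp add: e0)
    then show ?thesis by simp
  qed
  have sub: "{0..t} \<subseteq> {0..T}" using t by auto
  have ft: "((\<lambda>s. - 2 * (coef (e s) k * coef (z s) k)) has_integral (coef (e t) k)\<^sup>2 / neumann_eigenval k) {0..t}"
    if "k \<noteq> 0" for k
  proof -
    have l: "neumann_eigenval k > 0" by (rule eigenval_pos[OF that])
    have "((\<lambda>s. - 2 * (coef (e s) k * coef (z s) k)) has_integral
        (coef (e t) k)\<^sup>2 / neumann_eigenval k - (coef (e 0) k)\<^sup>2 / neumann_eigenval k) {0..t}"
    proof (rule fundamental_theorem_of_calculus_interior)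
      show "continuous_on {0..t} (\<lambda>s. (coef (e s) k)\<^sup>2 / neumann_eigenval k)"
        using l by (intro continuous_intros continuous_on_subset[OF ck(1) sub]) auto
      fix s assume "s \<in> {0<..<t}"
      then have "s \<in> {0<..<T}" using t by auto
      from dk[OF this, of k] have "((\<lambda>s. (coef (e s) k)\<^sup>2 / neumann_eigenval k) has_real_derivative
          2 * (- neumann_eigenval k * coef (z s) k) * coef (e s) k / neumann_eigenval k) (at s)"
        by (auto intro!: derivative_eq_intros)
      also have "2 * (- neumann_eigenval k * coef (z s) k) * coef (e s) k / neumann_eigenval k = - 2 * (coef (e s) k * coef (z s) k)"
        using l by simp
      finally show "((\<lambda>s. (coef (e s) k)\<^sup>2 / neumann_eigenval k) has_vector_derivative - 2 * (coef (e s) k * coef (z s) k)) (at s)"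
        by (simp add: has_real_derivative_iff_has_vector_derivative)
    qed (use t in auto)
    then show ?thesis by (simp add: c0)
  qed
  have mean: "coef (e s) 0 = 0" if s: "s \<in> {0..T}" for s
  proof -
    have "((\<lambda>s. 0) has_integral coef (e s) 0 - coef (e 0) 0) {0..s}"
    proof (rule fundamental_theorem_of_calculus_interior)
      show "continuous_on {0..s} (\<lambda>s. coef (e s) 0)" using s by (intro continuous_on_subset[OF ck(1)]) auto
      fix r assume "r \<in> {0<..<s}"
      then show "((\<lambda>s. coef (e s) 0) has_vector_derivative 0) (at r)"
        using dk[of r 0] s by (simp add: has_real_derivative_iff_has_vector_derivative)
    qed (use s in auto)
    then show ?thesis using has_integral_unique[OF has_integral_0] by (force simp: c0)
  qed
  show "cint (e t) = 0" using mean[OF t] by (simp add: coef_0)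
  let ?S = "\<lambda>N. \<Sum>k\<in>modes N - {0}. (coef (e t) k)\<^sup>2 / neumann_eigenval k"
  have "((\<lambda>s. - 2 * cint (\<lambda>x. e s x * z s x)) has_integral hm1_sq (e t)) {0..t}"
  proof (rule has_integral_dominated_convergence)
    show "((\<lambda>s. \<Sum>k\<in>modes N - {0}. - 2 * (coef (e s) k * coef (z s) k)) has_integral ?S N) {0..t}" for N
      by (intro has_integral_sum ft finite_Diff finite_modes) auto
    have "continuous_on {0..T} (\<lambda>s. cint (\<lambda>x. (e s x)\<^sup>2) + cint (\<lambda>x. (z s x)\<^sup>2))"
      by (intro continuous_on_add cint_continuous; use e z in \<open>auto simp: case_prod_beta intro!: continuous_intros\<close>)
    then show "(\<lambda>s. cint (\<lambda>x. (e s x)\<^sup>2) + cint (\<lambda>x. (z s x)\<^sup>2)) integrable_on {0..t}"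
      using continuous_on_subset[OF _ sub] integrable_continuous_real by blast
    have eqs: "(\<Sum>k\<in>modes N - {0}. - 2 * (coef (e s) k * coef (z s) k)) = - 2 * (\<Sum>k\<in>modes N. coef (e s) k * coef (z s) k)"
      if "s \<in> {0..t}" for s N
    proof -
      have "s \<in> {0..T}" using that sub by blast
      from mean[OF this] show ?thesis
        using sum.remove[OF finite_modes zero_in_modes, of "\<lambda>k. coef (e s) k * coef (z s) k" N]
        by (simp add: sum_distrib_left)
    qed
    show "\<forall>s\<in>{0..t}. norm (\<Sum>k\<in>modes N - {0}. - 2 * (coef (e s) k * coef (z s) k))
        \<le> cint (\<lambda>x. (e s x)\<^sup>2) + cint (\<lambda>x. (z s x)\<^sup>2)" for N
    proof
      fix s assume s: "s \<in> {0..t}"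
      then have sT: "s \<in> {0..T}" using sub by blast
      have "norm (\<Sum>k\<in>modes N - {0}. - 2 * (coef (e s) k * coef (z s) k)) \<le> (\<Sum>k\<in>modes N. 2 * (\<bar>coef (e s) k\<bar> * \<bar>coef (z s) k\<bar>))"
        unfolding eqs[OF s] using sum_abs[of "\<lambda>k. coef (e s) k * coef (z s) k" "modes N"]
        by (simp add: abs_mult sum_distrib_left[symmetric])
      also have "\<dots> \<le> (\<Sum>k\<in>modes N. (coef (e s) k)\<^sup>2 + (coef (z s) k)\<^sup>2)"
      proof (rule sum_mono)
        fix k show "2 * (\<bar>coef (e s) k\<bar> * \<bar>coef (z s) k\<bar>) \<le> (coef (e s) k)\<^sup>2 + (coef (z s) k)\<^sup>2"
          using sum_squares_bound[of "\<bar>coef (e s) k\<bar>" "\<bar>coef (z s) k\<bar>"] by (simp add: mult.assoc)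
      qed
      also have "\<dots> \<le> cint (\<lambda>x. (e s x)\<^sup>2) + cint (\<lambda>x. (z s x)\<^sup>2)"
        unfolding sum.distrib by (intro add_mono bessel ec zc sT)
      finally show "norm (\<Sum>k\<in>modes N - {0}. - 2 * (coef (e s) k * coef (z s) k))
        \<le> cint (\<lambda>x. (e s x)\<^sup>2) + cint (\<lambda>x. (z s x)\<^sup>2)" .
    qed
    show "\<forall>s\<in>{0..t}. (\<lambda>N. \<Sum>k\<in>modes N - {0}. - 2 * (coef (e s) k * coef (z s) k)) \<longlonglongrightarrow> - 2 * cint (\<lambda>x. e s x * z s x)"
    proof
      fix s assume s: "s \<in> {0..t}"
      then have sT: "s \<in> {0..T}" using sub by blast
      show "(\<lambda>N. \<Sum>k\<in>modes N - {0}. - 2 * (coef (e s) k * coef (z s) k)) \<longlonglongrightarrow> - 2 * cint (\<lambda>x. e s x * z s x)"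
        unfolding eqs[OF s] by (intro tendsto_intros parseval_inner ec zc sT)
    qed
    show "?S \<longlonglongrightarrow> hm1_sq (e t)" by (rule hm1_sq_tendsto[OF ec[OF t]])
  qed
  then show "hm1_sq (e t) = integral {0..t} (\<lambda>s. - 2 * cint (\<lambda>x. e s x * z s x))" by (rule integral_unique[symmetric])
qed

section \<open>The energy inequality\<close>

lemma deriv_ch_f: "deriv ch_f s = 3 * s\<^sup>2 - 1"
proof -
  have "(ch_f has_real_derivative 3 * s\<^sup>2 - 1) (at s)"
    unfolding ch_f_def[abs_def] by (auto intro!: derivative_eq_intros)
  then show ?thesis by (rule DERIV_imp_deriv)
qed

lemma ch_f_expand: "(ch_f (a + e) - ch_f a) * e = deriv ch_f a * e\<^sup>2 + 3 * a * e ^ 3 + e ^ 4"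
  unfolding deriv_ch_f ch_f_def by (simp add: power2_eq_square power3_eq_cube power4_eq_xxxx algebra_simps)

text \<open>Testing the error equation with the inverse Laplacian of the error \<open>e\<close>. The quadratic part of
  the nonlinearity is bounded below by the spectral estimate, taken with weight \<open>1 - \<epsilon>\<^sup>3\<close>, and by
  \<open>f' \<ge> -1\<close>, taken with weight \<open>\<epsilon>\<^sup>3\<close>; the cubic part is absorbed while \<open>e\<close> is small; the residual is
  split by Young's inequality.\<close>

lemma energy_inequality:
  fixes e a z :: "real^'n \<Rightarrow> real" and \<epsilon> C\<^sub>0 C\<^sub>a C\<^sub>\<rho> M :: real
  assumes d: "CARD('n) \<le> 3" and e: "C2 e" "zero_normal_deriv e" "cint e = 0"
    and a: "continuous_on ccube a" "\<And>x. x \<in> cube \<Longrightarrow> \<bar>a x\<bar> \<le> C\<^sub>a" and z: "continuous_on ccube z"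
    and eps: "0 < \<epsilon>" "\<epsilon> \<le> 1" and C0: "C\<^sub>0 \<ge> 0" and Ca: "C\<^sub>a \<ge> 0" and Cr: "C\<^sub>\<rho> \<ge> 0"
    and residual: "\<And>x. x \<in> cube \<Longrightarrow>
        \<bar>- \<epsilon> * laplacian e x + (ch_f (a x + e x) - ch_f (a x)) / \<epsilon> - z x\<bar> \<le> C\<^sub>\<rho>"
    and spectral: "\<epsilon> * dirichlet e + cint (\<lambda>x. deriv ch_f (a x) * (e x)\<^sup>2) / \<epsilon> \<ge> - C\<^sub>0 * hm1_sq e"
    and M: "M \<ge> 1" "32 * (6 * C\<^sub>a) + 32 * (6 * C\<^sub>a)\<^sup>2 \<le> M\<^sup>2"
    and small: "hm1_sq e \<le> \<epsilon> ^ 17 / (393216 * M ^ 5 * (6 * C\<^sub>a + 1)\<^sup>2)"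
  shows "- 2 * cint (\<lambda>x. e x * z x) \<le> (2 * C\<^sub>0 + 16) * hm1_sq e
     - (3 / 2 * \<epsilon> ^ 4 * dirichlet e + 7 / (4 * \<epsilon>) * cint (\<lambda>x. e x ^ 4)) + C\<^sub>\<rho>\<^sup>2 / \<epsilon>\<^sup>2"
proof -
  have e1: "C1 e" using e(1) by (simp add: C2_def)
  have ec: "continuous_on ccube e" by (rule C1_continuous[OF e1])
  have lc: "continuous_on ccube (laplacian e)" by (rule C2_continuous_laplacian[OF e(1)])
  define R where "R = (\<lambda>x. - \<epsilon> * laplacian e x + (ch_f (a x + e x) - ch_f (a x)) / \<epsilon> - z x)"
  have fc: "continuous_on ccube (\<lambda>x. ch_f (a x))" "continuous_on ccube (\<lambda>x. ch_f (a x + e x))"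
    unfolding ch_f_def by (intro continuous_intros a ec)+
  have dfc: "continuous_on ccube (\<lambda>x. deriv ch_f (a x))"
    unfolding deriv_ch_f by (intro continuous_intros a)
  have Rc: "continuous_on ccube R"
    unfolding R_def by (intro continuous_intros lc fc z) (use eps in auto)
  define X where "X = dirichlet e"
  define Y where "Y = hm1_sq e"
  define Q where "Q = cint (\<lambda>x. (e x)\<^sup>2)"
  define P where "P = cint (\<lambda>x. deriv ch_f (a x) * (e x)\<^sup>2)"
  define X3 where "X3 = cint (\<lambda>x. \<bar>e x\<bar> ^ 3)"
  define X4 where "X4 = cint (\<lambda>x. e x ^ 4)"
  have Y0: "Y \<ge> 0" unfolding Y_def by (rule hm1_sq_nonneg[OF ec])
  have "- 2 * cint (\<lambda>x. e x * z x) = cint (\<lambda>x. - 2 * (e x * z x))" by simp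
  also have "\<dots> \<le> cint (\<lambda>x. 2 * \<epsilon> * (laplacian e x * e x) + (- 2 / \<epsilon>) * (deriv ch_f (a x) * (e x)\<^sup>2)
       + 6 * C\<^sub>a / \<epsilon> * \<bar>e x\<bar> ^ 3 + (- 2 / \<epsilon>) * e x ^ 4 + \<epsilon>\<^sup>2 * (e x)\<^sup>2 + C\<^sub>\<rho>\<^sup>2 / \<epsilon>\<^sup>2)"
  proof (rule cint_mono)
    fix x :: "real^'n" assume x: "x \<in> cube"
    have "z x = - \<epsilon> * laplacian e x + (ch_f (a x + e x) - ch_f (a x)) / \<epsilon> - R x" by (simp add: R_def)
    moreover have "- 2 * (p * (- \<epsilon> * l + f / \<epsilon> - r)) = 2 * \<epsilon> * (l * p) + (- 2 / \<epsilon>) * (f * p) + 2 * (r * p)"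
      for p l f r by (simp add: algebra_simps)
    ultimately have "- 2 * (e x * z x) = 2 * \<epsilon> * (laplacian e x * e x)
        + (- 2 / \<epsilon>) * ((ch_f (a x + e x) - ch_f (a x)) * e x) + 2 * (R x * e x)"
      by (simp only:)
    also have "(- 2 / \<epsilon>) * ((ch_f (a x + e x) - ch_f (a x)) * e x)
        = (- 2 / \<epsilon>) * (deriv ch_f (a x) * (e x)\<^sup>2) + (- 6 / \<epsilon>) * (a x * e x ^ 3) + (- 2 / \<epsilon>) * e x ^ 4"
      unfolding ch_f_expand by (simp add: algebra_simps)
    also have "(- 6 / \<epsilon>) * (a x * e x ^ 3) \<le> 6 * C\<^sub>a / \<epsilon> * \<bar>e x\<bar> ^ 3"
    proof -
      have "- (a x * e x ^ 3) \<le> \<bar>a x\<bar> * \<bar>e x\<bar> ^ 3" by (metis abs_ge_minus_self abs_mult power_abs)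
      also have "\<dots> \<le> C\<^sub>a * \<bar>e x\<bar> ^ 3" by (rule mult_right_mono[OF a(2)[OF x]]) simp
      finally have "6 / \<epsilon> * (- (a x * e x ^ 3)) \<le> 6 / \<epsilon> * (C\<^sub>a * \<bar>e x\<bar> ^ 3)"
        using eps by (intro mult_left_mono) auto
      then show ?thesis by simp
    qed
    also have "2 * (R x * e x) \<le> \<epsilon>\<^sup>2 * (e x)\<^sup>2 + C\<^sub>\<rho>\<^sup>2 / \<epsilon>\<^sup>2"
    proof -
      have "2 * ((R x / \<epsilon>) * (\<epsilon> * e x)) \<le> (R x / \<epsilon>)\<^sup>2 + (\<epsilon> * e x)\<^sup>2"
        using sum_squares_bound[of "R x / \<epsilon>" "\<epsilon> * e x"] by (simp only: mult.assoc)
      moreover have "\<bar>R x\<bar> \<le> C\<^sub>\<rho>" using residual[OF x] by (simp only: R_def)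
      then have "(R x)\<^sup>2 \<le> C\<^sub>\<rho>\<^sup>2" using Cr by (simp add: abs_le_square_iff[symmetric])
      then have "(R x / \<epsilon>)\<^sup>2 \<le> C\<^sub>\<rho>\<^sup>2 / \<epsilon>\<^sup>2" by (simp add: power_divide divide_right_mono)
      ultimately show ?thesis using eps by (simp add: power_mult_distrib)
    qed
    finally show "- 2 * (e x * z x) \<le> 2 * \<epsilon> * (laplacian e x * e x) + (- 2 / \<epsilon>) * (deriv ch_f (a x) * (e x)\<^sup>2)
       + 6 * C\<^sub>a / \<epsilon> * \<bar>e x\<bar> ^ 3 + (- 2 / \<epsilon>) * e x ^ 4 + \<epsilon>\<^sup>2 * (e x)\<^sup>2 + C\<^sub>\<rho>\<^sup>2 / \<epsilon>\<^sup>2" by simp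
  qed (intro continuous_intros ec z lc dfc)+
  also have "\<dots> = 2 * \<epsilon> * cint (\<lambda>x. laplacian e x * e x) + (- 2 / \<epsilon>) * P + 6 * C\<^sub>a / \<epsilon> * X3 + (- 2 / \<epsilon>) * X4
      + \<epsilon>\<^sup>2 * Q + C\<^sub>\<rho>\<^sup>2 / \<epsilon>\<^sup>2"
    unfolding P_def X3_def X4_def Q_def
    by ((subst cint_add; (intro continuous_intros ec z lc dfc)?)+)
       (simp only: integral_mult_right_zero cint_const)
  also have "cint (\<lambda>x. laplacian e x * e x) = - X"
    unfolding X_def green_first[OF e(1) e1 e(2)] by (simp add: power2_norm_eq_inner)
  finally have main: "- 2 * cint (\<lambda>x. e x * z x) \<le> - 2 * (\<epsilon> * X + P / \<epsilon>) + 6 * C\<^sub>a * X3 / \<epsilon> - 2 * X4 / \<epsilon> + \<epsilon>\<^sup>2 * Q + C\<^sub>\<rho>\<^sup>2 / \<epsilon>\<^sup>2"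
    by (simp add: algebra_simps)
  \<comment> \<open>The weight \<open>\<epsilon>\<^sup>3\<close> of the plain lower bound \<open>f' \<ge> -1\<close> is what leaves \<open>\<epsilon>\<^sup>4\<close> in front of the gradient.\<close>
  have quad: "- 2 * (\<epsilon> * X + P / \<epsilon>) \<le> 2 * C\<^sub>0 * Y - 2 * \<epsilon> ^ 4 * X + 2 * \<epsilon>\<^sup>2 * Q"
  proof -
    have "- Q = cint (\<lambda>x. - (e x)\<^sup>2)" by (simp add: Q_def)
    also have "\<dots> \<le> P"
      unfolding P_def
    proof (rule cint_mono)
      fix x show "- (e x)\<^sup>2 \<le> deriv ch_f (a x) * (e x)\<^sup>2"
        using mult_right_mono[of "-1" "deriv ch_f (a x)" "(e x)\<^sup>2"] by (simp add: deriv_ch_f)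
    qed (intro continuous_intros ec dfc)+
    finally have PQ: "- Q \<le> P" .
    have e3: "0 \<le> \<epsilon> ^ 3" "\<epsilon> ^ 3 \<le> 1" using eps by (auto simp: power_le_one)
    define W where "W = \<epsilon> * X + P / \<epsilon>"
    have "W = (1 - \<epsilon> ^ 3) * W + \<epsilon> ^ 3 * W" by (simp add: algebra_simps)
    moreover have "(1 - \<epsilon> ^ 3) * (- (C\<^sub>0 * Y)) \<le> (1 - \<epsilon> ^ 3) * W"
      using e3 spectral unfolding X_def P_def Y_def W_def by (intro mult_left_mono) auto
    moreover have "(1 - \<epsilon> ^ 3) * (- (C\<^sub>0 * Y)) = - ((1 - \<epsilon> ^ 3) * (C\<^sub>0 * Y))" by simp
    moreover have "(1 - \<epsilon> ^ 3) * (C\<^sub>0 * Y) \<le> 1 * (C\<^sub>0 * Y)" using e3 C0 Y0 by (intro mult_right_mono) auto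
    moreover have "\<epsilon> ^ 3 * W = \<epsilon> ^ 4 * X + \<epsilon>\<^sup>2 * P"
      unfolding W_def using eps by (simp add: field_simps power2_eq_square power3_eq_cube power4_eq_xxxx)
    moreover have "- (\<epsilon>\<^sup>2 * Q) \<le> \<epsilon>\<^sup>2 * P" using mult_left_mono[OF PQ, of "\<epsilon>\<^sup>2"] by simp
    ultimately have "- 2 * W \<le> 2 * (C\<^sub>0 * Y) - 2 * (\<epsilon> ^ 4 * X) + 2 * (\<epsilon>\<^sup>2 * Q)" by linarith
    then show ?thesis by (simp only: W_def mult.assoc)
  qed
  have cubic: "6 * C\<^sub>a * X3 / \<epsilon> \<le> X4 / (4 * \<epsilon>) + \<epsilon>\<^sup>2 * Q + \<epsilon> ^ 4 / 4 * X"
  proof -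
    have "6 * C\<^sub>a * X3 \<le> X4 / 4 + \<epsilon> ^ 3 * Q + \<epsilon> ^ 5 / 4 * X"
      unfolding X3_def X4_def Q_def X_def by (rule cubic_estimate[OF d e _ M eps small]) (use Ca in simp)
    then have "6 * C\<^sub>a * X3 / \<epsilon> \<le> (X4 / 4 + \<epsilon> ^ 3 * Q + \<epsilon> ^ 5 / 4 * X) / \<epsilon>" using eps by (intro divide_right_mono) auto
    also have "\<dots> = X4 / (4 * \<epsilon>) + \<epsilon>\<^sup>2 * Q + \<epsilon> ^ 4 / 4 * X"
      using eps by (simp add: field_simps numeral_eq_Suc)
    finally show ?thesis .
  qed
  have inter: "4 * \<epsilon>\<^sup>2 * Q \<le> \<epsilon> ^ 4 / 4 * X + 16 * Y"
  proof -
    have "Q \<le> \<epsilon>\<^sup>2 / 16 * X + Y / (4 * (\<epsilon>\<^sup>2 / 16))"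
      unfolding Q_def X_def Y_def using eps by (intro l2_interpolation e) auto
    then have "4 * \<epsilon>\<^sup>2 * Q \<le> 4 * \<epsilon>\<^sup>2 * (\<epsilon>\<^sup>2 / 16 * X + Y / (4 * (\<epsilon>\<^sup>2 / 16)))" by (rule mult_left_mono) simp
    also have "\<dots> = \<epsilon> ^ 4 / 4 * X + 16 * Y" using eps by (simp add: field_simps power2_eq_square power4_eq_xxxx)
    finally show ?thesis .
  qed
  have x4: "7 / (4 * \<epsilon>) * X4 = 2 * X4 / \<epsilon> - X4 / (4 * \<epsilon>)" using eps by (simp add: field_simps)
  show ?thesis
    unfolding X_def[symmetric] Y_def[symmetric] X4_def[symmetric] x4
    using main quad cubic inter by (simp add: algebra_simps)
qed

section \<open>A bootstrap Gronwall argument\<close>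

lemma gronwall_below_threshold:
  fixes Y q :: "real \<Rightarrow> real"
  assumes A: "A \<ge> 0" and S: "S \<ge> 0"
    and cont: "continuous_on {0..T} Y" and Y0: "Y 0 = 0" and \<tau>: "\<tau> \<in> {0..T}"
    and der: "\<And>t. t \<in> {0<..<T} \<Longrightarrow> (Y has_real_derivative q t) (at t)"
    and le: "\<And>t. t \<in> {0<..<\<tau>} \<Longrightarrow> q t \<le> A * Y t + S"
  shows "Y \<tau> \<le> S * T * exp (A * T)"
proof -
  \<comment> \<open>nonincreasing where the differential inequality holds\<close>
  define v where "v = (\<lambda>t. Y t * exp (- (A * t)) - S * t)"
  have "v \<tau> \<le> v 0"
  proof (rule DERIV_nonpos_imp_decreasing_open[where f = v])
    show "0 \<le> \<tau>" using \<tau> by simp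
    show "continuous_on {0..\<tau>} v"
      unfolding v_def using \<tau> by (intro continuous_intros continuous_on_subset[OF cont]) auto
    fix t assume t: "0 < t" "t < \<tau>"
    have "(v has_real_derivative q t * exp (- (A * t)) + Y t * (exp (- (A * t)) * (- A)) - S) (at t)"
      unfolding v_def using t \<tau> by (auto intro!: derivative_eq_intros der)
    moreover have "q t * exp (- (A * t)) + Y t * (exp (- (A * t)) * (- A)) - S \<le> 0"
    proof -
      have "(q t - A * Y t) * exp (- (A * t)) \<le> S * exp (- (A * t))" using le[of t] t by (intro mult_right_mono) auto
      also have "\<dots> \<le> S * 1" using A S t by (intro mult_left_mono) auto
      finally show ?thesis by (simp add: algebra_simps)
    qed
    ultimately show "\<exists>y. (v has_real_derivative y) (at t) \<and> y \<le> 0" by blast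
  qed
  then have "Y \<tau> * exp (- (A * \<tau>)) \<le> S * \<tau>" by (simp add: v_def Y0)
  then have "Y \<tau> * exp (- (A * \<tau>)) * exp (A * \<tau>) \<le> S * \<tau> * exp (A * \<tau>)" by (rule mult_right_mono) simp
  then have "Y \<tau> \<le> S * \<tau> * exp (A * \<tau>)" by (simp add: mult.assoc flip: exp_add)
  also have "\<dots> \<le> S * T * exp (A * T)"
    using \<tau> A S by (intro mult_mono mult_left_mono) (auto intro: mult_left_mono)
  finally show ?thesis .
qed

text \<open>The differential inequality holds only below the threshold \<open>m\<close>. At the first time at which \<open>Y\<close> reaches
  \<open>m\<close>, Gronwall's inequality on the interval before it bounds \<open>Y\<close> by a number below \<open>m\<close>, so this time does
  not exist. Integrating the inequality once more bounds the dissipation.\<close>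

lemma bootstrap:
  fixes Y q D :: "real \<Rightarrow> real"
  assumes T: "T > 0" and A: "A \<ge> 0" and S: "S \<ge> 0"
    and cont: "continuous_on {0..T} Y" and Y0: "Y 0 = 0" and Ypos: "\<And>t. t \<in> {0..T} \<Longrightarrow> 0 \<le> Y t"
    and der: "\<And>t. t \<in> {0<..<T} \<Longrightarrow> (Y has_real_derivative q t) (at t)"
    and D: "continuous_on {0..T} D" "\<And>t. t \<in> {0..T} \<Longrightarrow> 0 \<le> D t"
    and le: "\<And>t. t \<in> {0<..<T} \<Longrightarrow> Y t \<le> m \<Longrightarrow> q t \<le> A * Y t - D t + S"
    and m: "S * T * exp (A * T) < m"
  shows "\<And>t. t \<in> {0..T} \<Longrightarrow> Y t \<le> S * T * exp (A * T)"
    and "integral {0..T} D \<le> T * (A * (S * T * exp (A * T)) + S)"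
proof -
  let ?b = "S * T * exp (A * T)"
  have b0: "?b \<ge> 0" using S T by simp
  have below: "Y t < m" if t: "t \<in> {0..T}" for t
  proof (rule ccontr)
    assume "\<not> Y t < m"
    define B where "B = {s \<in> {0..T}. m \<le> Y s}"
    have Bne: "B \<noteq> {}" using \<open>\<not> Y t < m\<close> t by (auto simp: B_def)
    have "B = {0..T} \<inter> Y -` {m..}" by (auto simp: B_def)
    then have "closed B" using continuous_closed_preimage[OF cont, of "{m..}"] by simp
    moreover have bdd: "bdd_below B" by (rule bdd_belowI[of _ 0]) (simp add: B_def)
    ultimately have inB: "Inf B \<in> B" using closed_contains_Inf[OF Bne] by blast
    have "Y s \<le> m" if "s \<in> {0<..<Inf B}" for s
    proof (rule ccontr)
      assume "\<not> Y s \<le> m"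
      then have "s \<in> B" using that inB by (simp add: B_def)
      then have "Inf B \<le> s" using bdd by (rule cInf_lower)
      then show False using that by simp
    qed
    note early = this
    have iT: "Inf B \<in> {0..T}" "m \<le> Y (Inf B)" using inB by (simp_all add: B_def)
    have "Y (Inf B) \<le> ?b"
    proof (rule gronwall_below_threshold[OF A S cont Y0 iT(1) der])
      fix s assume s: "s \<in> {0<..<Inf B}"
      then have sT: "s \<in> {0<..<T}" using iT(1) by auto
      have "q s \<le> A * Y s - D s + S" by (rule le[OF sT early[OF s]])
      moreover have "0 \<le> D s" using D(2)[of s] sT by auto
      ultimately show "q s \<le> A * Y s + S" by linarith
    qed
    then show False using iT(2) m by linarith
  qed
  have bound: "Y t \<le> ?b" if t: "t \<in> {0..T}" for t
  proof (rule gronwall_below_threshold[OF A S cont Y0 t der])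
    fix s assume s: "s \<in> {0<..<t}"
    then have sT: "s \<in> {0<..<T}" using t by auto
    then have "q s \<le> A * Y s - D s + S" using below[of s] by (intro le) auto
    moreover have "0 \<le> D s" using D(2)[of s] sT by auto
    ultimately show "q s \<le> A * Y s + S" by linarith
  qed auto
  show "Y t \<le> ?b" if "t \<in> {0..T}" for t by (rule bound[OF that])
  have "Y T + integral {0..T} D - (A * ?b + S) * T \<le> Y 0 + integral {0..0} D - (A * ?b + S) * 0"
  proof (rule DERIV_nonpos_imp_decreasing_open[where f = "\<lambda>t. Y t + integral {0..t} D - (A * ?b + S) * t"])
    have "continuous_on {0..T} (\<lambda>t. integral {0..t} D)"
      by (rule indefinite_integral_continuous_1[OF integrable_continuous_real[OF D(1)]])
    then show "continuous_on {0..T} (\<lambda>t. Y t + integral {0..t} D - (A * ?b + S) * t)"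
      by (intro continuous_intros cont)
    fix t assume t: "0 < t" "t < T"
    have "((\<lambda>x. integral {0..x} D) has_real_derivative D t) (at t within {0..T})"
      by (rule integral_has_real_derivative[OF D(1)]) (use t in auto)
    then have i: "((\<lambda>x. integral {0..x} D) has_real_derivative D t) (at t)"
      using t at_within_interior[of t "{0..T}"] by simp
    have "((\<lambda>t. Y t + integral {0..t} D - (A * ?b + S) * t) has_real_derivative q t + D t - (A * ?b + S)) (at t)"
      using t by (auto intro!: derivative_eq_intros der i)
    moreover have "q t + D t - (A * ?b + S) \<le> 0"
    proof -
      have "q t \<le> A * Y t - D t + S" using t below[of t] by (intro le) auto
      moreover have "A * Y t \<le> A * ?b" using t A by (intro mult_left_mono bound) auto
      ultimately show ?thesis by linarith
    qed
    ultimately show "\<exists>y. ((\<lambda>t. Y t + integral {0..t} D - (A * ?b + S) * t) has_real_derivative y) (at t) \<and> y \<le> 0"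
      by blast
  qed (use T in simp)
  then show "integral {0..T} D \<le> T * (A * ?b + S)"
    using Ypos[of T] T by (simp add: Y0 mult.commute)
qed

lemma nn_integral_interval:
  fixes F :: "real \<Rightarrow> real"
  assumes "continuous_on {0..T} F" "\<And>t. t \<in> {0..T} \<Longrightarrow> 0 \<le> F t"
  shows "(\<integral>\<^sup>+t. ennreal (F t) \<partial>lebesgue_on {0<..<T}) = ennreal (integral {0..T} F)"
proof -
  have "F absolutely_integrable_on {0..T}"
    using absolutely_integrable_continuous_real assms(1) by blast
  then have "F absolutely_integrable_on {0<..<T}" by (rule set_integrable_subset) auto
  then have i: "integrable (lebesgue_on {0<..<T}) F" by (rule absolutely_integrable_imp_integrable) auto
  have "(\<integral>\<^sup>+t. ennreal (F t) \<partial>lebesgue_on {0<..<T}) = ennreal (LINT t|lebesgue_on {0<..<T}. F t)"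
    by (rule nn_integral_eq_integral[OF i]) (use assms(2) in \<open>auto intro!: AE_I2\<close>)
  also have "(LINT t|lebesgue_on {0<..<T}. F t) = integral {0<..<T} F"
    by (rule lebesgue_integral_eq_integral[OF i]) simp
  also have "\<dots> = integral {0..T} F" using integral_open_interval[of 0 T F] by simp
  finally show ?thesis .
qed

section \<open>The error estimate\<close>

definition error_functional :: "real \<Rightarrow> real \<Rightarrow> (real \<Rightarrow> real^'n \<Rightarrow> real) \<Rightarrow> ennreal" where
  "error_functional T \<epsilon> e = (SUP t\<in>{0..T}. ennreal ((Hm1_norm (e t))\<^sup>2))
     + ennreal (\<epsilon> ^ 4) * (\<integral>\<^sup>+t. ennreal ((H1_norm (e t))\<^sup>2) \<partial>lebesgue_on {0<..<T})
     + ennreal (13 / (8 * \<epsilon>)) * (\<integral>\<^sup>+t. ennreal ((Lp_norm 4 (e t)) ^ 4) \<partial>lebesgue_on {0<..<T})"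

text \<open>The estimate at a fixed \<open>\<epsilon>\<close>, with all constants explicit: their dependence on \<open>\<epsilon>\<close> is confined to the
  residual bound and to the smallness condition.\<close>

lemma difference_estimate:
  fixes uA wA uD wD \<rho> :: "real \<Rightarrow> real^'n \<Rightarrow> real" and T \<epsilon> C\<^sub>0 C\<^sub>a C\<^sub>\<rho> M :: real
  assumes d: "CARD('n) \<le> 3" and T: "T > 0" and eps: "0 < \<epsilon>" "\<epsilon> \<le> 1"
    and A: "ch_system T \<epsilon> \<rho> uA wA" "\<And>t. t \<in> {0<..<T} \<Longrightarrow> zero_normal_deriv (wA t)"
    and D: "ch_solution T \<epsilon> (uA 0) uD wD"
    and Ca: "C\<^sub>a \<ge> 0" "\<And>t x. t \<in> {0<..<T} \<Longrightarrow> x \<in> cube \<Longrightarrow> \<bar>uA t x\<bar> \<le> C\<^sub>a"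
    and Cr: "C\<^sub>\<rho> \<ge> 0" "\<And>t x. t \<in> {0<..<T} \<Longrightarrow> x \<in> cube \<Longrightarrow> \<bar>\<rho> t x\<bar> \<le> C\<^sub>\<rho>"
    and C0: "C\<^sub>0 \<ge> 0"
    and spectral: "\<And>t g. t \<in> {0..T} \<Longrightarrow> H1 g \<Longrightarrow> cint g = 0 \<Longrightarrow>
       cint (\<lambda>x. \<epsilon> * (norm (weak_grad g x))\<^sup>2 + 1/\<epsilon> * deriv ch_f (uA t x) * (g x)\<^sup>2) \<ge> - C\<^sub>0 * (Hm1_norm g)\<^sup>2"
    and M: "M \<ge> 1" "32 * (6 * C\<^sub>a) + 32 * (6 * C\<^sub>a)\<^sup>2 \<le> M\<^sup>2"
    and Lam: "\<Lambda> = 2 * C\<^sub>0 + 16" and S: "S = C\<^sub>\<rho>\<^sup>2 / \<epsilon>\<^sup>2"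
    and small: "S * T * exp (\<Lambda> * T) < \<epsilon> ^ 17 / (393216 * M ^ 5 * (6 * C\<^sub>a + 1)\<^sup>2)"
  shows "error_functional T \<epsilon> (\<lambda>t x. uD t x - uA t x)
    \<le> ennreal (S * (T * exp (\<Lambda> * T) * (1 + \<Lambda> * T + 4 * T) + T))"
proof -
  have uA4: "spatially_Ck 4 T uA" and wA2: "spatially_Ck 2 T wA"
    and A_eq: "\<And>t x. t \<in> {0<..<T} \<Longrightarrow> x \<in> cube \<Longrightarrow> ((\<lambda>s. uA s x) has_real_derivative laplacian (wA t) x) (at t)"
      "\<And>t x. t \<in> {0<..<T} \<Longrightarrow> x \<in> cube \<Longrightarrow> wA t x = - \<epsilon> * laplacian (uA t) x + 1/\<epsilon> * ch_f (uA t x) + \<rho> t x"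
    and A_bc: "\<And>t. t \<in> {0<..<T} \<Longrightarrow> zero_normal_deriv (uA t)"
    using A(1) unfolding ch_system_def by blast+
  have uD4: "spatially_Ck 4 T uD" and wD2: "spatially_Ck 2 T wD"
    and D_eq: "\<And>t x. t \<in> {0<..<T} \<Longrightarrow> x \<in> cube \<Longrightarrow> ((\<lambda>s. uD s x) has_real_derivative laplacian (wD t) x) (at t)"
      "\<And>t x. t \<in> {0<..<T} \<Longrightarrow> x \<in> cube \<Longrightarrow> wD t x = - \<epsilon> * laplacian (uD t) x + 1/\<epsilon> * ch_f (uD t x) + 0"
    and D_bc: "\<And>t. t \<in> {0<..<T} \<Longrightarrow> zero_normal_deriv (uD t)" "\<And>t. t \<in> {0<..<T} \<Longrightarrow> zero_normal_deriv (laplacian (uD t))"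
    and D_0: "\<And>x. x \<in> cube \<Longrightarrow> uD 0 x = uA 0 x"
    using D unfolding ch_solution_def ch_system_def by blast+
  have C2u: "C2 (uD t)" "C2 (uA t)" and C2w: "C2 (wD t)" "C2 (wA t)" if "t \<in> {0..T}" for t
    using spatially_Ck_C2[OF uD4 _ that] spatially_Ck_C2[OF uA4 _ that]
      spatially_Ck_C2[OF wD2 _ that] spatially_Ck_C2[OF wA2 _ that] by simp_all
  define e where "e = (\<lambda>t x. uD t x - uA t x)"
  define z where "z = (\<lambda>t x. wD t x - wA t x)"
  have io: "t \<in> {0..T}" if "t \<in> {0<..<T}" for t using that by auto
  have C2e: "C2 (e t)" if "t \<in> {0..T}" for t unfolding e_def by (rule C2_diff[OF C2u[OF that]])
  have C1e: "C1 (e t)" if "t \<in> {0..T}" for t using C2e[OF that] by (simp add: C2_def)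
  have zn_e: "zero_normal_deriv (e t)" if t: "t \<in> {0..T}" for t
  proof -
    have "zero_normal_deriv (uD t)" "zero_normal_deriv (uA t)"
      using zero_normal_end_points[OF T spatially_Ck_cont(2)[OF uD4] D_bc(1) t]
        zero_normal_end_points[OF T spatially_Ck_cont(2)[OF uA4] A_bc t] by simp_all
    then show ?thesis unfolding e_def using C2u[OF t] by (intro zero_normal_diff) (auto simp: C2_def)
  qed
  have zn_wD: "zero_normal_deriv (wD t)" if t: "t \<in> {0<..<T}" for t
  proof (rule zero_normal_chemical_potential[where u = "uD t" and c = "1/\<epsilon>" and \<epsilon> = \<epsilon>])
    show lap: "C1 (laplacian (uD t))" by (rule spatially_Ck_laplacian_C1[OF uD4 _ io[OF t]]) simp
    show C1u: "C1 (uD t)" using C2u[OF io[OF t]] by (simp add: C2_def)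
    fix x :: "real^'n" assume x: "x \<in> ccube"
    show "wD t x = - \<epsilon> * laplacian (uD t) x + 1/\<epsilon> * ch_f (uD t x)"
    proof (rule eq_on_closed_cube[OF _ _ _ x])
      show "continuous_on ccube (wD t)" using C2w[OF io[OF t]] C1_continuous by (auto simp: C2_def)
      show "continuous_on ccube (\<lambda>x. - \<epsilon> * laplacian (uD t) x + 1/\<epsilon> * ch_f (uD t x))"
        unfolding ch_f_def using eps by (intro continuous_intros C1_continuous lap C1u) auto
      show "wD t y = - \<epsilon> * laplacian (uD t) y + 1/\<epsilon> * ch_f (uD t y)" if "y \<in> cube" for y
        using D_eq(2)[OF t that] by simp
    qed
  qed (use D_bc t in auto)
  have cu: "continuous_on ({0..T} \<times> ccube) (\<lambda>p. uD (fst p) (snd p))" "continuous_on ({0..T} \<times> ccube) (\<lambda>p. uA (fst p) (snd p))"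
    "continuous_on ({0..T} \<times> ccube) (\<lambda>p. wD (fst p) (snd p))" "continuous_on ({0..T} \<times> ccube) (\<lambda>p. wA (fst p) (snd p))"
    using spatially_Ck_cont(1)[OF uD4] spatially_Ck_cont(1)[OF uA4] spatially_Ck_cont(1)[OF wD2] spatially_Ck_cont(1)[OF wA2]
    by (simp_all add: case_prod_beta)
  have ce: "continuous_on ({0..T} \<times> ccube) (\<lambda>p. e (fst p) (snd p))" and cz: "continuous_on ({0..T} \<times> ccube) (\<lambda>p. z (fst p) (snd p))"
    unfolding e_def z_def by (intro continuous_intros cu)+
  have clz: "continuous_on ({0..T} \<times> ccube) (\<lambda>(t, x). laplacian (z t) x)"
  proof (rule continuous_on_eq)
    show "continuous_on ({0..T} \<times> ccube) (\<lambda>p. laplacian (wD (fst p)) (snd p) - laplacian (wA (fst p)) (snd p))"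
      using spatially_Ck_cont(3)[OF wD2] spatially_Ck_cont(3)[OF wA2]
      by (intro continuous_intros) (simp_all add: case_prod_beta)
    show "laplacian (wD (fst p)) (snd p) - laplacian (wA (fst p)) (snd p) = (case p of (t, x) \<Rightarrow> laplacian (z t) x)"
      if "p \<in> {0..T} \<times> ccube" for p
      using that C2w[of "fst p"] by (auto simp: z_def laplacian_diff)
  qed
  have cX: "continuous_on ({0..T} \<times> ccube) (\<lambda>(t, x). (norm (grad (e t) x))\<^sup>2)"
  proof (rule continuous_on_eq)
    show "continuous_on ({0..T} \<times> ccube) (\<lambda>p. \<Sum>i\<in>UNIV. (pd i (uD (fst p)) (snd p) - pd i (uA (fst p)) (snd p))\<^sup>2)"
      using spatially_Ck_cont(2)[OF uD4] spatially_Ck_cont(2)[OF uA4]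
      by (intro continuous_intros) (simp_all add: case_prod_beta)
    fix p :: "real \<times> (real^'n)" assume p: "p \<in> {0..T} \<times> ccube"
    then obtain t x where tx: "p = (t, x)" "t \<in> {0..T}" "x \<in> ccube" by auto
    have "uD t differentiable_on ccube" "uA t differentiable_on ccube"
      using C2u[OF tx(2)] by (auto simp: C2_def C1_def)
    then have "pd i (e t) x = pd i (uD t) x - pd i (uA t) x" for i
      unfolding e_def using tx(3) by (rule pd_diff)
    then show "(\<Sum>i\<in>UNIV. (pd i (uD (fst p)) (snd p) - pd i (uA (fst p)) (snd p))\<^sup>2)
        = (case p of (t, x) \<Rightarrow> (norm (grad (e t) x))\<^sup>2)"
      by (simp add: tx(1) grad_def norm_vec_def L2_set_def sum_nonneg)
  qed
  define q where "q = (\<lambda>s. - 2 * cint (\<lambda>x. e s x * z s x))"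
  define Y where "Y = (\<lambda>t. integral {0..t} q)"
  define X where "X = (\<lambda>t. dirichlet (e t))"
  define Q where "Q = (\<lambda>t. cint (\<lambda>x. (e t x)\<^sup>2))"
  define X4 where "X4 = (\<lambda>t. cint (\<lambda>x. e t x ^ 4))"
  define Dis where "Dis = (\<lambda>t. 3 / 2 * \<epsilon> ^ 4 * X t + 7 / (4 * \<epsilon>) * X4 t)"
  have Xc: "continuous_on {0..T} X" unfolding X_def by (rule cint_continuous[OF cX])
  have Qc: "continuous_on {0..T} Q" unfolding Q_def
    by (rule cint_continuous) (use ce in \<open>auto simp: case_prod_beta intro!: continuous_intros\<close>)
  have X4c: "continuous_on {0..T} X4" unfolding X4_def
    by (rule cint_continuous) (use ce in \<open>auto simp: case_prod_beta intro!: continuous_intros\<close>)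
  have qc: "continuous_on {0..T} q" unfolding q_def
    by (intro continuous_intros cint_continuous) (use ce cz in \<open>auto simp: case_prod_beta intro!: continuous_intros\<close>)
  have Dc: "continuous_on {0..T} Dis" unfolding Dis_def by (intro continuous_intros Xc X4c)
  have Yc: "continuous_on {0..T} Y" unfolding Y_def
    by (rule indefinite_integral_continuous_1[OF integrable_continuous_real[OF qc]])
  have nonneg: "0 \<le> X t" "0 \<le> Q t" "0 \<le> X4 t" for t
    unfolding X_def Q_def X4_def by (rule cint_nonneg; simp)+
  have Dpos: "0 \<le> Dis t" for t unfolding Dis_def using nonneg eps by (intro add_nonneg_nonneg mult_nonneg_nonneg) auto
  have evol: "cint (e t) = 0" "hm1_sq (e t) = Y t" if t: "t \<in> {0..T}" for t
  proof -
    have z2: "C2 (z t) \<and> zero_normal_deriv (z t)" if "t \<in> {0<..<T}" for t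
      unfolding z_def using C2w[OF io[OF that]] zn_wD[OF that] A(2)[OF that]
      by (intro conjI C2_diff zero_normal_diff) (auto simp: C2_def)
    have der: "((\<lambda>s. e s x) has_real_derivative laplacian (z t) x) (at t)" if tx: "t \<in> {0<..<T}" "x \<in> cube" for t x
    proof -
      have "laplacian (z t) x = laplacian (wD t) x - laplacian (wA t) x"
        unfolding z_def by (rule laplacian_diff) (use C2w[OF io[OF tx(1)]] tx(2) cube_subset_ccube in auto)
      then show ?thesis unfolding e_def using DERIV_diff[OF D_eq(1)[OF tx] A_eq(1)[OF tx]] by simp
    qed
    have e0: "e 0 x = 0" if "x \<in> cube" for x using D_0[OF that] by (simp add: e_def)
    show "cint (e t) = 0"
      by (rule hm1_evolution(1)[OF _ _ clz z2 der e0 t]) (use ce cz in \<open>simp_all add: case_prod_beta\<close>)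
    show "hm1_sq (e t) = Y t" unfolding Y_def q_def
      by (rule hm1_evolution(2)[OF _ _ clz z2 der e0 t]) (use ce cz in \<open>simp_all add: case_prod_beta\<close>)
  qed
  have ec: "continuous_on ccube (e t)" if "t \<in> {0..T}" for t by (rule C1_continuous[OF C1e[OF that]])
  have Ypos: "0 \<le> Y t" if "t \<in> {0..T}" for t
    using hm1_sq_nonneg[OF ec[OF that]] evol(2)[OF that] by simp
  have Hm1: "(Hm1_norm (e t))\<^sup>2 = Y t" if "t \<in> {0..T}" for t
    using Hm1_norm_sq[OF d C2e[OF that] zn_e[OF that] evol(1)[OF that]] evol(2)[OF that] by simp
  have Yder: "(Y has_real_derivative q t) (at t)" if t: "t \<in> {0<..<T}" for t
  proof -
    have "(Y has_real_derivative q t) (at t within {0..T})" unfolding Y_def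
      by (rule integral_has_real_derivative[OF qc io[OF t]])
    then show ?thesis using t at_within_interior[of t "{0..T}"] by simp
  qed
  define m where "m = \<epsilon> ^ 17 / (393216 * M ^ 5 * (6 * C\<^sub>a + 1)\<^sup>2)"
  have ineq: "q t \<le> \<Lambda> * Y t - Dis t + S" if t: "t \<in> {0<..<T}" and Ym: "Y t \<le> m" for t
  proof -
    note tT = io[OF t]
    have "continuous_on ccube (uA t)" using C2u[OF tT] C1_continuous by (auto simp: C2_def)
    note ac = this
    have zc: "continuous_on ccube (z t)" unfolding z_def
      using C2w[OF tT] C1_continuous by (auto simp: C2_def intro!: continuous_intros)
    have dfc: "continuous_on ccube (\<lambda>x. deriv ch_f (uA t x))"
      unfolding deriv_ch_f by (intro continuous_intros ac)
    have "q t \<le> (2 * C\<^sub>0 + 16) * hm1_sq (e t)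
       - (3 / 2 * \<epsilon> ^ 4 * dirichlet (e t) + 7 / (4 * \<epsilon>) * cint (\<lambda>x. e t x ^ 4)) + C\<^sub>\<rho>\<^sup>2 / \<epsilon>\<^sup>2"
      unfolding q_def
    proof (rule energy_inequality[OF d C2e[OF tT] zn_e[OF tT] evol(1)[OF tT] ac Ca(2)[OF t] zc eps C0 Ca(1) Cr(1) _ _ M])
      fix x :: "real^'n" assume x: "x \<in> cube"
      then have xc: "x \<in> ccube" using cube_subset_ccube by blast
      have l: "laplacian (e t) x = laplacian (uD t) x - laplacian (uA t) x"
        unfolding e_def by (rule laplacian_diff[OF C2u[OF tT] xc])
      have "- \<epsilon> * laplacian (e t) x + (ch_f (uA t x + e t x) - ch_f (uA t x)) / \<epsilon> - z t x = \<rho> t x"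
        unfolding l z_def A_eq(2)[OF t x] D_eq(2)[OF t x] by (simp add: e_def algebra_simps diff_divide_distrib)
      then show "\<bar>- \<epsilon> * laplacian (e t) x + (ch_f (uA t x + e t x) - ch_f (uA t x)) / \<epsilon> - z t x\<bar> \<le> C\<^sub>\<rho>"
        using Cr(2)[OF t x] by simp
    next
      have hc: "continuous_on ccube (\<lambda>x. 1/\<epsilon> * deriv ch_f (uA t x) * (e t x)\<^sup>2)"
        using eps by (intro continuous_intros dfc ec[OF tT]) auto
      have gc: "continuous_on ccube (\<lambda>x. \<epsilon> * (norm (grad (e t) x))\<^sup>2)"
        by (intro continuous_intros slice_continuous(1)[OF cX tT])
      have "- C\<^sub>0 * hm1_sq (e t) \<le> cint (\<lambda>x. \<epsilon> * (norm (weak_grad (e t) x))\<^sup>2 + 1/\<epsilon> * deriv ch_f (uA t x) * (e t x)\<^sup>2)"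
        using spectral[OF tT weak_grad_classical(1)[OF C1e[OF tT]] evol(1)[OF tT]] Hm1[OF tT] evol(2)[OF tT] by simp
      also have "\<dots> = cint (\<lambda>x. \<epsilon> * (norm (grad (e t) x))\<^sup>2 + 1/\<epsilon> * deriv ch_f (uA t x) * (e t x)\<^sup>2)"
        by (rule dirichlet_weak[OF C1e[OF tT] hc])
      also have "\<dots> = cint (\<lambda>x. \<epsilon> * (norm (grad (e t) x))\<^sup>2) + cint (\<lambda>x. 1/\<epsilon> * deriv ch_f (uA t x) * (e t x)\<^sup>2)"
        by (rule cint_add[OF gc hc])
      also have "cint (\<lambda>x. 1/\<epsilon> * deriv ch_f (uA t x) * (e t x)\<^sup>2) = cint (\<lambda>x. deriv ch_f (uA t x) * (e t x)\<^sup>2) / \<epsilon>"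
        by simp
      also have "cint (\<lambda>x. \<epsilon> * (norm (grad (e t) x))\<^sup>2) = \<epsilon> * dirichlet (e t)" by simp
      finally show "- C\<^sub>0 * hm1_sq (e t) \<le> \<epsilon> * dirichlet (e t) + cint (\<lambda>x. deriv ch_f (uA t x) * (e t x)\<^sup>2) / \<epsilon>" .
    next
      show "hm1_sq (e t) \<le> \<epsilon> ^ 17 / (393216 * M ^ 5 * (6 * C\<^sub>a + 1)\<^sup>2)"
        using Ym evol(2)[OF tT] by (simp only: m_def)
    qed
    then show ?thesis by (simp only: Lam S Dis_def X_def X4_def evol(2)[OF tT])
  qed
  have Lpos: "\<Lambda> \<ge> 0" and Spos: "S \<ge> 0" using C0 by (simp_all add: Lam S)
  have Y00: "Y 0 = 0" by (simp add: Y_def)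
  define b where "b = S * T * exp (\<Lambda> * T)"
  have b0: "b \<ge> 0" using Spos T by (simp add: b_def)
  have mb: "S * T * exp (\<Lambda> * T) < m" using small by (simp only: m_def)
  have Yb: "Y t \<le> b" if "t \<in> {0..T}" for t
    unfolding b_def by (rule bootstrap(1)[OF T Lpos Spos Yc Y00 Ypos Yder Dc Dpos ineq mb that])
  have Db: "integral {0..T} Dis \<le> T * (\<Lambda> * b + S)"
    unfolding b_def by (rule bootstrap(2)[OF T Lpos Spos Yc Y00 Ypos Yder Dc Dpos ineq mb])
  have sup: "(SUP t\<in>{0..T}. ennreal ((Hm1_norm (e t))\<^sup>2)) \<le> ennreal b"
    by (rule SUP_least) (use Hm1 Yb in \<open>simp add: ennreal_leI\<close>)
  have n1: "(\<integral>\<^sup>+t. ennreal ((H1_norm (e t))\<^sup>2) \<partial>lebesgue_on {0<..<T}) = ennreal (integral {0..T} (\<lambda>t. Q t + X t))"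
  proof -
    have "(\<integral>\<^sup>+t. ennreal ((H1_norm (e t))\<^sup>2) \<partial>lebesgue_on {0<..<T}) = (\<integral>\<^sup>+t. ennreal (Q t + X t) \<partial>lebesgue_on {0<..<T})"
      by (rule nn_integral_cong) (simp add: H1_norm_sq[OF C1e] Q_def X_def)
    also have "\<dots> = ennreal (integral {0..T} (\<lambda>t. Q t + X t))"
      by (rule nn_integral_interval) (use nonneg in \<open>auto intro!: continuous_intros Qc Xc\<close>)
    finally show ?thesis .
  qed
  have n2: "(\<integral>\<^sup>+t. ennreal ((Lp_norm 4 (e t)) ^ 4) \<partial>lebesgue_on {0<..<T}) = ennreal (integral {0..T} X4)"
    unfolding Lp_norm_4_pow X4_def[symmetric, THEN fun_cong, simplified]
    using nn_integral_interval[OF X4c] nonneg by (simp add: X4_def)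
  have int: "\<epsilon> ^ 4 * integral {0..T} (\<lambda>t. Q t + X t) + 13 / (8 * \<epsilon>) * integral {0..T} X4 \<le> T * (\<Lambda> * b + S) + 4 * T * b"
  proof -
    have "\<epsilon> ^ 4 * integral {0..T} (\<lambda>t. Q t + X t) + 13 / (8 * \<epsilon>) * integral {0..T} X4
        = integral {0..T} (\<lambda>t. \<epsilon> ^ 4 * (Q t + X t) + 13 / (8 * \<epsilon>) * X4 t)"
      unfolding integral_mult_right[symmetric]
      by (rule integral_add[symmetric]; intro integrable_continuous_real continuous_intros Qc Xc X4c)
    also have "\<dots> \<le> integral {0..T} (\<lambda>t. Dis t + 4 * b)"
    proof (rule integral_le)
      fix t assume t: "t \<in> {0..T}"
      have "Q t \<le> \<epsilon>\<^sup>2 / 16 * X t + Y t / (4 * (\<epsilon>\<^sup>2 / 16))"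
        unfolding Q_def X_def evol(2)[OF t, symmetric]
        using eps by (intro l2_interpolation C2e[OF t] zn_e[OF t] evol(1)[OF t]) auto
      then have "\<epsilon>\<^sup>2 * Q t \<le> \<epsilon>\<^sup>2 * (\<epsilon>\<^sup>2 / 16 * X t + Y t / (4 * (\<epsilon>\<^sup>2 / 16)))" by (rule mult_left_mono) simp
      also have "\<dots> = \<epsilon> ^ 4 * X t / 16 + 4 * Y t" using eps by (simp add: field_simps power2_eq_square power4_eq_xxxx)
      finally have 1: "\<epsilon>\<^sup>2 * Q t \<le> \<epsilon> ^ 4 * X t / 16 + 4 * Y t" .
      have 2: "\<epsilon> ^ 4 * Q t \<le> \<epsilon>\<^sup>2 * Q t" using eps nonneg by (intro mult_right_mono power_decreasing) auto
      have 3: "13 / (8 * \<epsilon>) * X4 t \<le> 7 / (4 * \<epsilon>) * X4 t"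
      proof (rule mult_right_mono)
        show "13 / (8 * \<epsilon>) \<le> 7 / (4 * \<epsilon>)" using eps by (simp add: field_simps)
      qed (rule nonneg)
      have "0 \<le> \<epsilon> ^ 4 * X t" using eps nonneg by simp
      then show "\<epsilon> ^ 4 * (Q t + X t) + 13 / (8 * \<epsilon>) * X4 t \<le> Dis t + 4 * b"
        using 1 2 3 Yb[OF t] unfolding Dis_def by (simp add: distrib_left)
    qed (use eps in \<open>auto intro!: integrable_continuous_real continuous_intros Qc Xc X4c Dc\<close>)
    also have "\<dots> = integral {0..T} Dis + 4 * T * b"
      using T by (subst integral_add) (auto intro!: integrable_continuous_real continuous_intros Dc)
    finally show ?thesis using Db by linarith
  qed
  have I0: "0 \<le> integral {0..T} (\<lambda>t. Q t + X t)" "0 \<le> integral {0..T} X4"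
    using nonneg by (auto intro!: integral_nonneg integrable_continuous_real continuous_intros Qc Xc X4c)
  have "error_functional T \<epsilon> e
     \<le> ennreal b + ennreal (\<epsilon> ^ 4) * ennreal (integral {0..T} (\<lambda>t. Q t + X t)) + ennreal (13 / (8 * \<epsilon>)) * ennreal (integral {0..T} X4)"
    unfolding error_functional_def n1 n2 by (intro add_right_mono sup)
  also have "\<dots> = ennreal (b + (\<epsilon> ^ 4 * integral {0..T} (\<lambda>t. Q t + X t) + 13 / (8 * \<epsilon>) * integral {0..T} X4))"
    using eps I0 b0 by (simp add: ennreal_mult[symmetric] ennreal_plus[symmetric] add.assoc del: ennreal_plus)
  also have "\<dots> \<le> ennreal (b + (T * (\<Lambda> * b + S) + 4 * T * b))" using int by (intro ennreal_leI) simp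
  also have "b + (T * (\<Lambda> * b + S) + 4 * T * b) = S * (T * exp (\<Lambda> * T) * (1 + \<Lambda> * T + 4 * T) + T)"
    by (simp add: b_def algebra_simps)
  finally show ?thesis by (simp only: e_def)
qed

text \<open>The term with \<open>\<alpha>\<close> in the lower bound for \<open>\<gamma>\<close> is nonnegative and the rest is \<open>7 + 6 / (r - 2) \<ge> 16\<close>. The
  resulting bound on \<open>K\<close> makes \<open>2 * K - 6\<close>, the order in \<open>\<epsilon>\<close> of the error, exceed \<open>17\<close>, the order of
  the threshold below which the cubic term is absorbed.\<close>

lemma gamma_bound:
  fixes \<alpha> \<gamma> K r :: real
  assumes "2 < r" "r \<le> 8/3" "\<alpha> > 0" "\<gamma> > ((7 - 2 * \<alpha>) * r + 6 * \<alpha> - 8) / (r - 2)" "3/2 * (K - 1) \<ge> \<gamma>"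
  shows "K > 35/3" "\<gamma> - 1 \<le> 2 * K - 6"
proof -
  have "0 \<le> \<alpha> * (6 - 2 * r)" using assms by (intro mult_nonneg_nonneg) auto
  moreover have "((7 - 2 * \<alpha>) * r + 6 * \<alpha> - 8) = 7 * r - 8 + \<alpha> * (6 - 2 * r)" by (simp add: algebra_simps)
  moreover have "16 * (r - 2) \<le> 7 * r - 8" using assms(2) by simp
  ultimately have "16 * (r - 2) \<le> (7 - 2 * \<alpha>) * r + 6 * \<alpha> - 8" by simp
  then have "16 \<le> ((7 - 2 * \<alpha>) * r + 6 * \<alpha> - 8) / (r - 2)" using assms(1) by (simp add: pos_le_divide_eq)
  then have g: "\<gamma> > 16" using assms(4) by linarith
  then show "K > 35/3" using assms(5) by (simp add: field_simps)
  then show "\<gamma> - 1 \<le> 2 * K - 6" using assms(5) by (simp add: field_simps)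
qed

theorem theorem6p1:
  fixes T K lam r \<epsilon>\<^sub>1 :: real
    and \<Gamma>\<^sub>0 :: "(real^'n) set"
    and \<Gamma> :: "real \<Rightarrow> (real^'n) set"
    and v :: "real \<Rightarrow> real^'n \<Rightarrow> real"
    and uA wA rA :: "real \<Rightarrow> real \<Rightarrow> real^'n \<Rightarrow> real"
  assumes "CARD('n) \<in> {2, 3}"
    and "T > 0"
    and "hele_shaw_solution T lam \<Gamma>\<^sub>0 v \<Gamma>"
    and "K > 0"
    and "0 < \<epsilon>\<^sub>1" "\<epsilon>\<^sub>1 \<le> 1"
    and "ch_approximation T K \<epsilon>\<^sub>1 v uA wA rA"
    and "2 < r" "r \<le> 8/3"
  shows "\<exists>\<epsilon>\<^sub>0\<in>{0<..\<epsilon>\<^sub>1}. \<exists>C>0. \<forall>\<alpha> \<gamma>.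
    \<alpha> > 0 \<and> \<gamma> > ((7 - 2 * \<alpha>) * r + 6 * \<alpha> - 8) / (r - 2) \<and> 3/2 * (K - 1) \<ge> \<gamma> \<longrightarrow>
    (\<forall>\<epsilon>\<in>{0<..\<epsilon>\<^sub>0}. \<forall>uD wD. ch_solution T \<epsilon> (uA \<epsilon> 0) uD wD \<longrightarrow>
       (SUP t\<in>{0..T}. ennreal ((Hm1_norm (\<lambda>x. uD t x - uA \<epsilon> t x))\<^sup>2))
       + ennreal (\<epsilon> ^ 4) *
           (\<integral>\<^sup>+t. ennreal ((H1_norm (\<lambda>x. uD t x - uA \<epsilon> t x))\<^sup>2) \<partial>lebesgue_on {0<..<T})
       + ennreal (13 / (8 * \<epsilon>)) *
           (\<integral>\<^sup>+t. ennreal ((Lp_norm 4 (\<lambda>x. uD t x - uA \<epsilon> t x)) ^ 4) \<partial>lebesgue_on {0<..<T})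
       \<le> ennreal (C * \<epsilon> powr (\<gamma> - 1)))"
proof (cases "K > 35/3")
  case False
  then have "\<not> (\<alpha> > 0 \<and> \<gamma> > ((7 - 2 * \<alpha>) * r + 6 * \<alpha> - 8) / (r - 2) \<and> 3/2 * (K - 1) \<ge> \<gamma>)" for \<alpha> \<gamma>
    using gamma_bound(1)[OF assms(8,9)] by blast
  then show ?thesis
    using assms(5) by (intro bexI[of _ \<epsilon>\<^sub>1] exI[of _ 1]) auto
next
  case K: True
  obtain C C\<^sub>0 where C: "C \<ge> 0" "C\<^sub>0 \<ge> 0" and app: "\<forall>\<epsilon>\<in>{0<..\<epsilon>\<^sub>1}.
       ch_system T \<epsilon> (rA \<epsilon>) (uA \<epsilon>) (wA \<epsilon>) \<and>
       (\<forall>t\<in>{0<..<T}. zero_normal_deriv (wA \<epsilon> t)) \<and>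
       (\<forall>t\<in>{0<..<T}. \<forall>x\<in>cube.
          \<bar>rA \<epsilon> t x\<bar> \<le> C * \<epsilon> powr (K - 2) \<and>
          \<bar>wA \<epsilon> t x - v t x\<bar> \<le> C * \<epsilon> \<and>
          \<bar>uA \<epsilon> t x\<bar> \<le> C) \<and>
       (\<forall>t\<in>{0..T}. \<forall>g. H1 g \<and> (LINT x|lebesgue_on cube. g x) = 0 \<longrightarrow>
          (LINT x|lebesgue_on cube.
              \<epsilon> * (norm (weak_grad g x))\<^sup>2 + 1/\<epsilon> * deriv ch_f (uA \<epsilon> t x) * (g x)\<^sup>2)
            \<ge> - C\<^sub>0 * (Hm1_norm g)\<^sup>2)"
    using assms(7) unfolding ch_approximation_def by (elim exE conjE)
  define M where "M = 1 + 32 * (6 * C) + 32 * (6 * C)\<^sup>2"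
  have M: "M \<ge> 1" "32 * (6 * C) + 32 * (6 * C)\<^sup>2 \<le> M\<^sup>2"
  proof -
    show M1: "M \<ge> 1" using C by (simp add: M_def)
    have "32 * (6 * C) + 32 * (6 * C)\<^sup>2 \<le> M" by (simp add: M_def)
    also have "M \<le> M\<^sup>2" using M1 by (simp add: power2_eq_square)
    finally show "32 * (6 * C) + 32 * (6 * C)\<^sup>2 \<le> M\<^sup>2" .
  qed
  define \<kappa> where "\<kappa> = 393216 * M ^ 5 * (6 * C + 1)\<^sup>2"
  have kappa: "\<kappa> > 0" unfolding \<kappa>_def using M(1) C by (intro mult_pos_pos) auto
  define \<Lambda> where "\<Lambda> = 2 * C\<^sub>0 + 16"
  define L where "L = C\<^sup>2 * T * exp (\<Lambda> * T) * \<kappa>"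
  have L: "L \<ge> 0" unfolding L_def using kappa assms(2) by (intro mult_nonneg_nonneg) auto
  define p where "p = 2 * K - 23"
  have p: "p > 0" using K by (simp add: p_def)
  \<comment> \<open>chosen so that \<open>L * \<epsilon> powr p < 1\<close> for \<open>\<epsilon> \<le> \<epsilon>\<^sub>0\<close>, which is the smallness condition\<close>
  define \<epsilon>\<^sub>0 where "\<epsilon>\<^sub>0 = min \<epsilon>\<^sub>1 ((1 / (L + 1)) powr (1 / p))"
  have e0: "\<epsilon>\<^sub>0 \<in> {0<..\<epsilon>\<^sub>1}" using assms(5) L by (simp add: \<epsilon>\<^sub>0_def)
  define C' where "C' = C\<^sup>2 * (T * exp (\<Lambda> * T) * (1 + \<Lambda> * T + 4 * T) + T) + 1"
  have C': "C' > 0"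
  proof -
    have "0 \<le> C\<^sup>2 * (T * exp (\<Lambda> * T) * (1 + \<Lambda> * T + 4 * T) + T)"
      using C assms(2) by (intro mult_nonneg_nonneg add_nonneg_nonneg) (auto simp: \<Lambda>_def)
    then show ?thesis by (simp add: C'_def)
  qed
  have main: "error_functional T \<epsilon> (\<lambda>t x. uD t x - uA \<epsilon> t x) \<le> ennreal (C' * \<epsilon> powr (\<gamma> - 1))"
    if par: "\<alpha> > 0 \<and> \<gamma> > ((7 - 2 * \<alpha>) * r + 6 * \<alpha> - 8) / (r - 2) \<and> 3/2 * (K - 1) \<ge> \<gamma>"
      and \<epsilon>: "\<epsilon> \<in> {0<..\<epsilon>\<^sub>0}" and D: "ch_solution T \<epsilon> (uA \<epsilon> 0) uD wD" for \<alpha> \<gamma> \<epsilon> uD wD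
  proof -
    have eps: "0 < \<epsilon>" "\<epsilon> \<le> 1" "\<epsilon> \<in> {0<..\<epsilon>\<^sub>1}" using \<epsilon> e0 assms(6) by auto
    define S where "S = (C * \<epsilon> powr (K - 2))\<^sup>2 / \<epsilon>\<^sup>2"
    have S: "S = C\<^sup>2 * \<epsilon> powr (2 * K - 6)"
    proof -
      have "(\<epsilon> powr (K - 2))\<^sup>2 = \<epsilon> powr (2 * K - 4)"
        using eps by (simp add: power2_eq_square flip: powr_add)
      moreover have "\<epsilon>\<^sup>2 = \<epsilon> powr 2" using eps by (simp add: powr_numeral)
      moreover have "\<epsilon> powr (2 * K - 4) / \<epsilon> powr 2 = \<epsilon> powr (2 * K - 6)" by (simp flip: powr_diff)
      ultimately show ?thesis by (simp only: S_def power_mult_distrib times_divide_eq_right[symmetric])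
    qed
    have small: "S * T * exp (\<Lambda> * T) < \<epsilon> ^ 17 / \<kappa>"
    proof -
      have "\<epsilon> powr p \<le> ((1 / (L + 1)) powr (1 / p)) powr p"
        using \<epsilon> p by (intro powr_mono2) (auto simp: \<epsilon>\<^sub>0_def)
      also have "\<dots> = 1 / (L + 1)" using p L by (simp add: powr_powr)
      finally have "L * \<epsilon> powr p \<le> L * (1 / (L + 1))" using L by (rule mult_left_mono)
      also have "\<dots> < 1" using L by simp
      finally have "L * \<epsilon> powr p * \<epsilon> ^ 17 < 1 * \<epsilon> ^ 17" using eps by (intro mult_strict_right_mono) auto
      moreover have "\<epsilon> powr p * \<epsilon> ^ 17 = \<epsilon> powr (2 * K - 6)"
      proof -
        have "\<epsilon> ^ 17 = \<epsilon> powr 17" using eps by (simp add: powr_numeral)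
        then show ?thesis by (simp add: p_def flip: powr_add)
      qed
      ultimately have "L * \<epsilon> powr (2 * K - 6) < \<epsilon> ^ 17" by (simp add: mult.assoc)
      then have "S * T * exp (\<Lambda> * T) * \<kappa> < \<epsilon> ^ 17" by (simp add: S L_def mult_ac)
      then show ?thesis using kappa by (simp add: pos_less_divide_eq)
    qed
    have app\<epsilon>: "ch_system T \<epsilon> (rA \<epsilon>) (uA \<epsilon>) (wA \<epsilon>)" "\<And>t. t \<in> {0<..<T} \<Longrightarrow> zero_normal_deriv (wA \<epsilon> t)"
       "\<And>t x. t \<in> {0<..<T} \<Longrightarrow> x \<in> cube \<Longrightarrow> \<bar>rA \<epsilon> t x\<bar> \<le> C * \<epsilon> powr (K - 2)"
       "\<And>t x. t \<in> {0<..<T} \<Longrightarrow> x \<in> cube \<Longrightarrow> \<bar>uA \<epsilon> t x\<bar> \<le> C"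
       "\<And>t g. t \<in> {0..T} \<Longrightarrow> H1 g \<Longrightarrow> cint g = 0 \<Longrightarrow>
          cint (\<lambda>x. \<epsilon> * (norm (weak_grad g x))\<^sup>2 + 1/\<epsilon> * deriv ch_f (uA \<epsilon> t x) * (g x)\<^sup>2) \<ge> - C\<^sub>0 * (Hm1_norm g)\<^sup>2"
      using bspec[OF app eps(3)] by simp_all
    have "error_functional T \<epsilon> (\<lambda>t x. uD t x - uA \<epsilon> t x)
        \<le> ennreal (S * (T * exp (\<Lambda> * T) * (1 + \<Lambda> * T + 4 * T) + T))"
    proof (rule difference_estimate[OF _ assms(2) eps(1,2) app\<epsilon>(1,2) D C(1) app\<epsilon>(4) _ app\<epsilon>(3) C(2) app\<epsilon>(5) M \<Lambda>_def S_def])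
      show "CARD('n) \<le> 3" using assms(1) by auto
      show "0 \<le> C * \<epsilon> powr (K - 2)" using C by simp
      show "S * T * exp (\<Lambda> * T) < \<epsilon> ^ 17 / (393216 * M ^ 5 * (6 * C + 1)\<^sup>2)" using small by (simp only: \<kappa>_def)
    qed
    also have "\<dots> \<le> ennreal (C' * \<epsilon> powr (\<gamma> - 1))"
    proof (rule ennreal_leI)
      have g: "\<gamma> - 1 \<le> 2 * K - 6" using gamma_bound(2)[OF assms(8,9)] par by blast
      have "S * (T * exp (\<Lambda> * T) * (1 + \<Lambda> * T + 4 * T) + T) = (C' - 1) * \<epsilon> powr (2 * K - 6)"
        by (simp add: S C'_def)
      also have "\<dots> \<le> C' * \<epsilon> powr (2 * K - 6)" by (intro mult_right_mono) auto
      also have "\<dots> \<le> C' * \<epsilon> powr (\<gamma> - 1)"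
        using C' eps g by (intro mult_left_mono powr_mono') auto
      finally show "S * (T * exp (\<Lambda> * T) * (1 + \<Lambda> * T + 4 * T) + T) \<le> C' * \<epsilon> powr (\<gamma> - 1)" .
    qed
    finally show ?thesis .
  qed
  show ?thesis
    by (intro bexI[OF _ e0] exI[of _ C'] conjI allI impI ballI)
       (rule C', (rule main[unfolded error_functional_def]; assumption))
qed

end
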